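(* Let $x\in\{l,u,b\}$ and view $[\![P]\!]$ as a map $S\to\mathcal P_x\mathcal V(S)$. For all programs $P,Q$ not containing $\parallel$, all states $s$, atomic programs $\mathtt a$ and conditions $\mathtt b$: $[\![\mathtt{skip}]\!](s)=x(\{\delta_s\})$; $[\![\mathtt a]\!](s)=x(\{[\![\mathtt a]\!](s)\})$; $[\![P;Q]\!]=[\![Q]\!]^\star\circ[\![P]\!]$; $[\![P+_{\mathtt p}Q]\!](s)=\mathtt p\cdot[\![P]\!](s)+(1-\mathtt p)\cdot[\![Q]\!](s)$; $[\![P+Q]\!](s)=[\![P]\!](s)\uplus[\![Q]\!](s)$; $[\![\mathtt{if}\ \mathtt b\ \mathtt{then}\ P\ \mathtt{else}\ Q]\!](s)$ equals $[\![P]\!](s)$ if $[\![\mathtt b]\!](s)=\mathtt{tt}$ and $[\![Q]\!](s)$ otherwise; and $[\![\mathtt{while}\ \mathtt b\ P]\!]$ is the least fixpoint of the map $f\mapsto\big(s\mapsto \eta(s)\text{ if }[\![\mathtt b]\!](s)=\mathtt{ff},\ f^\star([\![P]\!](s))\text{ if }[\![\mathtt b]\!](s)=\mathtt{tt}\big)$ on the pointwise-ordered dcpo of maps $S\to\mathcal P_x\mathcal V(S)$.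
   Context: Setting: a set $S$ of states (discrete); finitely supported (sub)probability distributions $\mathcal V_{=1,\omega}(X)$, $\mathcal V_{\le1,\omega}(X)$ written $\sum_ip_i\cdot x_i$, $\bot$ zero distribution, $\delta_s$ point mass. Programs $P::=\mathtt{skip}\mid\mathtt a\mid P;P\mid P\parallel P\mid P+_{\mathtt p}P\mid P+P\mid\mathtt{if}\ \mathtt b\ \mathtt{then}\ P\ \mathtt{else}\ P\mid\mathtt{while}\ \mathtt b\ P$ with given $[\![\mathtt a]\!]:S\to\mathcal V_{=1,\omega}(S)$, $[\![\mathtt b]\!]:S\to\{\mathtt{tt},\mathtt{ff}\}$. Small-step $\longrightarrow\subseteq(\mathrm{Pr}\times S)\times\mathcal V_{=1,\omega}(S+\mathrm{Pr}\times S)$: least relation with $\langle\mathtt a,s\rangle\to[\![\mathtt a]\!](s)$; $\langle\mathtt{skip},s\rangle\to1\cdot s$; if $\langle P,s\rangle\to\sum_ip_i\langle P_i,s_i\rangle+\sum_jp_js_j$ then $\langle P;Q,s\rangle\to\sum_ip_i\langle P_i;Q,s_i\rangle+\sum_jp_j\langle Q,s_j\rangle$ and $\langle P\parallel Q,s\rangle\to\sum_ip_i\langle P_i\parallel Q,s_i\rangle+\sum_jp_j\langle Q,s_j\rangle$; symmetric rule for $\parallel$ with $Q$ stepping; $\langle P+_{\mathtt p}Q,s\rangle\to\mathtt p\mu+(1-\mathtt p)\nu$ if $\langle P,s\rangle\to\mu,\langle Q,s\rangle\to\nu$; $\langle P+Q,s\rangle\to\mu$ if $\langle P,s\rangle\to\mu$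 or $\langle Q,s\rangle\to\mu$; $\mathtt{if}$ steps with probability 1 to $\langle P,s\rangle$/$\langle Q,s\rangle$ according to $[\![\mathtt b]\!](s)=\mathtt{tt}/\mathtt{ff}$; $\langle\mathtt{while}\ \mathtt b\ P,s\rangle\to1\cdot\langle P;\mathtt{while}\ \mathtt b\ P,s\rangle$ if $\mathtt{tt}$, $\to1\cdot s$ if $\mathtt{ff}$. $\mathcal V(S)$: continuous valuations on discrete $S$ (pointwise order). Powercones on a continuous d-cone $C$: $\mathcal P_l(C)$ (nonempty Scott-closed convex sets, order by inclusion of down-closures), $\mathcal P_u(C)$ (nonempty compact saturated convex sets, reverse inclusion of up-closures), $\mathcal P_b(C)$ (nonempty convex Lawson-compact order-convex sets, both); basic elements $l(F)=\overline{\mathrm{conv}F}$, $u(F)={\uparrow}\mathrm{conv}F$, $b(F)=l(F)\cap u(F)$ for finite $F$. Operations on $\mathcal P_x\mathcal V(S)$, defined on basic elements and extended continuously: $x(F)+x(G)=x(F+G)$ (Minkowski sum), $r\cdot x(F)=x(r\cdot F)$, $x(F)\uplus x(G)=x(F\cup G)$. Unit $\eta(s)=x(\{\delta_s\})$; for $f:S\to\mathcal P_x\mathcal V(S)$, $f^\star:\mathcal P_x\mathcal V(S)\to\mathcal P_x\mathcal V(S)$ is given on basic elements by $f^\star(x(F))=\biguplus\{\sum_ir_i\cdot f(s_i)\mid\sum_ir_i\cdot s_i\in F\}$. Sets $F_n(P,s)\subseteq\mathcal V_{\le1,\omega}(S)$: $F_0=\{\bot\}$, $F_{n+1}(P,s)=\bigcup\{\sum_ip_i\cdot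 F_n(P_i,s_i)+\sum_jp_j\cdot\delta_{s_j}\mid\langle P,s\rangle\to\sum_ip_i\langle P_i,s_i\rangle+\sum_jp_js_j\}$. The (extensional) denotational semantics satisfies, and may be taken as defined by, $[\![P]\!](s)=\bigvee_nx(F_n(P,s))$ (directed supremum). *)

theory Defs
  imports "HOL-Analysis.Analysis"
begin

definition directed_by :: "('a \<Rightarrow> 'a \<Rightarrow> bool) \<Rightarrow> 'a set \<Rightarrow> bool" where
  "directed_by le D \<longleftrightarrow> D \<noteq> {} \<and> (\<forall>a\<in>D. \<forall>b\<in>D. \<exists>c\<in>D. le a c \<and> le b c)"

definition is_lub_in :: "'a set \<Rightarrow> ('a \<Rightarrow> 'a \<Rightarrow> bool) \<Rightarrow> 'a set \<Rightarrow> 'a \<Rightarrow> bool" where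
  "is_lub_in C le D y \<longleftrightarrow> y \<in> C \<and> (\<forall>d\<in>D. le d y) \<and> (\<forall>z\<in>C. (\<forall>d\<in>D. le d z) \<longrightarrow> le y z)"

definition scott_open :: "'a set \<Rightarrow> ('a \<Rightarrow> 'a \<Rightarrow> bool) \<Rightarrow> 'a set \<Rightarrow> bool" where
  "scott_open C le U \<longleftrightarrow> U \<subseteq> C \<and> (\<forall>a\<in>U. \<forall>b\<in>C. le a b \<longrightarrow> b \<in> U) \<and>
     (\<forall>D y. D \<subseteq> C \<longrightarrow> directed_by le D \<longrightarrow> is_lub_in C le D y \<longrightarrow> y \<in> U \<longrightarrow> D \<inter> U \<noteq> {})"

definition scott_top :: "'a set \<Rightarrow> ('a \<Rightarrow> 'a \<Rightarrow> bool) \<Rightarrow> 'a topology" where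
  "scott_top C le = topology_generated_by {U. scott_open C le U}"

definition lawson_top :: "'a set \<Rightarrow> ('a \<Rightarrow> 'a \<Rightarrow> bool) \<Rightarrow> 'a topology" where
  "lawson_top C le = topology_generated_by
     ({U. scott_open C le U} \<union> {C - {y\<in>C. le a y} | a. a \<in> C})"

type_synonym 's val = "'s set \<Rightarrow> ennreal"

text \<open>Continuous valuations on the discrete space S (every subset is open).\<close>
definition cval :: "'s val set" where
  "cval = {v. v {} = 0 \<and> (\<forall>U V. U \<subseteq> V \<longrightarrow> v U \<le> v V) \<and>
              (\<forall>U V. v U + v V = v (U \<union> V) + v (U \<inter> V)) \<and>
              (\<forall>\<D>. \<D> \<noteq> {} \<and> (\<forall>A\<in>\<D>. \<forall>B\<in>\<D>. \<exists>C\<in>\<D>. A \<union> B \<subseteq> C) \<longrightarrow>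
                    v (\<Union>\<D>) = (SUP U\<in>\<D>. v U))}"

definition vzero :: "'s val" where "vzero = (\<lambda>U. 0)"
definition vdelta :: "'s \<Rightarrow> 's val" where "vdelta s = (\<lambda>U. if s \<in> U then 1 else 0)"
definition vadd :: "'s val \<Rightarrow> 's val \<Rightarrow> 's val" where "vadd v w = (\<lambda>U. v U + w U)"
definition vscale :: "real \<Rightarrow> 's val \<Rightarrow> 's val" where "vscale r v = (\<lambda>U. ennreal r * v U)"

definition vconv :: "'s val set \<Rightarrow> 's val set" where
  "vconv F = {(\<lambda>U. \<Sum>i<n. ennreal (p i) * v i U) | (n::nat) p v.
                 n > 0 \<and> (\<forall>i<n. 0 \<le> p i \<and> v i \<in> F) \<and> (\<Sum>i<n. p i) = 1}"

definition vconvex :: "'s val set \<Rightarrow> bool" where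
  "vconvex A \<longleftrightarrow> (\<forall>a\<in>A. \<forall>b\<in>A. \<forall>p::real. 0 \<le> p \<and> p \<le> 1 \<longrightarrow> vadd (vscale p a) (vscale (1 - p) b) \<in> A)"

definition upc :: "'s val set \<Rightarrow> 's val set" where
  "upc A = {y \<in> cval. \<exists>a\<in>A. a \<le> y}"

definition dnc :: "'s val set \<Rightarrow> 's val set" where
  "dnc A = {y \<in> cval. \<exists>a\<in>A. y \<le> a}"

definition order_convex :: "'s val set \<Rightarrow> bool" where
  "order_convex A \<longleftrightarrow> (\<forall>a\<in>A. \<forall>c\<in>A. \<forall>b\<in>cval. a \<le> b \<and> b \<le> c \<longrightarrow> b \<in> A)"

definition VS :: "'s val topology" where "VS = scott_top cval (\<le>)"
definition VL :: "'s val topology" where "VL = lawson_top cval (\<le>)"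

definition vminkowski :: "'s val set \<Rightarrow> 's val set \<Rightarrow> 's val set" where
  "vminkowski F G = {vadd a b | a b. a \<in> F \<and> b \<in> G}"

definition simple_val :: "'s val \<Rightarrow> bool" where
  "simple_val v \<longleftrightarrow> (\<exists>S w. finite S \<and> (\<forall>s. 0 \<le> w s) \<and>
       v = (\<lambda>U. \<Sum>s\<in>S. if s \<in> U then ennreal (w s) else 0))"

definition basicF :: "'s val set \<Rightarrow> bool" where
  "basicF F \<longleftrightarrow> finite F \<and> F \<noteq> {} \<and> F \<subseteq> {v. simple_val v}"

datatype pk = PL | PU | PB

fun PC :: "pk \<Rightarrow> 's val set set" where
  "PC PL = {A. A \<noteq> {} \<and> closedin VS A \<and> vconvex A}"
| "PC PU = {A. A \<noteq> {} \<and> compactin VS A \<and> upc A = A \<and> vconvex A}"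
| "PC PB = {A. A \<noteq> {} \<and> vconvex A \<and> compactin VL A \<and> order_convex A}"

fun pc_le :: "pk \<Rightarrow> 's val set \<Rightarrow> 's val set \<Rightarrow> bool" where
  "pc_le PL A B \<longleftrightarrow> dnc A \<subseteq> dnc B"
| "pc_le PU A B \<longleftrightarrow> upc B \<subseteq> upc A"
| "pc_le PB A B \<longleftrightarrow> dnc A \<subseteq> dnc B \<and> upc B \<subseteq> upc A"

fun basic :: "pk \<Rightarrow> 's val set \<Rightarrow> 's val set" where
  "basic PL F = VS closure_of (vconv F)"
| "basic PU F = upc (vconv F)"
| "basic PB F = (VS closure_of (vconv F)) \<inter> upc (vconv F)"

definition pc_lub :: "pk \<Rightarrow> 's val set set \<Rightarrow> 's val set" where
  "pc_lub x D = (THE y. is_lub_in (PC x) (pc_le x) D y)"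

definition pc_cont :: "pk \<Rightarrow> ('s val set \<Rightarrow> 's val set) \<Rightarrow> bool" where
  "pc_cont x h \<longleftrightarrow> (\<forall>A\<in>PC x. h A \<in> PC x) \<and> (\<forall>A. A \<notin> PC x \<longrightarrow> h A = {}) \<and>
     (\<forall>D y. D \<subseteq> PC x \<longrightarrow> directed_by (pc_le x) D \<longrightarrow> is_lub_in (PC x) (pc_le x) D y \<longrightarrow>
            is_lub_in (PC x) (pc_le x) (h ` D) (h y))"

definition pc_cont2 :: "pk \<Rightarrow> ('s val set \<Rightarrow> 's val set \<Rightarrow> 's val set) \<Rightarrow> bool" where
  "pc_cont2 x h \<longleftrightarrow> (\<forall>A\<in>PC x. pc_cont x (h A)) \<and> (\<forall>B\<in>PC x. pc_cont x (\<lambda>A. h A B)) \<and>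
     (\<forall>A B. A \<notin> PC x \<longrightarrow> h A B = {})"

definition padd :: "pk \<Rightarrow> 's val set \<Rightarrow> 's val set \<Rightarrow> 's val set" where
  "padd x = (THE h. pc_cont2 x h \<and>
     (\<forall>F G. basicF F \<longrightarrow> basicF G \<longrightarrow> h (basic x F) (basic x G) = basic x (vminkowski F G)))"

definition punion :: "pk \<Rightarrow> 's val set \<Rightarrow> 's val set \<Rightarrow> 's val set" where
  "punion x = (THE h. pc_cont2 x h \<and>
     (\<forall>F G. basicF F \<longrightarrow> basicF G \<longrightarrow> h (basic x F) (basic x G) = basic x (F \<union> G)))"

definition pscale :: "pk \<Rightarrow> real \<Rightarrow> 's val set \<Rightarrow> 's val set" where
  "pscale x r = (THE h. pc_cont x h \<and>
     (\<forall>F. basicF F \<longrightarrow> h (basic x F) = basic x (vscale r ` F)))"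

definition pzero :: "pk \<Rightarrow> 's val set" where "pzero x = basic x {vzero}"

definition peta :: "pk \<Rightarrow> 's \<Rightarrow> 's val set" where "peta x s = basic x {vdelta s}"

text \<open>For a simple valuation v = \<Sum> r_i s_i, the element \<Sum> r_i f(s_i).\<close>
definition psum :: "pk \<Rightarrow> ('s \<Rightarrow> 's val set) \<Rightarrow> 's val \<Rightarrow> 's val set" where
  "psum x f v = Finite_Set.fold (\<lambda>s A. padd x (pscale x (enn2real (v {s})) (f s)) A)
                  (pzero x) {s. v {s} \<noteq> 0}"

definition pbig :: "pk \<Rightarrow> 's val set set \<Rightarrow> 's val set" where
  "pbig x \<A> = Finite_Set.fold (punion x) (SOME A. A \<in> \<A>) \<A>"

definition kleisli :: "pk \<Rightarrow> ('s \<Rightarrow> 's val set) \<Rightarrow> 's val set \<Rightarrow> 's val set" where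
  "kleisli x f = (THE h. pc_cont x h \<and>
     (\<forall>F. basicF F \<longrightarrow> h (basic x F) = pbig x (psum x f ` F)))"

datatype ('at, 'bc) prog =
    Skip
  | Atom 'at
  | Seq "('at, 'bc) prog" "('at, 'bc) prog"
  | Par "('at, 'bc) prog" "('at, 'bc) prog"
  | PCh real "('at, 'bc) prog" "('at, 'bc) prog"
  | NCh "('at, 'bc) prog" "('at, 'bc) prog"
  | If 'bc "('at, 'bc) prog" "('at, 'bc) prog"
  | While 'bc "('at, 'bc) prog"

fun nopar :: "('at, 'bc) prog \<Rightarrow> bool" where
  "nopar Skip = True"
| "nopar (Atom a) = True"
| "nopar (Seq P Q) = (nopar P \<and> nopar Q)"
| "nopar (Par P Q) = False"
| "nopar (PCh p P Q) = (0 \<le> p \<and> p \<le> 1 \<and> nopar P \<and> nopar Q)"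
| "nopar (NCh P Q) = (nopar P \<and> nopar Q)"
| "nopar (If b P Q) = (nopar P \<and> nopar Q)"
| "nopar (While b P) = nopar P"

definition fdist :: "('x \<Rightarrow> real) \<Rightarrow> bool" where
  "fdist \<mu> \<longleftrightarrow> finite {z. \<mu> z \<noteq> 0} \<and> (\<forall>z. 0 \<le> \<mu> z) \<and> (\<Sum>z\<in>{z. \<mu> z \<noteq> 0}. \<mu> z) = 1"

definition push :: "('x \<Rightarrow> 'y) \<Rightarrow> ('x \<Rightarrow> real) \<Rightarrow> 'y \<Rightarrow> real" where
  "push g \<mu> = (\<lambda>y. \<Sum>z\<in>{z. \<mu> z \<noteq> 0 \<and> g z = y}. \<mu> z)"

definition point :: "'x \<Rightarrow> 'x \<Rightarrow> real" where
  "point y = (\<lambda>z. if z = y then 1 else 0)"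

type_synonym ('at, 'bc, 's) conf = "('at, 'bc) prog \<times> 's"
type_synonym ('at, 'bc, 's) sdist = "'s + ('at, 'bc) prog \<times> 's \<Rightarrow> real"

definition seqmap :: "('at, 'bc) prog \<Rightarrow> 's + ('at, 'bc) prog \<times> 's \<Rightarrow> 's + ('at, 'bc) prog \<times> 's" where
  "seqmap Q z = (case z of Inl t \<Rightarrow> Inr (Q, t) | Inr (P', t) \<Rightarrow> Inr (Seq P' Q, t))"

definition parmapL :: "('at, 'bc) prog \<Rightarrow> 's + ('at, 'bc) prog \<times> 's \<Rightarrow> 's + ('at, 'bc) prog \<times> 's" where
  "parmapL Q z = (case z of Inl t \<Rightarrow> Inr (Q, t) | Inr (P', t) \<Rightarrow> Inr (Par P' Q, t))"

definition parmapR :: "('at, 'bc) prog \<Rightarrow> 's + ('at, 'bc) prog \<times> 's \<Rightarrow> 's + ('at, 'bc) prog \<times> 's" where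
  "parmapR P z = (case z of Inl t \<Rightarrow> Inr (P, t) | Inr (Q', t) \<Rightarrow> Inr (Par P Q', t))"

inductive step :: "('at \<Rightarrow> 's \<Rightarrow> 's \<Rightarrow> real) \<Rightarrow> ('bc \<Rightarrow> 's \<Rightarrow> bool) \<Rightarrow>
    ('at, 'bc, 's) conf \<Rightarrow> ('at, 'bc, 's) sdist \<Rightarrow> bool"
  for sa :: "'at \<Rightarrow> 's \<Rightarrow> 's \<Rightarrow> real" and sb :: "'bc \<Rightarrow> 's \<Rightarrow> bool" where
  st_atom: "step sa sb (Atom a, s) (\<lambda>z. case z of Inl t \<Rightarrow> sa a s t | Inr _ \<Rightarrow> 0)"
| st_skip: "step sa sb (Skip, s) (point (Inl s))"
| st_seq: "step sa sb (P, s) \<mu> \<Longrightarrow> step sa sb (Seq P Q, s) (push (seqmap Q) \<mu>)"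
| st_parL: "step sa sb (P, s) \<mu> \<Longrightarrow> step sa sb (Par P Q, s) (push (parmapL Q) \<mu>)"
| st_parR: "step sa sb (Q, s) \<mu> \<Longrightarrow> step sa sb (Par P Q, s) (push (parmapR P) \<mu>)"
| st_pch: "step sa sb (P, s) \<mu> \<Longrightarrow> step sa sb (Q, s) \<nu> \<Longrightarrow>
             step sa sb (PCh p P Q, s) (\<lambda>z. p * \<mu> z + (1 - p) * \<nu> z)"
| st_nchL: "step sa sb (P, s) \<mu> \<Longrightarrow> step sa sb (NCh P Q, s) \<mu>"
| st_nchR: "step sa sb (Q, s) \<mu> \<Longrightarrow> step sa sb (NCh P Q, s) \<mu>"
| st_ifT: "sb b s \<Longrightarrow> step sa sb (If b P Q, s) (point (Inr (P, s)))"
| st_ifF: "\<not> sb b s \<Longrightarrow> step sa sb (If b P Q, s) (point (Inr (Q, s)))"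
| st_whT: "sb b s \<Longrightarrow> step sa sb (While b P, s) (point (Inr (Seq P (While b P), s)))"
| st_whF: "\<not> sb b s \<Longrightarrow> step sa sb (While b P, s) (point (Inl s))"

primrec Fn :: "('at \<Rightarrow> 's \<Rightarrow> 's \<Rightarrow> real) \<Rightarrow> ('bc \<Rightarrow> 's \<Rightarrow> bool) \<Rightarrow> nat \<Rightarrow>
    ('at, 'bc) prog \<Rightarrow> 's \<Rightarrow> 's val set" where
  "Fn sa sb 0 P s = {vzero}"
| "Fn sa sb (Suc n) P s =
     (\<Union>\<mu>\<in>{\<mu>. step sa sb (P, s) \<mu>}.
        {(\<lambda>U. \<Sum>z\<in>{z. \<mu> z \<noteq> 0}. ennreal (\<mu> z) *
               (case z of Inl t \<Rightarrow> (if t \<in> U then 1 else 0) | Inr c \<Rightarrow> g c U)) | g.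
          \<forall>c. \<mu> (Inr c) \<noteq> 0 \<longrightarrow> g c \<in> Fn sa sb n (fst c) (snd c)})"

definition sem :: "pk \<Rightarrow> ('at \<Rightarrow> 's \<Rightarrow> 's \<Rightarrow> real) \<Rightarrow> ('bc \<Rightarrow> 's \<Rightarrow> bool) \<Rightarrow>
    ('at, 'bc) prog \<Rightarrow> 's \<Rightarrow> 's val set" where
  "sem x sa sb P s = pc_lub x (range (\<lambda>n. basic x (Fn sa sb n P s)))"

definition dist_val :: "('s \<Rightarrow> real) \<Rightarrow> 's val" where
  "dist_val \<mu> = (\<lambda>U. \<Sum>t\<in>{t. \<mu> t \<noteq> 0}. if t \<in> U then ennreal (\<mu> t) else 0)"

definition is_lfp :: "pk \<Rightarrow> (('s \<Rightarrow> 's val set) \<Rightarrow> ('s \<Rightarrow> 's val set)) \<Rightarrow> ('s \<Rightarrow> 's val set) \<Rightarrow> bool" where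
  "is_lfp x \<Phi> f \<longleftrightarrow> (\<forall>s. f s \<in> PC x) \<and> \<Phi> f = f \<and>
     (\<forall>g. (\<forall>s. g s \<in> PC x) \<longrightarrow> \<Phi> g = g \<longrightarrow> (\<forall>s. pc_le x (f s) (g s)))"

end

(*
  A continuous valuation on a discrete space S is the same thing as a function S -> [0,oo]. Under this
  identification the Lawson topology is the compact Hausdorff product topology, Scott closed sets are
  the closed lower sets and compact saturated sets are the closed upper sets, so that all three
  powercones consist of closed convex sets. The operations are unique because every element is a
  directed supremum of basic ones; for the upper and biconvex cones this rests on a separation
  theorem, obtained from a finite minimax lemma for affine functions with values in [0,oo]. They exist
  because they can be written down explicitly as images under jointly lower semicontinuous maps of
  products, and Tychonoff's theorem makes such images Scott continuous in all arguments at once.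
  The equations then reduce to Egli-Milner comparisons of the finite sets F_n; for sequential
  composition, F_n(P;Q) lies below F_n(Q)*(F_n(P)), which in turn lies below F_2n(P;Q).
*)
theory Submission
  imports Defs
begin

text \<open>Every operation in the statement is a definite description, so a concrete continuous map
  has to be produced before anything can be computed. The concrete images need not belong to the
  cone: scaling a saturated set by 0 leaves {0}, and with infinite weights a Kleisli image need not
  even be convex. The work is therefore done with generating sets, compared by \<open>ple\<close>
  through their Scott closures and saturations, and \<open>elt\<close> is applied at the end. Lower
  semicontinuity replaces continuity because multiplication on [0,oo], with 0 * oo = 0, is only
  lower semicontinuous; for conditions \<open>\<theta> g h \<le> y\<close> this still gives closed
  solution sets. The Kleisli extension has one argument per state besides the set itself, and in
  sequential composition all of them grow along one chain, so continuity in each argument separately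
  would not suffice. The bound 2n arises because the last step of P hands over to Q without a step
  of its own: n steps of P and n steps of Q fit into n + n steps of P;Q.\<close>

section \<open>Lower semicontinuous functions into [0,oo]\<close>

definition lsc :: "('a::topological_space \<Rightarrow> ennreal) \<Rightarrow> bool" where
  "lsc f \<longleftrightarrow> (\<forall>c. open {x. c < f x})"

lemma lsc_continuous: "continuous_on UNIV f \<Longrightarrow> lsc f"
  unfolding lsc_def by (auto intro!: open_Collect_less continuous_on_const)

lemma lsc_const: "lsc (\<lambda>x. c)"
  by (intro lsc_continuous continuous_on_const)

lemma lsc_comp:
  assumes "lsc f" "continuous_on UNIV k"
  shows "lsc (\<lambda>x. f (k x))"
  unfolding lsc_def
proof
  fix c
  have "open (k -` {x. c < f x})"
    using assms by (intro open_vimage) (auto simp: lsc_def)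
  then show "open {x. c < f (k x)}" by (simp add: vimage_def)
qed

lemma ennreal_SUP_lessThan: "(SUP a\<in>{..<x}. a) = (x::ennreal)"
proof (rule antisym)
  show "(SUP a\<in>{..<x}. a) \<le> x" by (rule SUP_least) auto
  show "x \<le> (SUP a\<in>{..<x}. a)"
  proof (rule dense_le)
    fix y assume "y < x"
    then show "y \<le> (SUP a\<in>{..<x}. a)" by (intro SUP_upper) auto
  qed
qed

text \<open>Each number is the supremum of the strictly smaller ones, and multiplication preserves
  suprema in either factor, so both factors can be lowered in turn without losing the strict bound.
  This yields the open rectangles behind \<open>lsc_mult\<close>.\<close>

lemma less_mult_below:
  assumes "c < x * (y::ennreal)"
  shows "\<exists>a<x. \<exists>b<y. c < a * b"
proof -
  have "x * y = (SUP a\<in>{..<x}. a) * y" by (simp only: ennreal_SUP_lessThan)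
  also have "\<dots> = (SUP a\<in>{..<x}. a * y)"
    by (rule SUP_mult_right_ennreal)
  finally have "c < (SUP a\<in>{..<x}. a * y)" using assms by simp
  then obtain a where a: "a < x" "c < a * y" by (auto simp: less_SUP_iff)
  have "a * y = a * (SUP b\<in>{..<y}. b)" by (simp only: ennreal_SUP_lessThan)
  also have "\<dots> = (SUP b\<in>{..<y}. a * b)"
    by (rule SUP_mult_left_ennreal)
  finally have "c < (SUP b\<in>{..<y}. a * b)" using a by simp
  then obtain b where "b < y" "c < a * b" by (auto simp: less_SUP_iff)
  with a show ?thesis by blast
qed

text \<open>The analogue for sums. Positivity makes the sets of strictly smaller numbers nonempty: a
  summand 0 cannot be undercut.\<close>

lemma less_add_below:
  assumes "c < x + (y::ennreal)" "x > 0" "y > 0"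
  shows "\<exists>a<x. \<exists>b<y. c < a + b"
proof -
  have nx: "{..<x} \<noteq> {}" and ny: "{..<y} \<noteq> {}" using assms by auto
  have "x + y = (SUP a\<in>{..<x}. a) + y" by (simp only: ennreal_SUP_lessThan)
  also have "\<dots> = (SUP a\<in>{..<x}. a + y)"
    using ennreal_SUP_add_left[OF nx, of "\<lambda>a. a" y] by simp
  finally have "c < (SUP a\<in>{..<x}. a + y)" using assms by simp
  then obtain a where a: "a < x" "c < a + y" by (auto simp: less_SUP_iff)
  have "a + y = a + (SUP b\<in>{..<y}. b)" by (simp only: ennreal_SUP_lessThan)
  also have "\<dots> = (SUP b\<in>{..<y}. a + b)"
    using ennreal_SUP_add_right[OF ny, of a "\<lambda>a. a"] by simp
  finally have "c < (SUP b\<in>{..<y}. a + b)" using a by simp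
  then obtain b where "b < y" "c < a + b" by (auto simp: less_SUP_iff)
  with a show ?thesis by blast
qed

lemma lsc_mult:
  assumes "lsc f" "lsc g"
  shows "lsc (\<lambda>x. f x * g x)"
  unfolding lsc_def
proof
  fix c
  have eq: "{x. c < f x * g x} = (\<Union>(a,b)\<in>{(a,b). c < a * b}. {x. a < f x} \<inter> {x. b < g x})"
    (is "?l = ?r")
  proof (intro set_eqI iffI)
    fix x assume "x \<in> ?l"
    then show "x \<in> ?r" using less_mult_below[of c "f x" "g x"] by auto
  next
    fix x assume "x \<in> ?r"
    then obtain a b where "c < a * b" "a < f x" "b < g x" by auto
    then show "x \<in> ?l" using mult_mono[of a "f x" b "g x"] by (auto intro: less_le_trans)
  qed
  show "open ?l" unfolding eq using assms
    by (auto simp: lsc_def intro!: open_Un open_UN open_Int)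
qed

lemma lsc_add:
  assumes "lsc f" "lsc g"
  shows "lsc (\<lambda>x. f x + g x)"
  unfolding lsc_def
proof
  fix c
  \<comment> \<open>The first two sets catch the points where one summand vanishes; elsewhere the
    rectangles suffice.\<close>
  have eq: "{x. c < f x + g x} = {x. c < f x} \<union> {x. c < g x} \<union>
      (\<Union>(a,b)\<in>{(a,b). c < a + b}. {x. a < f x} \<inter> {x. b < g x})"
    (is "?l = ?r")
  proof (intro set_eqI iffI)
    fix x assume "x \<in> ?l"
    then show "x \<in> ?r" using less_add_below[of c "f x" "g x"]
      by (cases "f x = 0"; cases "g x = 0") (auto simp: zero_less_iff_neq_zero)
  next
    fix x assume "x \<in> ?r"
    then consider "c < f x" | "c < g x" | a b where "c < a + b" "a < f x" "b < g x" by auto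
    then show "x \<in> ?l"
    proof cases
      case 1 then show ?thesis by (simp add: less_le_trans[OF _ le_add_same_cancel1[THEN iffD2]] add_increasing2 less_le_trans)
    next
      case 2
      have "g x \<le> f x + g x" by simp
      with 2 show ?thesis by (metis mem_Collect_eq order.strict_trans2)
    next
      case 3 then show ?thesis using add_mono[of a "f x" b "g x"] by (auto intro: less_le_trans)
    qed
  qed
  show "open ?l" unfolding eq using assms
    by (auto simp: lsc_def intro!: open_Un open_UN open_Int)
qed

lemma lsc_sum: "(\<And>i. i \<in> I \<Longrightarrow> lsc (f i)) \<Longrightarrow> lsc (\<lambda>x. \<Sum>i\<in>I. f i x)"
  by (induction I rule: infinite_finite_induct) (auto intro: lsc_const lsc_add)

lemma lsc_SUP:
  assumes "\<And>i. i \<in> I \<Longrightarrow> lsc (f i)"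
  shows "lsc (\<lambda>x. SUP i\<in>I. f i x)"
  unfolding lsc_def
proof
  fix c
  have "{x. c < (SUP i\<in>I. f i x)} = (\<Union>i\<in>I. {x. c < f i x})"
    by (auto simp: less_SUP_iff)
  then show "open {x. c < (SUP i\<in>I. f i x)}" using assms by (auto simp: lsc_def)
qed

text \<open>A failure of the inequality leaves room for a number strictly in between, so the
  complement is a union of open superlevel sets of \<open>f\<close> cut with open sublevel sets of
  \<open>k\<close>.\<close>

lemma closed_lsc_le:
  assumes "lsc f" "continuous_on UNIV k"
  shows "closed {x. f x \<le> k x}"
proof -
  have "- {x. f x \<le> k x} = (\<Union>c. {x. c < f x} \<inter> {x. k x < c})"
  proof (intro set_eqI iffI)
    fix x assume "x \<in> - {x. f x \<le> k x}"
    then have "k x < f x" by (simp add: not_le)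
    then obtain c where "k x < c" "c < f x" using dense by blast
    then show "x \<in> (\<Union>c. {x. c < f x} \<inter> {x. k x < c})" by blast
  next
    fix x assume "x \<in> (\<Union>c. {x. c < f x} \<inter> {x. k x < c})"
    then show "x \<in> - {x. f x \<le> k x}" by (auto simp: not_le intro: less_trans)
  qed
  moreover have "open (\<Union>c. {x. c < f x} \<inter> {x. k x < c})"
    using assms(1) open_Collect_less[OF assms(2) continuous_on_const]
    by (intro open_UN ballI open_Int) (auto simp: lsc_def)
  ultimately show ?thesis by (simp add: closed_def)
qed

lemma continuous_coordinate: "continuous_on UNIV (\<lambda>x::'i \<Rightarrow> ennreal. x i)"
  by (rule continuous_on_product_coordinates)

lemma lsc_coordinate: "lsc (\<lambda>x::'i \<Rightarrow> ennreal. x i)"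
  by (intro lsc_continuous continuous_coordinate)

section \<open>Upper and lower closures; compactness of the function space\<close>

definition upE :: "'a::order set \<Rightarrow> 'a set" where "upE A = {y. \<exists>a\<in>A. a \<le> y}"
definition dnE :: "'a::order set \<Rightarrow> 'a set" where "dnE A = {y. \<exists>a\<in>A. y \<le> a}"

lemma subset_upE: "A \<subseteq> upE A" and subset_dnE: "A \<subseteq> dnE A"
  by (auto simp: upE_def dnE_def)

lemma upE_upE [simp]: "upE (upE A) = upE A" and dnE_dnE [simp]: "dnE (dnE A) = dnE A"
  by (auto simp: upE_def dnE_def intro: order_trans)

lemma upE_mono: "A \<subseteq> B \<Longrightarrow> upE A \<subseteq> upE B" and dnE_mono: "A \<subseteq> B \<Longrightarrow> dnE A \<subseteq> dnE B"
  by (auto simp: upE_def dnE_def)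

lemma upE_eq_empty [simp]: "upE A = {} \<longleftrightarrow> A = {}" and dnE_eq_empty [simp]: "dnE A = {} \<longleftrightarrow> A = {}"
  by (auto simp: upE_def dnE_def)

text \<open>Projection along a compact factor is a closed map, by the tube lemma. Closed upper and
  lower closures and closed images are obtained from it later.\<close>

lemma closed_proj:
  fixes R :: "('a::topological_space \<times> 'b::topological_space) set"
  assumes G: "compact G" and R: "closed R"
  shows "closed {y. \<exists>x\<in>G. (x, y) \<in> R}"
proof -
  have "open {y. \<forall>x\<in>G. (x, y) \<in> - R}"
  proof (subst open_subopen, intro ballI)
    fix y assume "y \<in> {y. \<forall>x\<in>G. (x, y) \<in> - R}"
    then have sub: "G \<times> {y} \<subseteq> - R" by auto
    have "openin (prod_topology euclidean euclidean) (- R)"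
      using R by (simp add: closed_def)
    from tube_lemma_left[OF this _ _ sub] G
    obtain U V where "open V" "G \<subseteq> U" "y \<in> V" "U \<times> V \<subseteq> - R"
      by (auto simp: compactin_euclidean_iff)
    then show "\<exists>T. open T \<and> y \<in> T \<and> T \<subseteq> {y. \<forall>x\<in>G. (x, y) \<in> - R}" by (intro exI[of _ V]) auto
  qed
  moreover have "- {y. \<exists>x\<in>G. (x, y) \<in> R} = {y. \<forall>x\<in>G. (x, y) \<in> - R}" by auto
  ultimately show ?thesis by (simp add: closed_def)
qed

lemma compact_UNIV_ennfun: "compact (UNIV :: ('i \<Rightarrow> ennreal) set)"
proof -
  have "compact_space (product_topology (\<lambda>i::'i. euclidean :: ennreal topology) UNIV)"
  proof -
    have "compact_space (euclidean :: ennreal topology)" by (simp add: compact_space_def compact_UNIV)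
    then show ?thesis by (simp add: compact_space_product_topology)
  qed
  then show ?thesis by (simp add: euclidean_product_topology compact_space_def)
qed

lemma closed_imp_compact_ennfun: "closed (A :: ('i \<Rightarrow> ennreal) set) \<Longrightarrow> compact A"
  using compact_Int_closed[OF compact_UNIV_ennfun, of A] by simp

lemma continuous_on_coordinate:
  "continuous_on X f \<Longrightarrow> continuous_on X (\<lambda>x. (f x :: 'i \<Rightarrow> 'b::topological_space) i)"
  by (rule continuous_on_product_then_coordinatewise)

lemma closed_le_fun:
  assumes "continuous_on UNIV f" "continuous_on UNIV g"
  shows "closed {x. (f x :: 'i \<Rightarrow> ennreal) \<le> g x}"
proof -
  have "{x. f x \<le> g x} = (\<Inter>i. {x. f x i \<le> g x i})" by (auto simp: le_fun_def)
  then show ?thesis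
    using assms by (auto intro!: closed_INT closed_Collect_le continuous_on_coordinate)
qed

lemma closed_upE:
  fixes A :: "('i \<Rightarrow> ennreal) set"
  assumes "closed A" shows "closed (upE A)"
proof -
  have "closed {y. \<exists>x\<in>A. (x, y) \<in> {z. fst z \<le> snd z}}"
    by (intro closed_proj closed_imp_compact_ennfun assms closed_le_fun continuous_intros)
  then show ?thesis by (simp add: upE_def)
qed

lemma closed_dnE:
  fixes A :: "('i \<Rightarrow> ennreal) set"
  assumes "closed A" shows "closed (dnE A)"
proof -
  have "closed {y. \<exists>x\<in>A. (x, y) \<in> {z. snd z \<le> fst z}}"
    by (intro closed_proj closed_imp_compact_ennfun assms closed_le_fun continuous_intros)
  then show ?thesis by (simp add: dnE_def)
qed

text \<open>Directedness shrinks every finite intersection to a single nonempty member, so the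
  finite intersection property applies.\<close>

lemma filtered_compact_Inter:
  fixes C :: "'i \<Rightarrow> 'a::topological_space set"
  assumes I: "I \<noteq> {}" and dir: "\<And>i j. i \<in> I \<Longrightarrow> j \<in> I \<Longrightarrow> \<exists>k\<in>I. C k \<subseteq> C i \<and> C k \<subseteq> C j"
    and cl: "\<And>i. i \<in> I \<Longrightarrow> closed (C i)" and K: "compact K"
    and sub: "\<And>i. i \<in> I \<Longrightarrow> C i \<subseteq> K" and ne: "\<And>i. i \<in> I \<Longrightarrow> C i \<noteq> {}"
  shows "\<Inter>(C ` I) \<noteq> {}"
proof -
  have fin: "\<exists>k\<in>I. \<forall>j\<in>J. C k \<subseteq> C j" if "finite J" "J \<subseteq> I" for J
    using that
  proof (induction J)
    case empty then show ?case using I by auto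
  next
    case (insert j J)
    then obtain k where k: "k \<in> I" "\<forall>j\<in>J. C k \<subseteq> C j" by auto
    obtain l where "l \<in> I" "C l \<subseteq> C k" "C l \<subseteq> C j" using dir[of k j] k insert.prems by auto
    with k show ?case by (intro bexI[of _ l]) auto
  qed
  have "K \<inter> \<Inter>(C ` I) \<noteq> {}"
  proof (rule compact_imp_fip[OF K])
    fix T assume "T \<in> C ` I" then show "closed T" using cl by auto
  next
    fix F assume F: "finite F" "F \<subseteq> C ` I"
    then obtain J where J: "finite J" "J \<subseteq> I" "F = C ` J" by (meson finite_subset_image)
    obtain k where "k \<in> I" "\<forall>j\<in>J. C k \<subseteq> C j" using fin[OF J(1,2)] by auto
    then show "K \<inter> \<Inter>F \<noteq> {}" using ne[of k] sub[of k] J(3) by fastforce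
  qed
  then show ?thesis by auto
qed

subsection \<open>Way-below approximation\<close>

text \<open>The way-below relation of the continuous lattice of all functions, restricted to finitely
  supported \<open>b\<close>; on its support such a \<open>b\<close> is automatically finite.\<close>

definition way_below :: "('i \<Rightarrow> ennreal) \<Rightarrow> ('i \<Rightarrow> ennreal) \<Rightarrow> bool" where
  "way_below b a \<longleftrightarrow> finite {i. b i \<noteq> 0} \<and> (\<forall>i. b i \<noteq> 0 \<longrightarrow> b i < a i)"

lemma way_below_imp_le: "way_below b a \<Longrightarrow> b \<le> a"
proof (rule le_funI)
  fix i assume "way_below b a"
  then show "b i \<le> a i" by (cases "b i = 0") (auto simp: way_below_def intro: less_imp_le)
qed

lemma way_below_zero [simp]: "way_below (\<lambda>_. 0) a"
  by (simp add: way_below_def)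

lemma way_below_le_trans: "way_below b a \<Longrightarrow> a \<le> c \<Longrightarrow> way_below b c"
  by (auto simp: way_below_def le_fun_def intro: less_le_trans)

text \<open>Only the finitely many coordinates in the support of \<open>b\<close> impose a
  condition, and each condition is strict.\<close>

lemma open_way_below: "open {a. way_below b a}"
proof (cases "finite {i. b i \<noteq> 0}")
  case True
  have "{a. way_below b a} = (\<Inter>i\<in>{i. b i \<noteq> 0}. {a. b i < a i})" using True by (auto simp: way_below_def)
  then show ?thesis using True
    by (auto intro!: open_INT open_Collect_less continuous_coordinate continuous_on_const)
qed (simp add: way_below_def)

lemma way_below_sup: "way_below b a \<Longrightarrow> way_below c a \<Longrightarrow> way_below (\<lambda>i. max (b i) (c i)) a"
proof -
  assume *: "way_below b a" "way_below c a"
  have "{i. max (b i) (c i) \<noteq> 0} \<subseteq> {i. b i \<noteq> 0} \<union> {i. c i \<noteq> 0}" by (auto simp: max_def)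
  then have "finite {i. max (b i) (c i) \<noteq> 0}"
    by (rule finite_subset) (use * in \<open>auto simp: way_below_def\<close>)
  moreover have "max (b i) (c i) < a i" if "max (b i) (c i) \<noteq> 0" for i
    using * that by (cases "b i \<le> c i") (auto simp: way_below_def max_def)
  ultimately show "way_below (\<lambda>i. max (b i) (c i)) a" unfolding way_below_def by blast
qed

lemma way_below_interpolate:
  assumes "way_below b a" shows "\<exists>c. way_below b c \<and> way_below c a"
proof -
  have "\<forall>i. \<exists>x. (b i \<noteq> 0 \<longrightarrow> b i < x \<and> x < a i) \<and> (b i = 0 \<longrightarrow> x = 0)"
  proof
    fix i
    show "\<exists>x. (b i \<noteq> 0 \<longrightarrow> b i < x \<and> x < a i) \<and> (b i = 0 \<longrightarrow> x = 0)"
      using assms dense[of "b i" "a i"] unfolding way_below_def by (cases "b i = 0") auto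
  qed
  then obtain c where c: "\<And>i. (b i \<noteq> 0 \<longrightarrow> b i < c i \<and> c i < a i) \<and> (b i = 0 \<longrightarrow> c i = 0)"
    by metis
  then have "c i = 0 \<longleftrightarrow> b i = 0" for i using c[of i] by (metis not_less_zero)
  then have "{i. c i \<noteq> 0} = {i. b i \<noteq> 0}" by auto
  with c assms show ?thesis unfolding way_below_def by (intro exI[of _ c]) (auto; metis)
qed

text \<open>A neighbourhood of \<open>a\<close> restricts only finitely many coordinates, and each
  of these can be lowered strictly unless \<open>a\<close> vanishes there. Hence \<open>a\<close> is
  a topological limit of elements way below it.\<close>

lemma closed_way_below_limit:
  assumes Z: "closed Z" and b: "\<And>b. way_below b a \<Longrightarrow> b \<in> Z"
  shows "a \<in> Z"
proof (rule ccontr)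
  assume "a \<notin> Z"
  then have a: "a \<in> - Z" and op: "open (- Z)" using Z by (auto simp: closed_def)
  have "openin (product_topology (\<lambda>i. euclidean) UNIV) (- Z)"
    using op by (simp add: euclidean_product_topology)
  from product_topology_open_contains_basis[OF this a]
  obtain X where X: "a \<in> (\<Pi>\<^sub>E i\<in>UNIV. X i)" "\<And>i. open (X i)" "finite {i. X i \<noteq> UNIV}"
    "(\<Pi>\<^sub>E i\<in>UNIV. X i) \<subseteq> - Z" by auto
  \<comment> \<open>The value is 0 wherever the neighbourhood imposes nothing or \<open>a i\<close>
    is 0, and otherwise a point slightly to the left of \<open>a i\<close>.\<close>
  have "\<exists>x. x \<in> X i \<and> (x \<noteq> 0 \<longrightarrow> x < a i) \<and> (X i = UNIV \<longrightarrow> x = 0)" for i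
  proof (cases "X i = UNIV \<or> a i = 0")
    case True
    moreover have "a i \<in> X i" using X(1) by (auto simp: PiE_iff)
    ultimately have "0 \<in> X i" by (cases "X i = UNIV") auto
    then show ?thesis by (intro exI[of _ 0]) simp
  next
    case False
    have "a i \<in> X i" using X(1) by (auto simp: PiE_iff)
    moreover have "0 < a i" using False by (simp add: zero_less_iff_neq_zero)
    ultimately obtain y where y: "y < a i" "{y<..a i} \<subseteq> X i" using open_left[OF X(2)] by blast
    obtain x where "y < x" "x < a i" using dense[OF y(1)] by blast
    moreover have "x \<in> X i" using y(2) calculation by (auto simp: subset_iff)
    ultimately show ?thesis using False by (intro exI[of _ x]) auto
  qed
  then obtain b where b': "\<And>i. b i \<in> X i \<and> (b i \<noteq> 0 \<longrightarrow> b i < a i) \<and> (X i = UNIV \<longrightarrow> b i = 0)"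
    by metis
  have "finite {i. b i \<noteq> 0}" by (rule finite_subset[OF _ X(3)]) (use b' in auto)
  then have "way_below b a" using b' by (auto simp: way_below_def)
  moreover have "b \<in> - Z" using b' X(4) by (auto simp: PiE_iff subset_iff)
  ultimately show False using assms by auto
qed

lemma way_below_dense: "open W \<Longrightarrow> a \<in> W \<Longrightarrow> \<exists>b\<in>W. way_below b a"
  using closed_way_below_limit[of "- W" a] by auto

subsection \<open>Scott closure\<close>

text \<open>In this continuous lattice a set is Scott closed iff it is a lower set that is closed in the
  product (= Lawson) topology, so this is the Scott closure.\<close>

definition scl :: "('i \<Rightarrow> ennreal) set \<Rightarrow> ('i \<Rightarrow> ennreal) set" where
  "scl M = dnE (closure M)"

lemma closed_scl [simp]: "closed (scl M)"
  by (simp add: scl_def closed_dnE)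

lemma dnE_scl [simp]: "dnE (scl M) = scl M"
  by (simp add: scl_def)

lemma subset_scl: "M \<subseteq> scl M"
  unfolding scl_def using closure_subset[of M] subset_dnE[of "closure M"] by (rule subset_trans)

lemma scl_least: "M \<subseteq> Z \<Longrightarrow> closed Z \<Longrightarrow> dnE Z = Z \<Longrightarrow> scl M \<subseteq> Z"
  unfolding scl_def using closure_minimal[of M Z] dnE_mono[of "closure M" Z] by simp

lemma scl_subset_iff: "scl M \<subseteq> scl N \<longleftrightarrow> M \<subseteq> scl N"
  using scl_least[of M "scl N"] subset_scl[of M] by auto

lemma scl_mono: "M \<subseteq> N \<Longrightarrow> scl M \<subseteq> scl N"
  using scl_subset_iff[of M N] subset_scl[of N] by blast

lemma scl_scl [simp]: "scl (scl M) = scl M"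
  using scl_subset_iff[of "scl M" M] subset_scl[of "scl M"] by blast

lemma scl_ident: "closed Z \<Longrightarrow> dnE Z = Z \<Longrightarrow> scl Z = Z"
  using scl_least[of Z Z] subset_scl[of Z] by blast

lemma scl_down: "a \<in> scl M \<Longrightarrow> b \<le> a \<Longrightarrow> b \<in> scl M"
  unfolding scl_def dnE_def by (auto intro: order_trans)

lemma scl_eq_empty [simp]: "scl M = {} \<longleftrightarrow> M = {}"
  by (simp add: scl_def)

text \<open>The points with \<open>b\<close> way below them form an open set, so if it contains a
  limit point of \<open>M\<close> it meets \<open>M\<close>. The converse is the approximation of
  \<open>a\<close> by elements way below it.\<close>

lemma mem_scl: "a \<in> scl M \<longleftrightarrow> (\<forall>b. way_below b a \<longrightarrow> b \<in> dnE M)"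
proof
  assume "a \<in> scl M"
  then obtain a' where a': "a \<le> a'" "a' \<in> closure M" by (auto simp: scl_def dnE_def)
  show "\<forall>b. way_below b a \<longrightarrow> b \<in> dnE M"
  proof (intro allI impI)
    fix b assume "way_below b a"
    then have "a' \<in> {c. way_below b c}" using a'(1) way_below_le_trans[of b a a'] by simp
    then have "M \<inter> {c. way_below b c} \<noteq> {}"
      using a'(2) open_Int_closure_eq_empty[OF open_way_below, of b M] by (auto simp: Int_commute)
    then obtain m where "m \<in> M" "way_below b m" by auto
    then show "b \<in> dnE M" using way_below_imp_le[of b m] by (auto simp: dnE_def)
  qed
next
  assume "\<forall>b. way_below b a \<longrightarrow> b \<in> dnE M"
  moreover have "dnE M \<subseteq> scl M" using dnE_mono[OF subset_scl[of M]] by simp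
  ultimately show "a \<in> scl M" by (blast intro: closed_way_below_limit[OF closed_scl])
qed

lemma scl_way_below: "a \<in> scl M \<Longrightarrow> way_below b a \<Longrightarrow> \<exists>m\<in>M. b \<le> m"
  by (auto simp: mem_scl dnE_def)

text \<open>This is Scott continuity: superlevel sets of a coordinate are open upper sets of the
  product topology, which are the Scott open sets.\<close>

definition scottc :: "(('i \<Rightarrow> ennreal) \<Rightarrow> ('k \<Rightarrow> ennreal)) \<Rightarrow> bool" where
  "scottc \<theta> \<longleftrightarrow> mono \<theta> \<and> (\<forall>k. lsc (\<lambda>a. \<theta> a k))"

text \<open>By semicontinuity and finite support, an element way below \<open>\<theta> a\<close> is
  already dominated by \<open>\<theta> b'\<close> for some \<open>b'\<close> way below
  \<open>a\<close>.\<close>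

lemma scottc_scl:
  assumes \<theta>: "scottc \<theta>" and b: "\<And>b. way_below b a \<Longrightarrow> \<theta> b \<in> scl Z"
  shows "\<theta> a \<in> scl Z"
proof -
  have "c \<in> dnE (scl Z)" if c: "way_below c (\<theta> a)" for c
  proof -
    let ?W = "\<Inter>i\<in>{i. c i \<noteq> 0}. {a'. c i < \<theta> a' i}"
    have "open ?W" "a \<in> ?W" using \<theta> c by (auto simp: scottc_def lsc_def way_below_def)
    then obtain b' where b': "b' \<in> ?W" "way_below b' a" using way_below_dense by blast
    have "c i \<le> \<theta> b' i" for i using b'(1) by (cases "c i = 0") auto
    then have "c \<le> \<theta> b'" by (simp add: le_funI)
    with b[OF b'(2)] show ?thesis by (auto simp: dnE_def)
  qed
  then have "\<theta> a \<in> scl (scl Z)" by (simp only: mem_scl) blast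
  then show ?thesis by simp
qed

section \<open>Mixtures and convex sets of functions\<close>

definition mixv :: "real \<Rightarrow> ('i \<Rightarrow> ennreal) \<Rightarrow> ('i \<Rightarrow> ennreal) \<Rightarrow> 'i \<Rightarrow> ennreal" where
  "mixv p a b = (\<lambda>i. ennreal p * a i + ennreal (1 - p) * b i)"

definition cvx :: "('i \<Rightarrow> ennreal) set \<Rightarrow> bool" where
  "cvx A \<longleftrightarrow> (\<forall>a\<in>A. \<forall>b\<in>A. \<forall>p. 0 \<le> p \<and> p \<le> 1 \<longrightarrow> mixv p a b \<in> A)"

lemma cvxD: "cvx A \<Longrightarrow> a \<in> A \<Longrightarrow> b \<in> A \<Longrightarrow> 0 \<le> p \<Longrightarrow> p \<le> 1 \<Longrightarrow> mixv p a b \<in> A"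
  by (auto simp: cvx_def)

lemma cvx_Inter: "(\<And>A. A \<in> \<A> \<Longrightarrow> cvx A) \<Longrightarrow> cvx (\<Inter>\<A>)"
  unfolding cvx_def by blast

lemma cvx_Int: "cvx A \<Longrightarrow> cvx B \<Longrightarrow> cvx (A \<inter> B)"
  unfolding cvx_def by blast

lemma mixv_mono: "a \<le> a' \<Longrightarrow> b \<le> b' \<Longrightarrow> mixv p a b \<le> mixv p a' b'"
  by (auto simp: mixv_def le_fun_def intro!: add_mono mult_left_mono)

subsection \<open>Images of products under jointly continuous maps\<close>

definition slice :: "('j \<times> 's \<Rightarrow> 'b) \<Rightarrow> 'j \<Rightarrow> 's \<Rightarrow> 'b" where
  "slice h j = (\<lambda>s. h (j, s))"

text \<open>Every operation of the semantics has this shape. Pairing the indices puts a whole family of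
  arguments into one function space, where Tychonoff applies. The compact parameter set \<open>G\<close> is only
  needed for formal union, where it is the range of the mixing weight.\<close>

definition Op :: "'g set \<Rightarrow> ('g \<Rightarrow> ('j \<times> 's \<Rightarrow> ennreal) \<Rightarrow> ('k \<Rightarrow> ennreal)) \<Rightarrow>
    ('j \<Rightarrow> ('s \<Rightarrow> ennreal) set) \<Rightarrow> ('k \<Rightarrow> ennreal) set" where
  "Op G \<theta> A = {\<theta> g h | g h. g \<in> G \<and> (\<forall>j. slice h j \<in> A j)}"

text \<open>The parameter carries a topology but no order, so monotonicity is asked in the second
  argument only, while semicontinuity is joint.\<close>

definition jcont :: "('g::topological_space \<Rightarrow> ('i \<Rightarrow> ennreal) \<Rightarrow> ('k \<Rightarrow> ennreal)) \<Rightarrow> bool" where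
  "jcont \<theta> \<longleftrightarrow> (\<forall>g. mono (\<theta> g)) \<and> (\<forall>k. lsc (\<lambda>z. \<theta> (fst z) (snd z) k))"

lemma jcont_scottc: "jcont \<theta> \<Longrightarrow> scottc (\<theta> g)"
proof -
  assume \<theta>: "jcont \<theta>"
  have "lsc (\<lambda>h. \<theta> g h k)" for k
  proof -
    have "lsc (\<lambda>z. \<theta> (fst z) (snd z) k)" using \<theta> by (simp add: jcont_def)
    then have "lsc (\<lambda>h. \<theta> (fst (g, h)) (snd (g, h)) k)"
      by (rule lsc_comp) (intro continuous_intros)
    then show ?thesis by simp
  qed
  then show ?thesis using \<theta> by (simp add: jcont_def scottc_def)
qed

lemma jcont_mono: "jcont \<theta> \<Longrightarrow> a \<le> b \<Longrightarrow> \<theta> g a \<le> \<theta> g b"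
  by (auto simp: jcont_def mono_def)

lemma OpI: "g \<in> G \<Longrightarrow> (\<And>j. slice h j \<in> A j) \<Longrightarrow> \<theta> g h \<in> Op G \<theta> A"
  by (auto simp: Op_def)

lemma slice_case_prod [simp]: "slice (\<lambda>(j, s). f j s) j = f j"
  by (simp add: slice_def)

lemma way_below_slice: "way_below b h \<Longrightarrow> way_below (slice b j) (slice h j)"
  unfolding way_below_def slice_def
  using finite_vimageI[of "{i. b i \<noteq> 0}" "Pair j"] by (auto simp: vimage_def inj_on_def)

lemma Op_empty_iff: "Op G \<theta> A = {} \<longleftrightarrow> G = {} \<or> (\<exists>j. A j = {})"
proof
  assume e: "Op G \<theta> A = {}"
  show "G = {} \<or> (\<exists>j. A j = {})"
  proof (rule ccontr)
    assume "\<not> ?thesis"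
    then have "\<exists>g. g \<in> G" and "\<forall>j. \<exists>a. a \<in> A j" by auto
    then obtain g f where g: "g \<in> G" and "\<And>j. f j \<in> A j" by metis
    note g this
    then have "\<theta> g (\<lambda>(j, s). f j s) \<in> Op G \<theta> A" by (intro OpI) simp_all
    with e show False by simp
  qed
qed (auto simp: Op_def)

text \<open>The arguments may be infinitely many, but an element way below only constrains finitely many
  of them, so one member of the directed family suffices.\<close>

lemma Op_scl_limit:
  assumes \<theta>: "jcont \<theta>"
    and I: "I \<noteq> {}"
    and dir: "\<And>i i'. i \<in> I \<Longrightarrow> i' \<in> I \<Longrightarrow>
      \<exists>k\<in>I. \<forall>j. scl (\<A> i j) \<subseteq> scl (\<A> k j) \<and> scl (\<A> i' j) \<subseteq> scl (\<A> k j)"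
    and ne: "\<And>i j. i \<in> I \<Longrightarrow> \<A> i j \<noteq> {}"
    and B: "\<And>j. B j \<subseteq> scl (\<Union>i\<in>I. \<A> i j)"
  shows "scl (Op G \<theta> B) \<subseteq> scl (\<Union>i\<in>I. Op G \<theta> (\<A> i))"
proof -
  have fin: "\<exists>k\<in>I. \<forall>j\<in>J. scl (\<A> (f j) j) \<subseteq> scl (\<A> k j)" if J: "finite J" and f: "\<And>j. f j \<in> I" for J f
    using J
  proof (induction J)
    case empty then show ?case using I by auto
  next
    case (insert j0 J)
    then obtain k where k: "k \<in> I" "\<forall>j\<in>J. scl (\<A> (f j) j) \<subseteq> scl (\<A> k j)" by auto
    obtain l where l: "l \<in> I" "\<forall>j. scl (\<A> k j) \<subseteq> scl (\<A> l j) \<and> scl (\<A> (f j0) j) \<subseteq> scl (\<A> l j)"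
      using dir[OF k(1) f] by blast
    then have "\<forall>j\<in>insert j0 J. scl (\<A> (f j) j) \<subseteq> scl (\<A> l j)" using k(2) by blast
    with l(1) show ?case by blast
  qed
  have "\<theta> g h \<in> scl (\<Union>i\<in>I. Op G \<theta> (\<A> i))" if g: "g \<in> G" and h: "\<And>j. slice h j \<in> B j" for g h
  proof (rule scottc_scl[OF jcont_scottc[OF \<theta>]])
    fix b assume "way_below b h"
    \<comment> \<open>Two layers of approximation: \<open>c\<close> selects a member of the family
      for each argument, and passing from \<open>c\<close> to \<open>b\<close> pays for the move to
      a common index, which preserves membership only up to Scott closure.\<close>
    then obtain c where c: "way_below b c" "way_below c h" using way_below_interpolate by blast
    have "\<exists>i\<in>I. \<exists>m\<in>\<A> i j. slice c j \<le> m" for j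
      using scl_way_below[OF subsetD[OF B h] way_below_slice[OF c(2)]] by auto
    then obtain f where f: "\<And>j. f j \<in> I" "\<And>j. \<exists>m\<in>\<A> (f j) j. slice c j \<le> m" by metis
    have "finite (fst ` {i. b i \<noteq> 0})" using c(1) by (auto simp: way_below_def)
    from fin[OF this, of f] f(1) obtain k where
      k: "k \<in> I" "\<forall>j\<in>fst ` {i. b i \<noteq> 0}. scl (\<A> (f j) j) \<subseteq> scl (\<A> k j)" by blast
    have "\<exists>m\<in>\<A> k j. slice b j \<le> m" for j
    proof (cases "j \<in> fst ` {i. b i \<noteq> 0}")
      case True
      obtain m where m: "m \<in> \<A> (f j) j" "slice c j \<le> m" using f(2) by blast
      then have "m \<in> scl (\<A> k j)" using k(2) True subset_scl[of "\<A> (f j) j"] by blast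
      then have "slice c j \<in> scl (\<A> k j)" using m(2) by (rule scl_down)
      then show ?thesis using way_below_slice[OF c(1)] by (rule scl_way_below)
    next
      case False
      \<comment> \<open>Here \<open>b\<close> asks for nothing, so any member of the nonempty set
        will do.\<close>
      then have "slice b j = (\<lambda>_. 0)" by (force simp: slice_def image_iff)
      then show ?thesis using ne[OF k(1), of j] by (auto simp: le_fun_def)
    qed
    then obtain m where m: "\<And>j. m j \<in> \<A> k j" "\<And>j. slice b j \<le> m j" by metis
    define h' where "h' = (\<lambda>(j, s). m j s)"
    have "b \<le> h'" using m(2) by (auto simp: h'_def slice_def le_fun_def)
    then have "\<theta> g b \<le> \<theta> g h'" by (rule jcont_mono[OF \<theta>])
    moreover have "\<theta> g h' \<in> Op G \<theta> (\<A> k)" using g m(1) by (intro OpI) (auto simp: h'_def)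
    then have "\<theta> g h' \<in> scl (\<Union>i\<in>I. Op G \<theta> (\<A> i))" using k(1) subset_scl[of "\<Union>i\<in>I. Op G \<theta> (\<A> i)"] by blast
    ultimately show "\<theta> g b \<in> scl (\<Union>i\<in>I. Op G \<theta> (\<A> i))" by (metis scl_down)
  qed
  then show ?thesis unfolding scl_subset_iff by (auto simp: Op_def)
qed

text \<open>A one-element directed family specialises the limit statement to monotonicity.\<close>

lemma Op_scl_mono:
  assumes "jcont \<theta>" "\<And>j. A j \<noteq> {}" "\<And>j. scl (B j) \<subseteq> scl (A j)"
  shows "scl (Op G \<theta> B) \<subseteq> scl (Op G \<theta> A)"
  using Op_scl_limit[of \<theta> "{()}" "\<lambda>_. A" B G] assms by (simp add: scl_subset_iff)

text \<open>By monotonicity the arguments may range over saturations instead. The admissible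
  \<open>h\<close> then form a closed set as soon as the saturations are closed.\<close>

lemma upE_Op:
  assumes \<theta>: "jcont \<theta>"
  shows "upE (Op G \<theta> A) = {y. \<exists>z\<in>G \<times> {h. \<forall>j. slice h j \<in> upE (A j)}. \<theta> (fst z) (snd z) \<le> y}"
    (is "?l = ?r")
proof (intro set_eqI iffI)
  fix y assume "y \<in> ?l"
  then obtain g h where "g \<in> G" "\<forall>j. slice h j \<in> A j" "\<theta> g h \<le> y" by (auto simp: upE_def Op_def)
  then show "y \<in> ?r" using subset_upE[of "A _"] by (intro CollectI bexI[of _ "(g, h)"]) (auto simp: subset_iff)
next
  fix y assume "y \<in> ?r"
  then obtain g h where g: "g \<in> G" "\<forall>j. slice h j \<in> upE (A j)" "\<theta> g h \<le> y" by auto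
  then obtain m where m: "\<And>j. m j \<in> A j" "\<And>j. m j \<le> slice h j" unfolding upE_def by simp metis
  define h' where "h' = (\<lambda>(j, s). m j s)"
  have "h' \<le> h" using m(2) by (auto simp: h'_def slice_def le_fun_def)
  then have "\<theta> g h' \<le> y" using jcont_mono[OF \<theta>, of h' h g] g(3) by simp
  moreover have "\<theta> g h' \<in> Op G \<theta> A" using g(1) m(1) by (intro OpI) (auto simp: h'_def)
  ultimately show "y \<in> ?l" by (auto simp: upE_def)
qed

lemma continuous_slice: "continuous_on UNIV (\<lambda>h :: 'j \<times> 's \<Rightarrow> ennreal. slice h j)"
  unfolding slice_def by (intro continuous_on_coordinatewise_then_product continuous_coordinate)

lemma closed_slices:
  assumes "\<And>j. closed (A j)"
  shows "closed {h :: 'j \<times> 's \<Rightarrow> ennreal. \<forall>j. slice h j \<in> A j}"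
proof -
  have "{h :: 'j \<times> 's \<Rightarrow> ennreal. \<forall>j. slice h j \<in> A j} = (\<Inter>j. (\<lambda>h. slice h j) -` A j)" by auto
  then show ?thesis using assms by (auto intro!: closed_INT closed_vimage continuous_slice)
qed

lemma closed_jcont_le:
  assumes \<theta>: "jcont \<theta>" and f: "continuous_on UNIV f" and k: "continuous_on UNIV k"
  shows "closed {z. \<theta> (fst (f z)) (snd (f z)) \<le> k z}"
proof -
  have "lsc (\<lambda>z. \<theta> (fst (f z)) (snd (f z)) i)" for i
  proof -
    have "lsc (\<lambda>z. \<theta> (fst z) (snd z) i)" using \<theta> by (simp add: jcont_def)
    then show ?thesis by (rule lsc_comp[OF _ f])
  qed
  then have "closed {z. \<theta> (fst (f z)) (snd (f z)) i \<le> k z i}" for i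
    by (rule closed_lsc_le[OF _ continuous_on_coordinate[OF k]])
  then have "closed (\<Inter>i. {z. \<theta> (fst (f z)) (snd (f z)) i \<le> k z i})" by blast
  moreover have "(\<Inter>i. {z. \<theta> (fst (f z)) (snd (f z)) i \<le> k z i}) = {z. \<theta> (fst (f z)) (snd (f z)) \<le> k z}"
    by (auto simp: le_fun_def)
  ultimately show ?thesis by (simp only:)
qed

text \<open>The saturation is the projection of a closed relation along the compact set of
  parameters and admissible arguments.\<close>

lemma closed_upE_Op:
  assumes \<theta>: "jcont \<theta>" and G: "compact G" and A: "\<And>j. closed (upE (A j))"
  shows "closed (upE (Op G \<theta> A))"
proof -
  have "closed {y. \<exists>z\<in>G \<times> {h. \<forall>j. slice h j \<in> upE (A j)}.
      (z, y) \<in> {w. \<theta> (fst (fst w)) (snd (fst w)) \<le> snd w}}"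
    by (intro closed_proj compact_Times G closed_imp_compact_ennfun closed_slices A
        closed_jcont_le \<theta> continuous_intros)
  then show ?thesis by (simp add: upE_Op[OF \<theta>])
qed

lemma Op_upE_mono:
  assumes \<theta>: "jcont \<theta>" and "\<And>j. upE (B j) \<subseteq> upE (A j)"
  shows "upE (Op G \<theta> B) \<subseteq> upE (Op G \<theta> A)"
  using assms(2) by (fastforce simp: upE_Op[OF \<theta>])

text \<open>For fixed \<open>y\<close>, the conditions "admissible for index \<open>i\<close> and
  mapped below \<open>y\<close>" are closed, filtered and satisfiable over the compact set
  \<open>G \<times> UNIV\<close>. A pair satisfying all of them witnesses membership in the
  limit.\<close>

lemma Op_upE_limit:
  assumes \<theta>: "jcont \<theta>" and G: "compact G" and I: "I \<noteq> {}"
    and dir: "\<And>i i'. i \<in> I \<Longrightarrow> i' \<in> I \<Longrightarrow>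
      \<exists>k\<in>I. \<forall>j. upE (\<A> k j) \<subseteq> upE (\<A> i j) \<and> upE (\<A> k j) \<subseteq> upE (\<A> i' j)"
    and cl: "\<And>i j. i \<in> I \<Longrightarrow> closed (upE (\<A> i j))"
    and B: "\<And>j. (\<Inter>i\<in>I. upE (\<A> i j)) \<subseteq> upE (B j)"
  shows "(\<Inter>i\<in>I. upE (Op G \<theta> (\<A> i))) \<subseteq> upE (Op G \<theta> B)"
proof
  fix y assume y: "y \<in> (\<Inter>i\<in>I. upE (Op G \<theta> (\<A> i)))"
  define R where "R = {z. \<theta> (fst z) (snd z) \<le> y}"
  have cR: "closed R" unfolding R_def
    using closed_jcont_le[OF \<theta>, of "\<lambda>z. z" "\<lambda>_. y"] by (simp add: continuous_intros)
  have GU: "compact (G \<times> (UNIV :: ('b \<times> 'c \<Rightarrow> ennreal) set))"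
    by (intro compact_Times G compact_UNIV_ennfun)
  define C where "C i = R \<inter> snd -` {h. \<forall>j. slice h j \<in> upE (\<A> i j)}" for i
  have "(G \<times> UNIV) \<inter> \<Inter>(C ` I) \<noteq> {}"
  \<comment> \<open>\<open>G\<close> lives in an arbitrary space and need not be closed, so the
    intersection property is used relative to \<open>G \<times> UNIV\<close>.\<close>
  proof (rule compact_imp_fip_image[OF GU])
    fix i assume "i \<in> I"
    then show "closed (C i)" unfolding C_def
      by (intro closed_Int cR closed_vimage closed_slices cl continuous_intros)
  next
    fix J assume J: "finite J" "J \<subseteq> I"
    have "\<exists>k\<in>I. \<forall>i\<in>J. C k \<subseteq> C i" using J
    proof (induction J)
      case empty then show ?case using I by auto
    next
      case (insert j J)
      then obtain k where k: "k \<in> I" "\<forall>i\<in>J. C k \<subseteq> C i" by auto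
      obtain l where l: "l \<in> I" "\<forall>n. upE (\<A> l n) \<subseteq> upE (\<A> k n) \<and> upE (\<A> l n) \<subseteq> upE (\<A> j n)"
        using dir[of k j] k insert.prems by auto
      then have "C l \<subseteq> C k" "C l \<subseteq> C j" by (auto simp: C_def)
      with k l(1) show ?case by (intro bexI[of _ l]) auto
    qed
    then obtain k where k: "k \<in> I" "\<forall>i\<in>J. C k \<subseteq> C i" by blast
    have "(G \<times> UNIV) \<inter> C k \<noteq> {}"
    proof -
      have "y \<in> upE (Op G \<theta> (\<A> k))" using y k(1) by blast
      then obtain g h where "g \<in> G" "\<forall>j. slice h j \<in> upE (\<A> k j)" "\<theta> g h \<le> y"
        by (auto simp: upE_Op[OF \<theta>])
      then have "(g, h) \<in> (G \<times> UNIV) \<inter> C k" by (simp add: C_def R_def)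
      then show ?thesis by blast
    qed
    with k show "(G \<times> UNIV) \<inter> \<Inter>(C ` J) \<noteq> {}" by blast
  qed
  then obtain z where z: "z \<in> G \<times> UNIV" "\<And>i. i \<in> I \<Longrightarrow> z \<in> C i" by blast
  obtain g h where gh': "z = (g, h)" by (cases z)
  have gh: "g \<in> G" "(g, h) \<in> R" "\<And>i j. i \<in> I \<Longrightarrow> slice h j \<in> upE (\<A> i j)"
    using z I by (auto simp: C_def gh')
  then have "slice h j \<in> upE (B j)" for j using B by blast
  with gh(1,2) show "y \<in> upE (Op G \<theta> B)"
    by (auto simp: upE_Op[OF \<theta>] R_def intro!: bexI[of _ "(g, h)"])
qed

lemma lsc_snd_coordinate: "lsc (\<lambda>z :: 'g::topological_space \<times> ('i \<Rightarrow> ennreal). snd z i)"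
  by (rule lsc_continuous, rule continuous_on_coordinate) (intro continuous_intros)

definition mix_op :: "real \<Rightarrow> (bool \<times> 's \<Rightarrow> ennreal) \<Rightarrow> 's \<Rightarrow> ennreal" where
  "mix_op p h = mixv p (slice h True) (slice h False)"

lemma jcont_mix_op: "jcont mix_op"
  unfolding jcont_def
proof (intro conjI allI)
  show "mono (mix_op p)" for p :: real
    by (intro monoI) (auto simp: mix_op_def slice_def mixv_def le_fun_def intro!: add_mono mult_left_mono)
  fix k :: 's
  show "lsc (\<lambda>z. mix_op (fst z) (snd z :: bool \<times> 's \<Rightarrow> ennreal) k)"
    unfolding mix_op_def mixv_def slice_def
    by (intro lsc_add lsc_mult lsc_snd_coordinate; intro lsc_continuous continuous_on_ennreal continuous_intros)
qed

lemma Op_mix_op: "Op G mix_op A = {mixv p a b | p a b. p \<in> G \<and> a \<in> A True \<and> b \<in> A False}"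
  (is "_ = ?r")
proof (intro set_eqI iffI)
  fix y assume "y \<in> Op G mix_op A"
  then obtain p h where "p \<in> G" "\<And>j. slice h j \<in> A j" "y = mix_op p h" by (auto simp: Op_def)
  then show "y \<in> ?r" by (auto simp: mix_op_def)
next
  fix y assume "y \<in> ?r"
  then obtain p a b where *: "p \<in> G" "a \<in> A True" "b \<in> A False" "y = mixv p a b" by auto
  have "mix_op p (\<lambda>(j, s). (if j then a else b) s) \<in> Op G mix_op A"
    using * by (intro OpI) (auto simp: slice_def)
  then show "y \<in> Op G mix_op A" using * by (simp add: mix_op_def slice_def)
qed

text \<open>Mixing is jointly continuous, so mixtures of points of \<open>scl X\<close> lie in the
  Scott closure of the mixtures of points of \<open>X\<close>. The latter have to lie only in
  \<open>scl X\<close>, which matters for Kleisli images that are not convex themselves.\<close>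

lemma cvx_scl:
  assumes "\<And>a b p. a \<in> X \<Longrightarrow> b \<in> X \<Longrightarrow> 0 \<le> p \<Longrightarrow> p \<le> 1 \<Longrightarrow> mixv p a b \<in> scl X"
  shows "cvx (scl X)"
proof (cases "X = {}")
  case False
  have "scl (Op {0..1} mix_op (\<lambda>_. scl X)) \<subseteq> scl (Op {0..1} mix_op (\<lambda>_. X))"
    using False by (intro Op_scl_mono jcont_mix_op) auto
  also have "\<dots> \<subseteq> scl X" unfolding scl_subset_iff using assms by (auto simp: Op_mix_op)
  finally have "Op {0..1} mix_op (\<lambda>_. scl X) \<subseteq> scl X" by (simp add: scl_subset_iff)
  then show ?thesis unfolding cvx_def Op_mix_op by fastforce
qed (auto simp: cvx_def scl_def dnE_def)

lemma cvx_upE: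
  assumes "\<And>a b p. a \<in> X \<Longrightarrow> b \<in> X \<Longrightarrow> 0 \<le> p \<Longrightarrow> p \<le> 1 \<Longrightarrow> mixv p a b \<in> upE X"
  shows "cvx (upE X)"
  unfolding cvx_def
proof (intro ballI allI impI)
  fix a b p assume "a \<in> upE X" "b \<in> upE X" "0 \<le> p \<and> p \<le> (1::real)"
  then obtain a' b' where "a' \<in> X" "b' \<in> X" "a' \<le> a" "b' \<le> b" by (auto simp: upE_def)
  then have "mixv p a' b' \<in> upE X" "mixv p a' b' \<le> mixv p a b"
    using assms \<open>0 \<le> p \<and> p \<le> 1\<close> by (auto intro: mixv_mono)
  then show "mixv p a b \<in> upE X" by (auto simp: upE_def intro: order_trans)
qed

subsection \<open>The three power constructions\<close>

text \<open>The power constructions on functions instead of valuations. A biconvex element is determined by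
  its Scott closure and its saturation, so all constructions are handled through these two halves;
  arbitrary sets \<open>X\<close> serve as generators of the element \<open>elt x X\<close>.\<close>

definition ple :: "pk \<Rightarrow> ('s \<Rightarrow> ennreal) set \<Rightarrow> ('s \<Rightarrow> ennreal) set \<Rightarrow> bool" where
  "ple x X Y \<longleftrightarrow> (x \<noteq> PU \<longrightarrow> scl X \<subseteq> scl Y) \<and> (x \<noteq> PL \<longrightarrow> upE Y \<subseteq> upE X)"

definition generator :: "pk \<Rightarrow> ('s \<Rightarrow> ennreal) set \<Rightarrow> bool" where
  "generator x X \<longleftrightarrow> X \<noteq> {} \<and> (x \<noteq> PU \<longrightarrow> cvx (scl X)) \<and> (x \<noteq> PL \<longrightarrow> closed (upE X) \<and> cvx (upE X))"

text \<open>A half-by-half description of the supremum that also makes sense for generators outside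
  the cone. For directed families in \<open>PCE x\<close> it agrees with the least upper bound, by
  \<open>islim_is_lub\<close> and \<open>is_lub_islim\<close>.\<close>

definition islim :: "pk \<Rightarrow> 'i set \<Rightarrow> ('i \<Rightarrow> ('s \<Rightarrow> ennreal) set) \<Rightarrow> ('s \<Rightarrow> ennreal) set \<Rightarrow> bool" where
  "islim x I X Y \<longleftrightarrow> (x \<noteq> PU \<longrightarrow> scl Y = scl (\<Union>i\<in>I. X i)) \<and> (x \<noteq> PL \<longrightarrow> upE Y = (\<Inter>i\<in>I. upE (X i)))"

definition limset :: "pk \<Rightarrow> 'i set \<Rightarrow> ('i \<Rightarrow> ('s \<Rightarrow> ennreal) set) \<Rightarrow> ('s \<Rightarrow> ennreal) set" where
  "limset x I X = (case x of PL \<Rightarrow> scl (\<Union>i\<in>I. X i) | PU \<Rightarrow> (\<Inter>i\<in>I. upE (X i))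
     | PB \<Rightarrow> scl (\<Union>i\<in>I. X i) \<inter> (\<Inter>i\<in>I. upE (X i)))"

definition elt :: "pk \<Rightarrow> ('s \<Rightarrow> ennreal) set \<Rightarrow> ('s \<Rightarrow> ennreal) set" where
  "elt x X = (case x of PL \<Rightarrow> scl X | PU \<Rightarrow> upE X | PB \<Rightarrow> scl X \<inter> upE X)"

definition PCE :: "pk \<Rightarrow> ('s \<Rightarrow> ennreal) set set" where
  "PCE x = {A. A \<noteq> {} \<and> cvx A \<and> closed A \<and>
     (case x of PL \<Rightarrow> dnE A = A | PU \<Rightarrow> upE A = A
      | PB \<Rightarrow> (\<forall>a\<in>A. \<forall>c\<in>A. \<forall>b. a \<le> b \<and> b \<le> c \<longrightarrow> b \<in> A))}"

definition directed_fam :: "pk \<Rightarrow> 'i set \<Rightarrow> ('i \<Rightarrow> ('s \<Rightarrow> ennreal) set) \<Rightarrow> bool" where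
  "directed_fam x I X \<longleftrightarrow> I \<noteq> {} \<and> (\<forall>i\<in>I. \<forall>j\<in>I. \<exists>k\<in>I. ple x (X i) (X k) \<and> ple x (X j) (X k))"

lemma ple_refl [simp]: "ple x X X" by (simp add: ple_def)
lemma ple_trans: "ple x X Y \<Longrightarrow> ple x Y Z \<Longrightarrow> ple x X Z" by (auto simp: ple_def)

lemma elt_limset: "elt x X = limset x {()} (\<lambda>_. X)"
  by (cases x) (simp_all add: elt_def limset_def)

lemma scl_closed: "closed A \<Longrightarrow> scl A = dnE A"
  by (simp add: scl_def closure_closed)

text \<open>Compactness makes the limits of the lower and of the upper halves fit together again.\<close>

lemma lens:
  assumes d: "directed_fam PB I X" and g: "\<And>i. i \<in> I \<Longrightarrow> generator PB (X i)"
  defines "L \<equiv> scl (\<Union>i\<in>I. X i)" and "U \<equiv> (\<Inter>i\<in>I. upE (X i))"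
  shows "scl (L \<inter> U) = L" "upE (L \<inter> U) = U" "L \<inter> U \<noteq> {}"
proof -
  have I: "I \<noteq> {}" using d by (simp add: directed_fam_def)
  have cU: "closed U" unfolding U_def using g by (auto simp: generator_def)
  have uU: "upE U = U" unfolding U_def by (auto simp: upE_def intro: order_trans)
  have scl_LU: "scl (L \<inter> U) = dnE (L \<inter> U)"
    by (intro scl_closed closed_Int cU) (simp add: L_def)
  have sub: "X i \<subseteq> L" if "i \<in> I" for i unfolding L_def using subset_scl[of "\<Union>i\<in>I. X i"] that by blast
  \<comment> \<open>Compactness in the form used twice below: a closed condition satisfied in
    cofinally many \<open>X j\<close> is satisfied at some point of
    \<open>L \<inter> U\<close>.\<close>
  have meets: "\<exists>a\<in>L \<inter> U. P a"
    if P: "closed {a. P a}" and m: "\<And>i. i \<in> I \<Longrightarrow> \<exists>j\<in>I. ple PB (X i) (X j) \<and> (\<exists>a\<in>X j. P a)" for P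
  proof -
    have "\<Inter>((\<lambda>i. L \<inter> upE (X i) \<inter> {a. P a}) ` I) \<noteq> {}"
    proof (rule filtered_compact_Inter[OF I _ _ compact_UNIV_ennfun])
      fix i j assume "i \<in> I" "j \<in> I"
      then obtain k where "k \<in> I" "ple PB (X i) (X k)" "ple PB (X j) (X k)"
        using d by (auto simp: directed_fam_def)
      then show "\<exists>k\<in>I. L \<inter> upE (X k) \<inter> {a. P a} \<subseteq> L \<inter> upE (X i) \<inter> {a. P a} \<and>
          L \<inter> upE (X k) \<inter> {a. P a} \<subseteq> L \<inter> upE (X j) \<inter> {a. P a}"
        by (intro bexI[of _ k]) (auto simp: ple_def)
    next
      fix i assume i: "i \<in> I"
      show "closed (L \<inter> upE (X i) \<inter> {a. P a})"
        using g[OF i] P by (intro closed_Int) (auto simp: L_def generator_def)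
      obtain j a where "j \<in> I" "ple PB (X i) (X j)" "a \<in> X j" "P a" using m[OF i] by auto
      then have "a \<in> L \<inter> upE (X i) \<inter> {a. P a}" using sub[of j] subset_upE[of "X j"] by (auto simp: ple_def)
      then show "L \<inter> upE (X i) \<inter> {a. P a} \<noteq> {}" by blast
    qed simp
    then obtain a where "a \<in> \<Inter>((\<lambda>i. L \<inter> upE (X i) \<inter> {a. P a}) ` I)" by blast
    then have "\<forall>i\<in>I. a \<in> L \<inter> upE (X i) \<inter> {a. P a}" by blast
    then show ?thesis using I unfolding U_def by auto
  qed
  have "L \<subseteq> dnE (L \<inter> U)"
  proof -
    have "(\<Union>i\<in>I. X i) \<subseteq> dnE (L \<inter> U)"
    proof (intro UN_least subsetI)
      fix i a assume i: "i \<in> I" and a: "a \<in> X i"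
      show "a \<in> dnE (L \<inter> U)"
      proof (rule ccontr)
        assume "a \<notin> dnE (L \<inter> U)"
        then have "a \<notin> scl (L \<inter> U)"
          by (simp only: scl_LU not_False_eq_True)
        \<comment> \<open>The point \<open>a\<close> belongs to later members only up to Scott
          closure; an element way below it is dominated there by an actual member.\<close>
        then obtain b where b: "way_below b a" "b \<notin> dnE (L \<inter> U)" by (auto simp: mem_scl)
        have "\<exists>c\<in>L \<inter> U. b \<le> c"
        proof (rule meets)
          show "closed {c. b \<le> c}" by (intro closed_le_fun continuous_intros)
          fix j assume j: "j \<in> I"
          then obtain k where k: "k \<in> I" "ple PB (X i) (X k)" "ple PB (X j) (X k)"
            using d i by (auto simp: directed_fam_def)
          then have "a \<in> scl (X k)" using a subset_scl[of "X i"] by (auto simp: ple_def)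
          then show "\<exists>k\<in>I. ple PB (X j) (X k) \<and> (\<exists>c\<in>X k. b \<le> c)"
            using scl_way_below[OF _ b(1)] k by blast
        qed
        with b(2) show False by (auto simp: dnE_def)
      qed
    qed
    then show ?thesis unfolding L_def
      by (rule scl_least) (auto intro!: closed_dnE closed_Int cU simp: L_def[symmetric] closed_scl[of "\<Union>i\<in>I. X i", folded L_def])
  qed
  moreover have "dnE (L \<inter> U) \<subseteq> L" using dnE_mono[of "L \<inter> U" L] by (simp add: L_def)
  ultimately have dn: "dnE (L \<inter> U) = L" by blast
  then show "scl (L \<inter> U) = L" by (simp only: scl_LU)
  have "U \<subseteq> upE (L \<inter> U)"
  proof
    fix y assume y: "y \<in> U"
    have "\<exists>a\<in>L \<inter> U. a \<le> y"
    proof (rule meets)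
      show "closed {a. a \<le> y}" by (intro closed_le_fun continuous_intros)
      fix i assume i: "i \<in> I"
      then have "y \<in> upE (X i)" using y by (auto simp: U_def)
      then show "\<exists>j\<in>I. ple PB (X i) (X j) \<and> (\<exists>a\<in>X j. a \<le> y)"
        using i by (intro bexI[of _ i]) (auto simp: upE_def)
    qed
    then show "y \<in> upE (L \<inter> U)" by (auto simp: upE_def)
  qed
  moreover have "upE (L \<inter> U) \<subseteq> U" using upE_mono[of "L \<inter> U" U] uU by simp
  ultimately show "upE (L \<inter> U) = U" by blast
  obtain i where "i \<in> I" using I by blast
  then have "X i \<noteq> {}" using g by (auto simp: generator_def)
  then have "L \<noteq> {}" using sub[OF \<open>i \<in> I\<close>] by blast
  then show "L \<inter> U \<noteq> {}" using dn by (auto simp: dnE_def)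
qed

text \<open>Any two points of the union lie in the Scott closure of one later member, whence
  convexity of the lower half. Compactness keeps the upper half nonempty, and \<open>lens\<close>
  reassembles both in the biconvex case.\<close>

lemma limset_props:
  assumes d: "directed_fam x I X" and g: "\<And>i. i \<in> I \<Longrightarrow> generator x (X i)"
  shows limset_PCE: "limset x I X \<in> PCE x" and islim_limset: "islim x I X (limset x I X)"
proof -
  let ?L = "scl (\<Union>i\<in>I. X i)" and ?U = "\<Inter>i\<in>I. upE (X i)"
  have I: "I \<noteq> {}" using d by (simp add: directed_fam_def)
  have ne: "X i \<noteq> {}" if "i \<in> I" for i using g[OF that] by (simp add: generator_def)
  have Lne: "?L \<noteq> {}" using I ne by auto
  have uU: "upE ?U = ?U" by (auto simp: upE_def intro: order_trans)
  have cL: "cvx ?L" if x: "x \<noteq> PU"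
  proof (rule cvx_scl)
    fix a b p assume "a \<in> (\<Union>i\<in>I. X i)" "b \<in> (\<Union>i\<in>I. X i)" and p: "0 \<le> p" "p \<le> (1::real)"
    then obtain i j where ij: "i \<in> I" "j \<in> I" "a \<in> X i" "b \<in> X j" by auto
    then obtain k where k: "k \<in> I" "ple x (X i) (X k)" "ple x (X j) (X k)"
      using d by (auto simp: directed_fam_def)
    then have "a \<in> scl (X k)" "b \<in> scl (X k)" using ij x subset_scl[of "X i"] subset_scl[of "X j"] by (auto simp: ple_def)
    then have "mixv p a b \<in> scl (X k)" using g[OF k(1)] x p by (auto simp: generator_def intro: cvxD)
    also have "scl (X k) \<subseteq> ?L" using k(1) by (intro scl_mono) auto
    finally show "mixv p a b \<in> ?L" .
  qed
  have U: "closed ?U" "cvx ?U" if "x \<noteq> PL"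
    using g that by (auto simp: generator_def intro!: closed_INT cvx_Inter)
  have Une: "?U \<noteq> {}" if x: "x \<noteq> PL"
  proof (rule filtered_compact_Inter[OF I _ _ compact_UNIV_ennfun])
    fix i j assume "i \<in> I" "j \<in> I"
    then obtain k where k: "k \<in> I" "ple x (X i) (X k)" "ple x (X j) (X k)"
      using d by (auto simp: directed_fam_def)
    then show "\<exists>k\<in>I. upE (X k) \<subseteq> upE (X i) \<and> upE (X k) \<subseteq> upE (X j)"
      using x by (auto simp: ple_def)
  qed (use x g ne in \<open>auto simp: generator_def\<close>)
  have "limset x I X \<in> PCE x \<and> islim x I X (limset x I X)"
  proof (cases x)
    case PL
    then show ?thesis using cL Lne by (auto simp: PCE_def limset_def islim_def)
  next
    case PU
    then show ?thesis using U Une uU by (simp add: PCE_def limset_def islim_def)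
  next
    case PB
    note l = lens[OF d[unfolded PB] g[unfolded PB]]
    have oc: "\<forall>a\<in>?L \<inter> ?U. \<forall>c\<in>?L \<inter> ?U. \<forall>b. a \<le> b \<and> b \<le> c \<longrightarrow> b \<in> ?L \<inter> ?U"
    proof (intro ballI allI impI)
      fix a b c assume "a \<in> ?L \<inter> ?U" "c \<in> ?L \<inter> ?U" "a \<le> b \<and> b \<le> c"
      then have "b \<in> ?L" "b \<in> upE ?U" using scl_down[of c _ b] by (auto simp: upE_def)
      then show "b \<in> ?L \<inter> ?U" using uU by blast
    qed
    have cc: "cvx (?L \<inter> ?U)" "closed (?L \<inter> ?U)" using PB U cL by (auto intro!: cvx_Int closed_Int)
    have eq: "limset x I X = ?L \<inter> ?U" using PB by (simp add: limset_def)
    have "?L \<inter> ?U \<in> PCE x" unfolding PCE_def PB mem_Collect_eq pk.case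
      by (intro conjI l(3) cc oc)
    moreover have "islim x I X (?L \<inter> ?U)" unfolding islim_def using l(1,2) by blast
    ultimately show ?thesis unfolding eq by blast
  qed
  then show "limset x I X \<in> PCE x" "islim x I X (limset x I X)" by auto
qed

lemma elt_PCE: "generator x X \<Longrightarrow> elt x X \<in> PCE x"
  and islim_elt: "generator x X \<Longrightarrow> islim x {()} (\<lambda>_. X) (elt x X)"
  unfolding elt_limset by (rule limset_props; simp add: directed_fam_def)+

lemma PCE_scl: "A \<in> PCE x \<Longrightarrow> x \<noteq> PU \<Longrightarrow> scl A = dnE A"
  by (simp add: PCE_def scl_def closure_closed)

lemma PCE_generator: "A \<in> PCE x \<Longrightarrow> generator x A"
  unfolding generator_def
proof (intro conjI impI)
  assume A: "A \<in> PCE x"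
  then have c: "cvx A" "closed A" by (auto simp: PCE_def)
  show "A \<noteq> {}" using A by (simp add: PCE_def)
  show "cvx (scl A)" by (rule cvx_scl) (use c subset_scl[of A] in \<open>auto dest: cvxD\<close>)
  show "cvx (upE A)" by (rule cvx_upE) (use c subset_upE[of A] in \<open>auto dest: cvxD\<close>)
  show "closed (upE A)" using c by (intro closed_upE)
qed

lemma elt_PCE_ident: "A \<in> PCE x \<Longrightarrow> elt x A = A"
proof (cases x)
  case PB
  assume A: "A \<in> PCE x"
  \<comment> \<open>For closed \<open>A\<close> the Scott closure is the lower closure, so a point
    of the intersection lies between two members, and order convexity applies.\<close>
  have "scl A \<inter> upE A \<subseteq> A"
    using PCE_scl[OF A] A PB by (auto simp: PCE_def dnE_def upE_def)
  then show ?thesis using PB subset_scl[of A] subset_upE[of A] by (auto simp: elt_def)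
qed (auto simp: elt_def PCE_def scl_ident)

lemma ple_elt_iff [simp]:
  assumes "generator x X" "generator x Y"
  shows "ple x (elt x X) (elt x Y) \<longleftrightarrow> ple x X Y"
  using islim_elt[OF assms(1)] islim_elt[OF assms(2)] by (auto simp: islim_def ple_def)

lemma ple_elt: "generator x X \<Longrightarrow> ple x X (elt x X)" and elt_ple: "generator x X \<Longrightarrow> ple x (elt x X) X"
  using islim_elt[of x X] by (auto simp: islim_def ple_def)

lemma elt_eqI: "ple x X Y \<Longrightarrow> ple x Y X \<Longrightarrow> elt x X = elt x Y"
  by (cases x) (auto simp: ple_def elt_def)

lemma ple_antisym: "A \<in> PCE x \<Longrightarrow> B \<in> PCE x \<Longrightarrow> ple x A B \<Longrightarrow> ple x B A \<Longrightarrow> A = B"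
  using elt_eqI[of x A B] elt_PCE_ident[of A x] elt_PCE_ident[of B x] by simp

lemma islim_upper: "islim x I X Y \<Longrightarrow> i \<in> I \<Longrightarrow> ple x (X i) Y"
  unfolding islim_def ple_def using scl_mono[of "X i" "\<Union>i\<in>I. X i"] by auto

lemma islim_least: "islim x I X Y \<Longrightarrow> (\<And>i. i \<in> I \<Longrightarrow> ple x (X i) Z) \<Longrightarrow> ple x Y Z"
  unfolding islim_def ple_def using scl_subset_iff[of "\<Union>i\<in>I. X i" Z]
  by (auto simp: scl_subset_iff)

lemma islim_is_lub:
  assumes "islim x I X Y" "Y \<in> PCE x"
  shows "is_lub_in (PCE x) (ple x) (X ` I) Y"
  using assms islim_upper islim_least by (fastforce simp: is_lub_in_def)

lemma is_lub_unique:
  assumes "is_lub_in (PCE x) (ple x) D Y" "is_lub_in (PCE x) (ple x) D Y'"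
  shows "Y = Y'"
  using assms by (intro ple_antisym) (auto simp: is_lub_in_def)

text \<open>\<open>limset\<close> is a least upper bound as well, and these are unique. Continuity
  in the sense of \<open>pc_cont\<close> can thus be checked on the two halves.\<close>

lemma is_lub_islim:
  assumes "is_lub_in (PCE x) (ple x) (X ` I) Y" "directed_fam x I X" "\<And>i. i \<in> I \<Longrightarrow> X i \<in> PCE x"
  shows "islim x I X Y"
proof -
  have g: "\<And>i. i \<in> I \<Longrightarrow> generator x (X i)" using assms(3) PCE_generator by blast
  note l = limset_PCE[OF assms(2) g] islim_limset[OF assms(2) g]
  then have "Y = limset x I X" using is_lub_unique[OF assms(1) islim_is_lub] by blast
  with l show ?thesis by simp
qed

lemma scl_UN_mono:
  assumes "\<And>i. i \<in> I \<Longrightarrow> scl (X i) \<subseteq> scl (X' i)"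
  shows "scl (\<Union>i\<in>I. X i) \<subseteq> scl (\<Union>i\<in>I. X' i)"
  unfolding scl_subset_iff
proof (rule UN_least)
  fix i assume i: "i \<in> I"
  have "X i \<subseteq> scl (X' i)" using assms[OF i] by (simp add: scl_subset_iff)
  also have "\<dots> \<subseteq> scl (\<Union>i\<in>I. X' i)" using i by (intro scl_mono) auto
  finally show "X i \<subseteq> scl (\<Union>i\<in>I. X' i)" .
qed

lemma islim_cong:
  assumes "islim x I X Y" "\<And>i. i \<in> I \<Longrightarrow> ple x (X i) (X' i) \<and> ple x (X' i) (X i)"
    "ple x Y Y'" "ple x Y' Y"
  shows "islim x I X' Y'"
proof -
  have "scl (\<Union>i\<in>I. X i) = scl (\<Union>i\<in>I. X' i)" if "x \<noteq> PU"
    by (intro antisym scl_UN_mono) (use assms(2) that in \<open>auto simp: ple_def\<close>)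
  moreover have "(\<Inter>i\<in>I. upE (X i)) = (\<Inter>i\<in>I. upE (X' i))" if "x \<noteq> PL"
    by (intro INF_cong refl antisym) (use assms(2) that in \<open>auto simp: ple_def\<close>)
  moreover have "x \<noteq> PU \<Longrightarrow> scl Y' = scl Y" "x \<noteq> PL \<Longrightarrow> upE Y' = upE Y"
    using assms(3,4) by (auto simp: ple_def)
  ultimately show ?thesis using assms(1) by (simp add: islim_def)
qed

section \<open>Convex hulls of sets of functions\<close>

definition hullE :: "('s \<Rightarrow> ennreal) set \<Rightarrow> ('s \<Rightarrow> ennreal) set" where
  "hullE F = \<Inter>{A. F \<subseteq> A \<and> cvx A}"

lemma hullE_inc: "F \<subseteq> hullE F" by (auto simp: hullE_def)
lemma cvx_hullE: "cvx (hullE F)" unfolding hullE_def by (rule cvx_Inter) auto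
lemma hullE_min: "F \<subseteq> A \<Longrightarrow> cvx A \<Longrightarrow> hullE F \<subseteq> A" by (auto simp: hullE_def)
lemma hullE_mono: "F \<subseteq> G \<Longrightarrow> hullE F \<subseteq> hullE G"
  using hullE_min[of F "hullE G"] hullE_inc[of G] cvx_hullE[of G] by blast
lemma hullE_ident: "cvx A \<Longrightarrow> hullE A = A"
  using hullE_min[of A A] hullE_inc[of A] by blast
lemma hullE_eq_empty [simp]: "hullE F = {} \<longleftrightarrow> F = {}"
  using hullE_inc[of F] hullE_min[of "{}" "{}"] by (auto simp: cvx_def)

lemma ennreal_convex_same: "0 \<le> p \<Longrightarrow> p \<le> 1 \<Longrightarrow> ennreal p * c + ennreal (1 - p) * c = c"
  by (simp add: distrib_right[symmetric] ennreal_plus[symmetric] del: ennreal_plus)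

lemma mixv_same: "0 \<le> p \<Longrightarrow> p \<le> 1 \<Longrightarrow> mixv p a a = a"
  by (simp add: mixv_def ennreal_convex_same)

lemma cvx_singleton: "cvx {a}"
  by (simp add: cvx_def mixv_same)

lemma mixv_1: "mixv 1 a b = a" and mixv_0: "mixv 0 a b = b"
  by (simp_all add: mixv_def)

lemma ennreal_mult_quot:
  assumes "0 \<le> a" "0 < r" shows "ennreal r * (ennreal (a / r) * z) = ennreal a * z"
  using assms by (simp add: mult.assoc[symmetric] ennreal_mult[symmetric])

text \<open>The mixture with weight \<open>u / r\<close>, multiplied by \<open>r\<close> again. The
  equation is written without division so as to include \<open>r = 0\<close>, where both sides
  vanish.\<close>

lemma mixv_scaled:
  assumes "0 \<le> u" "0 \<le> v" "r = u + v" "a0 \<in> A" "cvx A" "a \<in> A" "a' \<in> A"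
  shows "\<exists>a''\<in>A. \<forall>i. ennreal u * a i + ennreal v * a' i = ennreal r * a'' i"
proof (cases "r = 0")
  case True
  then have "u = 0" "v = 0" using assms by auto
  then show ?thesis using assms by (intro bexI[of _ a0]) auto
next
  case False
  then have r: "r > 0" using assms by auto
  have "1 - u / r = v / r" using r assms by (simp add: field_simps)
  then have "mixv (u / r) a a' = (\<lambda>i. ennreal (u / r) * a i + ennreal (v / r) * a' i)"
    by (simp add: mixv_def)
  moreover have "mixv (u / r) a a' \<in> A" using assms r by (intro cvxD) (auto simp: field_simps)
  ultimately show ?thesis using assms(1,2) r
    by (intro bexI[of _ "mixv (u / r) a a'"])
      (simp_all only: distrib_left ennreal_mult_quot simp_thms)
qed

lemma cvx_join:
  assumes A: "cvx A" and B: "cvx B"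
  shows "cvx {mixv p a b | p a b. p \<in> {0..1} \<and> a \<in> A \<and> b \<in> B}"
  unfolding cvx_def
proof (intro ballI allI impI)
  fix x y p assume "x \<in> {mixv p a b | p a b. p \<in> {0..1} \<and> a \<in> A \<and> b \<in> B}"
    and "y \<in> {mixv p a b | p a b. p \<in> {0..1} \<and> a \<in> A \<and> b \<in> B}" and p: "0 \<le> p \<and> p \<le> (1::real)"
  then obtain q a b q' a' b' where *: "x = mixv q a b" "y = mixv q' a' b'" "a \<in> A" "a' \<in> A" "b \<in> B" "b' \<in> B"
    "0 \<le> q" "q \<le> 1" "0 \<le> q'" "q' \<le> 1" by auto
  \<comment> \<open>The total weight that the nested mixture puts on \<open>A\<close>; the weight
    left for \<open>B\<close> is \<open>1 - ?r\<close>.\<close>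
  let ?r = "p * q + (1 - p) * q'"
  obtain a'' where a'': "a'' \<in> A"
    "\<And>i. ennreal (p * q) * a i + ennreal ((1 - p) * q') * a' i = ennreal ?r * a'' i"
    using mixv_scaled[of "p * q" "(1 - p) * q'" ?r a A a a'] * p A by auto
  obtain b'' where b'': "b'' \<in> B"
    "\<And>i. ennreal (p * (1 - q)) * b i + ennreal ((1 - p) * (1 - q')) * b' i = ennreal (1 - ?r) * b'' i"
  proof -
    have "1 - ?r = p * (1 - q) + (1 - p) * (1 - q')" by (simp add: algebra_simps)
    from mixv_scaled[OF _ _ this *(5) B *(5,6)] that show ?thesis using * p by auto
  qed
  have "mixv p x y i = mixv ?r a'' b'' i" for i
  proof -
    have "mixv p x y i = (ennreal (p * q) * a i + ennreal ((1 - p) * q') * a' i)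
      + (ennreal (p * (1 - q)) * b i + ennreal ((1 - p) * (1 - q')) * b' i)"
    proof -
      have m: "ennreal (p * q) = ennreal p * ennreal q" "ennreal (p * (1 - q)) = ennreal p * ennreal (1 - q)"
        "ennreal ((1 - p) * q') = ennreal (1 - p) * ennreal q'"
        "ennreal ((1 - p) * (1 - q')) = ennreal (1 - p) * ennreal (1 - q')"
        using * p by (simp_all add: ennreal_mult)
      show ?thesis unfolding m *(1,2) mixv_def by (simp only: distrib_left mult.assoc ac_simps)
    qed
    then show ?thesis by (simp only: a'' b'' mixv_def)
  qed
  then have "mixv p x y = mixv ?r a'' b''" by (rule ext)
  moreover have "0 \<le> ?r" using p * by simp
  moreover have "?r \<le> 1" using convex_bound_le[of q 1 q' p "1 - p"] p * by (simp add: mult.commute)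
  ultimately show "mixv p x y \<in> {mixv p a b | p a b. p \<in> {0..1} \<and> a \<in> A \<and> b \<in> B}"
    using a'' b'' by auto
qed

text \<open>Mixtures of two convex sets form a convex set by \<open>cvx_join\<close>, and the
  weights 1 and 0 recover the two given sets.\<close>

lemma hullE_Un:
  assumes "F \<noteq> {}" "G \<noteq> {}"
  shows "hullE (F \<union> G) = {mixv p a b | p a b. p \<in> {0..1} \<and> a \<in> hullE F \<and> b \<in> hullE G}" (is "_ = ?J")
proof
  obtain f g where fg: "f \<in> hullE F" "g \<in> hullE G"
    using assms hullE_inc[of F] hullE_inc[of G] by blast
  have "a \<in> ?J" if "a \<in> F" for a
    using that fg hullE_inc[of F] by (intro CollectI exI[of _ 1] exI[of _ a] exI[of _ g]) (auto simp: mixv_1)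
  moreover have "a \<in> ?J" if "a \<in> G" for a
    using that fg hullE_inc[of G] by (intro CollectI exI[of _ 0] exI[of _ f] exI[of _ a]) (auto simp: mixv_0)
  ultimately show "hullE (F \<union> G) \<subseteq> ?J"
    by (intro hullE_min cvx_join cvx_hullE) auto
  show "?J \<subseteq> hullE (F \<union> G)"
    using hullE_mono[of F "F \<union> G"] hullE_mono[of G "F \<union> G"]
    by (auto intro!: cvxD[OF cvx_hullE])
qed

lemma hullE_Un_Op:
  assumes "F \<noteq> {}" "G \<noteq> {}"
  shows "hullE (F \<union> G) = Op {0..1} mix_op (\<lambda>j. if j then hullE F else hullE G)"
  by (simp add: hullE_Un[OF assms] Op_mix_op)

lemma closed_upE_singleton: "closed (upE {a :: 's \<Rightarrow> ennreal})"
  using closed_le_fun[of "\<lambda>_. a" "\<lambda>y. y"] by (simp add: upE_def continuous_intros)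

text \<open>Adjoining one point to a finite set is an application of \<open>mix_op\<close> with
  weights in the compact interval {0..1}, and such images have closed saturations.\<close>

lemma closed_upE_hullE: "finite F \<Longrightarrow> F \<noteq> {} \<Longrightarrow> closed (upE (hullE F))"
proof (induction rule: finite_ne_induct)
  case (singleton a)
  then show ?case by (simp add: hullE_ident[OF cvx_singleton] closed_upE_singleton)
next
  case (insert a F)
  have "hullE (insert a F) = Op {0..1} mix_op (\<lambda>j. if j then hullE {a} else hullE F)"
    using hullE_Un_Op[of "{a}" F] insert by simp
  then show ?case using insert
    by (simp only:) (intro closed_upE_Op jcont_mix_op;
        simp add: hullE_ident[OF cvx_singleton] closed_upE_singleton)
qed

lemma generator_cvx:
  assumes "cvx X" "X \<noteq> {}" "closed (upE X)"
  shows "generator x X"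
  unfolding generator_def
  using assms cvx_scl[of X] cvx_upE[of X] subset_scl[of X] subset_upE[of X] by (auto dest: cvxD)

lemma generator_hullE: "finite F \<Longrightarrow> F \<noteq> {} \<Longrightarrow> generator x (hullE F)"
  by (intro generator_cvx cvx_hullE closed_upE_hullE) auto

subsection \<open>Separation\<close>

definition aff :: "(('s \<Rightarrow> ennreal) \<Rightarrow> ennreal) \<Rightarrow> bool" where
  "aff f \<longleftrightarrow> (\<forall>a b p. 0 \<le> p \<longrightarrow> p \<le> 1 \<longrightarrow> f (mixv p a b) = ennreal p * f a + ennreal (1 - p) * f b)"

lemma affD: "aff f \<Longrightarrow> 0 \<le> p \<Longrightarrow> p \<le> 1 \<Longrightarrow> f (mixv p a b) = ennreal p * f a + ennreal (1 - p) * f b"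
  by (auto simp: aff_def)

lemma aff_sum:
  assumes "\<And>t. t \<in> T \<Longrightarrow> aff (f t)"
  shows "aff (\<lambda>a. \<Sum>t\<in>T. c t * f t a)"
  using assms unfolding aff_def
  by (simp add: sum.distrib sum_distrib_left distrib_left mult.left_commute)

text \<open>Each pair in \<open>L\<close> bounds the weight \<open>l\<close> from above and each
  pair in \<open>R\<close> bounds it from below. \<open>seg\<close> says that every lower bound is
  at most every upper bound, so the supremum of the lower bounds is a solution.\<close>

lemma minimax_real:
  fixes L :: "(real \<times> real) set" and R :: "(real \<times> real) set"
  assumes c: "0 < c'" "c' < c"
    and L: "\<And>u v. (u, v) \<in> L \<Longrightarrow> 0 \<le> u \<and> u < c' \<and> c \<le> v"
    and R: "\<And>u v. (u, v) \<in> R \<Longrightarrow> c \<le> u \<and> 0 \<le> v \<and> v < c'"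
    and seg: "\<And>u v u' v'. (u, v) \<in> L \<Longrightarrow> (u', v') \<in> R \<Longrightarrow> c' * (u' - u) \<le> v * (u' - c') + v' * (c' - u)"
  shows "\<exists>l. 0 < l \<and> l < 1 \<and> (\<forall>(u, v)\<in>L \<union> R. c' \<le> l * u + (1 - l) * v)"
proof -
  \<comment> \<open>All bounds from \<open>R\<close> are at most \<open>c' / c\<close> and all
    bounds from \<open>L\<close> at least \<open>1 - c' / c\<close>, so \<open>d\<close> keeps the
    weight away from both 0 and 1; the cap 1/2 gives \<open>d \<le> 1 - d\<close>.\<close>
  define d where "d = min (1/2) (1 - c' / c)"
  have d: "0 < d" "d \<le> 1/2" "d \<le> 1 - c' / c"
    using c min.cobounded1[of "1/2" "1 - c' / c"] by (auto simp: d_def)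
  define S where "S = insert d ((\<lambda>(u, v). (c' - v) / (u - v)) ` R)"
  have S1: "s \<le> 1 - d" if "s \<in> S" for s
  proof -
    have "(c' - v) / (u - v) \<le> 1 - d" if "(u, v) \<in> R" for u v
    proof -
      note uv = R[OF that]
      have "(c' - v) * u \<le> c' * (u - v)" using uv c mult_right_mono[of c' u v] by (simp add: algebra_simps)
      then have "(c' - v) / (u - v) \<le> c' / u" using uv c by (simp add: field_simps)
      also have "\<dots> \<le> c' / c" using uv c by (intro divide_left_mono) auto
      also have "\<dots> \<le> 1 - d" using d by simp
      finally show ?thesis .
    qed
    then show ?thesis using that d unfolding S_def by auto
  qed
  have S2: "s \<le> (v - c') / (v - u)" if s: "s \<in> S" and uv: "(u, v) \<in> L" for s u v
  proof -
    note uv' = L[OF uv]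
    have "d \<le> (v - c') / (v - u)"
    proof -
      have "d \<le> 1 - c' / c" by fact
      also have "\<dots> \<le> 1 - c' / v" using uv' c by (simp add: divide_left_mono)
      also have "\<dots> = (v - c') / v" using uv' c by (simp add: field_simps)
      also have "\<dots> \<le> (v - c') / (v - u)" using uv' c by (intro divide_left_mono) auto
      finally show ?thesis .
    qed
    moreover have "(c' - v') / (u' - v') \<le> (v - c') / (v - u)" if uvr: "(u', v') \<in> R" for u' v'
    proof -
      have pos: "u' - v' > 0" "v - u > 0" using uv' R[OF uvr] c by auto
      have "(c' - v') * (v - u) \<le> (v - c') * (u' - v')"
        using seg[OF uv uvr] by (simp add: algebra_simps)
      then show ?thesis using pos by (simp add: frac_le_eq divide_simps mult.commute)
    qed
    ultimately show ?thesis using s unfolding S_def by auto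
  qed
  have bdd: "bdd_above S" using S1 by (auto simp: bdd_above_def)
  have ne: "S \<noteq> {}" by (simp add: S_def)
  define l where "l = Sup S"
  have l1: "d \<le> l" unfolding l_def using bdd by (intro cSup_upper) (auto simp: S_def)
  have l2: "l \<le> 1 - d" unfolding l_def using ne S1 by (intro cSup_least)
  have "c' \<le> l * u + (1 - l) * v" if uv: "(u, v) \<in> L" for u v
  proof -
    have "l \<le> (v - c') / (v - u)" unfolding l_def using ne S2 uv by (intro cSup_least)
    then have "l * (v - u) \<le> v - c'" using L[OF uv] c by (simp add: field_simps)
    then show ?thesis by (simp add: algebra_simps)
  qed
  moreover have "c' \<le> l * u + (1 - l) * v" if uv: "(u, v) \<in> R" for u v
  proof -
    have "(c' - v) / (u - v) \<le> l" unfolding l_def using bdd uv by (intro cSup_upper) (force simp: S_def)+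
    then have "c' - v \<le> l * (u - v)" using R[OF uv] c by (simp add: field_simps)
    then show ?thesis by (simp add: algebra_simps)
  qed
  ultimately show ?thesis using d l1 l2 by (intro exI[of _ l]) auto
qed

text \<open>The margin \<open>c' < c\<close> confines the weight to a compact part of the open unit interval; there infinite
  values of \<open>f\<close> or \<open>g\<close> can only help, and the remaining constraints are pairwise compatible intervals.\<close>

lemma minimax_two:
  fixes f g :: "('s \<Rightarrow> ennreal) \<Rightarrow> ennreal"
  assumes A: "cvx A" and f: "aff f" and g: "aff g" and c: "0 < c'" "c' < (c::real)"
    and max: "\<And>a. a \<in> A \<Longrightarrow> ennreal c \<le> f a \<or> ennreal c \<le> g a"
  shows "\<exists>l. 0 \<le> l \<and> l \<le> 1 \<and> (\<forall>a\<in>A. ennreal c' \<le> ennreal l * f a + ennreal (1 - l) * g a)"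
proof -
  let ?V = "\<lambda>a. (enn2real (f a), enn2real (g a))"
  let ?fin = "\<lambda>a. f a \<noteq> top \<and> g a \<noteq> top"
  define L where "L = ?V ` {a\<in>A. f a < ennreal c' \<and> ?fin a}"
  define R where "R = ?V ` {a\<in>A. g a < ennreal c' \<and> ?fin a}"
  have val: "f a = ennreal (enn2real (f a))" "g a = ennreal (enn2real (g a))" if "?fin a" for a
    using that by (simp_all add: less_top)
  have cc: "ennreal c' < ennreal c" using c by (simp add: ennreal_lessI)
  have L: "0 \<le> u \<and> u < c' \<and> c \<le> v" if "(u, v) \<in> L" for u v
  proof -
    from that obtain a where a: "a \<in> A" "f a < ennreal c'" "?fin a" "u = enn2real (f a)" "v = enn2real (g a)"
      by (auto simp: L_def)
    have "\<not> ennreal c \<le> f a" using a(2) cc by auto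
    with max a(1) have "ennreal c \<le> ennreal v" using val[OF a(3)] a(5) by auto
    moreover have "ennreal u < ennreal c'" using val[OF a(3)] a by metis
    ultimately show ?thesis using c a by (auto simp: ennreal_less_iff)
  qed
  have R: "c \<le> u \<and> 0 \<le> v \<and> v < c'" if "(u, v) \<in> R" for u v
  proof -
    from that obtain a where a: "a \<in> A" "g a < ennreal c'" "?fin a" "u = enn2real (f a)" "v = enn2real (g a)"
      by (auto simp: R_def)
    have "\<not> ennreal c \<le> g a" using a(2) cc by auto
    with max a(1) have "ennreal c \<le> ennreal u" using val[OF a(3)] a(4) by auto
    moreover have "ennreal v < ennreal c'" using val[OF a(3)] a by metis
    ultimately show ?thesis using c a by (auto simp: ennreal_less_iff)
  qed
  have seg: "c' * (u' - u) \<le> v * (u' - c') + v' * (c' - u)" if uv: "(u, v) \<in> L" "(u', v') \<in> R" for u v u' v'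
  proof -
    note l = L[OF uv(1)] and r = R[OF uv(2)]
    from uv obtain a b where ab: "a \<in> A" "b \<in> A" "?fin a" "?fin b" "u = enn2real (f a)" "v = enn2real (g a)"
      "u' = enn2real (f b)" "v' = enn2real (g b)" by (auto simp: L_def R_def)
    have fab: "f a = ennreal u" "g a = ennreal v" "f b = ennreal u'" "g b = ennreal v'"
      using val[OF ab(3)] val[OF ab(4)] ab by auto
    \<comment> \<open>The weight at which \<open>f\<close> takes the value \<open>c'\<close> on the
      segment between \<open>a\<close> and \<open>b\<close>. There \<open>f\<close> is below
      \<open>c\<close>, so \<open>g\<close> is at least \<open>c\<close>, and this is the required
      inequality.\<close>
    define t where "t = (u' - c') / (u' - u)"
    have pos: "u' - u > 0" using l r c by auto
    have t: "0 \<le> t" "t \<le> 1" using l r c by (auto simp: t_def field_simps)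
    have mA: "mixv t a b \<in> A" using A ab t by (intro cvxD)
    have tu: "1 - t = (c' - u) / (u' - u)" using pos by (simp add: t_def field_simps)
    have "f (mixv t a b) = ennreal (t * u + (1 - t) * u')"
      using affD[OF f t] fab t l r c by (simp add: ennreal_mult ennreal_plus)
    also have "t * u + (1 - t) * u' = u' - t * (u' - u)" by (simp add: algebra_simps)
    also have "\<dots> = c'" using pos by (simp add: t_def)
    finally have "\<not> ennreal c \<le> f (mixv t a b)" using cc by auto
    with max[OF mA] have "ennreal c \<le> g (mixv t a b)" by auto
    also have "g (mixv t a b) = ennreal (t * v + (1 - t) * v')"
      using affD[OF g t] fab t l r c by (simp add: ennreal_mult ennreal_plus)
    finally have "c \<le> t * v + (1 - t) * v'" using t l r c by (subst (asm) ennreal_le_iff) auto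
    then have "c' \<le> (u' - c') / (u' - u) * v + (c' - u) / (u' - u) * v'" using c tu by (simp add: t_def)
    then have "c' \<le> (v * (u' - c') + v' * (c' - u)) / (u' - u)" by (simp add: add_divide_distrib mult.commute)
    then show ?thesis using pos by (simp add: field_simps)
  qed
  obtain l where l: "0 < l" "l < 1" "\<And>u v. (u, v) \<in> L \<union> R \<Longrightarrow> c' \<le> l * u + (1 - l) * v"
    using minimax_real[of c' c L R, OF c L R seg] by blast
  have "ennreal c' \<le> ennreal l * f a + ennreal (1 - l) * g a" if a: "a \<in> A" for a
  proof -
    \<comment> \<open>Both weights are positive, so an infinite value of either function makes the
      mixture infinite; this is why \<open>l\<close> must avoid the endpoints.\<close>
    consider "f a = top" | "g a = top" | "?fin a" "?V a \<in> L \<union> R" | "ennreal c' \<le> f a" "ennreal c' \<le> g a"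
    proof (cases "f a = top \<or> g a = top \<or> (ennreal c' \<le> f a \<and> ennreal c' \<le> g a)")
      case False
      then have "?fin a" "f a < ennreal c' \<or> g a < ennreal c'" by (auto simp: not_le)
      then have "?V a \<in> L \<union> R" using a unfolding L_def R_def by blast
      then show ?thesis using \<open>?fin a\<close> that by blast
    qed (use that in blast)
    then show ?thesis
    proof cases
      case 1 then show ?thesis using l by (simp add: ennreal_mult_top)
    next
      case 2 then show ?thesis using l by (simp add: ennreal_mult_top)
    next
      case 3
      then have "c' \<le> l * enn2real (f a) + (1 - l) * enn2real (g a)" using l by auto
      then have "ennreal c' \<le> ennreal (l * enn2real (f a) + (1 - l) * enn2real (g a))"
        by (rule ennreal_leI)
      also have "\<dots> = ennreal l * f a + ennreal (1 - l) * g a"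
        using l val[OF 3(1)] by (simp add: ennreal_mult)
      finally show ?thesis .
    next
      case 4
      have "ennreal c' = ennreal l * ennreal c' + ennreal (1 - l) * ennreal c'"
        using l by (simp add: ennreal_convex_same)
      also have "\<dots> \<le> ennreal l * f a + ennreal (1 - l) * g a"
        using 4 by (intro add_mono mult_left_mono) auto
      finally show ?thesis .
    qed
  qed
  then show ?thesis using l by (intro exI[of _ l]) auto
qed

text \<open>Induction on the number of functions. On the convex set where \<open>\<phi> s\<close> is
  below \<open>c\<close> the remaining functions reach \<open>c\<close>, so they merge into one
  affine function there, which is then combined with \<open>\<phi> s\<close> on all of
  \<open>A\<close>.\<close>

lemma minimax_finite:
  fixes \<phi> :: "'t \<Rightarrow> ('s \<Rightarrow> ennreal) \<Rightarrow> ennreal"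
  assumes "finite T" "T \<noteq> {}" "cvx A" "\<And>t. t \<in> T \<Longrightarrow> aff (\<phi> t)" "0 < c'" "c' < (c::real)"
    "\<And>a. a \<in> A \<Longrightarrow> \<exists>t\<in>T. ennreal c \<le> \<phi> t a"
  shows "\<exists>w. (\<forall>t\<in>T. 0 \<le> w t) \<and> (\<Sum>t\<in>T. w t) = (1::real) \<and> (\<forall>a\<in>A. ennreal c' \<le> (\<Sum>t\<in>T. ennreal (w t) * \<phi> t a))"
  using assms
proof (induction T arbitrary: A c' rule: finite_ne_induct)
  case (singleton t)
  have "ennreal c' \<le> ennreal c" using singleton by (simp add: ennreal_leI)
  then have "\<forall>a\<in>A. ennreal c' \<le> \<phi> t a" using singleton.prems(5) by (auto intro: order_trans)
  then show ?case by (intro exI[of _ "\<lambda>_. 1"]) simp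
next
  case (insert s T)
  \<comment> \<open>The induction hypothesis and the two-function case each consume a strict margin,
    so an intermediate level is inserted.\<close>
  obtain c'' where c'': "c' < c''" "c'' < c" using dense[OF insert.prems(4)] by blast
  let ?A' = "{a\<in>A. \<phi> s a < ennreal c}"
  have "cvx ?A'" unfolding cvx_def
  proof (intro ballI allI impI)
    fix a b p assume ab: "a \<in> ?A'" "b \<in> ?A'" "0 \<le> p \<and> p \<le> (1::real)"
    have "\<phi> s (mixv p a b) = ennreal p * \<phi> s a + ennreal (1 - p) * \<phi> s b"
      using insert.prems(2)[of s] ab by (intro affD) auto
    also have "\<dots> \<le> ennreal p * max (\<phi> s a) (\<phi> s b) + ennreal (1 - p) * max (\<phi> s a) (\<phi> s b)"
      by (intro add_mono mult_left_mono) auto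
    also have "\<dots> = max (\<phi> s a) (\<phi> s b)" using ab by (intro ennreal_convex_same) auto
    also have "\<dots> < ennreal c" using ab by simp
    finally show "mixv p a b \<in> ?A'" using ab insert.prems(1) by (auto intro: cvxD)
  qed
  moreover have "\<exists>t\<in>T. ennreal c \<le> \<phi> t a" if "a \<in> ?A'" for a
    using insert.prems(5)[of a] that by auto
  ultimately obtain w where w: "\<forall>t\<in>T. 0 \<le> w t" "(\<Sum>t\<in>T. w t) = 1"
    "\<forall>a\<in>?A'. ennreal c'' \<le> (\<Sum>t\<in>T. ennreal (w t) * \<phi> t a)"
    using insert.IH[of ?A' c''] insert.prems(2,3) c'' by auto
  let ?g = "\<lambda>a. \<Sum>t\<in>T. ennreal (w t) * \<phi> t a"
  have "aff ?g" using insert.prems(2) by (intro aff_sum) auto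
  moreover have "ennreal c'' \<le> \<phi> s a \<or> ennreal c'' \<le> ?g a" if "a \<in> A" for a
  proof (cases "\<phi> s a < ennreal c")
    case False
    then have "ennreal c'' \<le> \<phi> s a" using ennreal_leI[of c'' c] c'' by (auto simp: not_less intro: order_trans)
    then show ?thesis by blast
  qed (use w(3) that in auto)
  ultimately obtain l where l: "0 \<le> l" "l \<le> 1"
    "\<forall>a\<in>A. ennreal c' \<le> ennreal l * \<phi> s a + ennreal (1 - l) * ?g a"
    using minimax_two[of A "\<phi> s" ?g c' c''] insert.prems c'' by auto
  define w' where "w' t = (if t = s then l else (1 - l) * w t)" for t
  have eq: "(\<Sum>t\<in>insert s T. ennreal (w' t) * \<phi> t a) = ennreal l * \<phi> s a + ennreal (1 - l) * ?g a" for a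
  proof -
    have "(\<Sum>t\<in>T. ennreal (w' t) * \<phi> t a) = (\<Sum>t\<in>T. ennreal (1 - l) * (ennreal (w t) * \<phi> t a))"
      using insert.hyps l w(1) by (intro sum.cong) (auto simp: w'_def ennreal_mult mult.assoc)
    then show ?thesis using insert.hyps by (simp add: w'_def sum_distrib_left)
  qed
  have "(\<Sum>t\<in>T. w' t) = (\<Sum>t\<in>T. (1 - l) * w t)"
    using insert.hyps by (intro sum.cong) (auto simp: w'_def)
  then have "(\<Sum>t\<in>insert s T. w' t) = 1"
    using insert.hyps w(2) by (simp add: w'_def sum_distrib_left[symmetric])
  moreover have "\<forall>t\<in>insert s T. 0 \<le> w' t" using l w(1) by (auto simp: w'_def)
  ultimately show ?case using l(3) by (intro exI[of _ w'] conjI ballI) (simp_all only: eq)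
qed

text \<open>Local convexity: finitely many coordinates distinguish \<open>y\<close> from \<open>A\<close> by compactness, and minimax
  merges them into one linear functional.\<close>

lemma separation:
  fixes A :: "('s \<Rightarrow> ennreal) set"
  assumes A: "closed A" "cvx A" and y: "y \<notin> upE A"
  shows "\<exists>g c. lsc g \<and> mono g \<and> aff g \<and> g y < c \<and> (\<forall>a\<in>A. c < g a)"
proof (cases "A = {}")
  case True
  then show ?thesis
    by (intro exI[of _ "\<lambda>_. 0"] exI[of _ 1]) (auto simp: lsc_const mono_def aff_def)
next
  case False
  \<comment> \<open>Thresholds are taken positive and finite so that coordinates can be divided by
    them.\<close>
  define D where "D = {(s, d). y s < d \<and> 0 < d \<and> d < (top::ennreal)}"
  have cov: "A \<subseteq> (\<Union>c\<in>D. {a. snd c < a (fst c)})"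
  proof
    fix a assume "a \<in> A"
    then have "\<not> a \<le> y" using y by (auto simp: upE_def)
    then obtain s where "y s < a s" by (auto simp: le_fun_def not_le)
    then obtain d where d: "y s < d" "d < a s" using dense by blast
    then have "(s, d) \<in> D" by (auto simp: D_def intro: le_less_trans less_le_trans)
    with d show "a \<in> (\<Union>c\<in>D. {a. snd c < a (fst c)})" by force
  qed
  have op: "open {a :: 's \<Rightarrow> ennreal. snd c < a (fst c)}" for c
    using lsc_coordinate[where 'i = 's] by (simp add: lsc_def)
  obtain T where T: "T \<subseteq> D" "finite T" "A \<subseteq> (\<Union>c\<in>T. {a. snd c < a (fst c)})"
    by (rule compactE_image[OF closed_imp_compact_ennfun[OF A(1)] op cov])
  \<comment> \<open>Normalised coordinates: at \<open>y\<close> all of them are below 1, while at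
    each point of \<open>A\<close> at least one reaches 1.\<close>
  define \<phi> where "\<phi> t a = a (fst t) / snd t" for t and a :: "'s \<Rightarrow> ennreal"
  have Tne: "T \<noteq> {}" using T(3) False by auto
  have "\<phi> t y < 1" if "t \<in> T" for t
  proof -
    have t: "y (fst t) < snd t" "0 < snd t" "snd t < top" using that T(1) by (auto simp: D_def)
    then have "snd t \<noteq> 0" by auto
    then show ?thesis using t by (simp add: \<phi>_def divide_less_ennreal)
  qed
  then have "Max ((\<lambda>t. \<phi> t y) ` T) < 1" using T Tne by (subst Max_less_iff) auto
  \<comment> \<open>Three levels below 1: \<open>c1\<close> bounds the functional at
    \<open>y\<close>, \<open>c3\<close> is the level that minimax secures on \<open>A\<close>, and
    \<open>c2\<close> between them makes both inequalities strict.\<close>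
  then obtain c1 where c1: "Max ((\<lambda>t. \<phi> t y) ` T) < c1" "c1 < 1" using dense by blast
  obtain c2 where c2: "c1 < c2" "c2 < 1" using dense[OF c1(2)] by blast
  obtain c3 where c3: "c2 < c3" "c3 < 1" using dense[OF c2(2)] by blast
  have r3: "ennreal (enn2real c3) = c3" using c3 by (intro ennreal_enn2real) (auto intro: less_trans)
  have c3': "0 < enn2real c3" "enn2real c3 < 1"
    using c3 c2 c1 by (auto simp: enn2real_positive_iff r3 intro: le_less_trans less_trans
        dest: less_trans) (metis ennreal_1 ennreal_less_iff enn2real_nonneg r3 c3(2))
  have "aff (\<phi> t)" for t
    by (auto simp: aff_def \<phi>_def mixv_def add_divide_distrib_ennreal ennreal_times_divide)
  moreover have "\<exists>t\<in>T. ennreal 1 \<le> \<phi> t a" if "a \<in> A" for a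
  proof -
    have "a \<in> (\<Union>c\<in>T. {a. snd c < a (fst c)})" using T(3) that by blast
    then obtain s d where sd: "(s, d) \<in> T" "d < a s" by auto
    then have "0 < d" "d < top" using T(1) by (auto simp: D_def)
    then have "1 = d / d" by simp
    also have "\<dots> \<le> a s / d" using sd by (intro divide_right_mono_ennreal) auto
    finally show ?thesis using sd by (intro bexI[of _ "(s, d)"]) (auto simp: \<phi>_def)
  qed
  ultimately obtain w where w: "\<forall>t\<in>T. 0 \<le> w t" "(\<Sum>t\<in>T. w t) = (1::real)"
    "\<forall>a\<in>A. c3 \<le> (\<Sum>t\<in>T. ennreal (w t) * \<phi> t a)"
    using minimax_finite[OF T(2) Tne A(2), of \<phi> "enn2real c3" 1] c3' r3 by auto
  define g where "g a = (\<Sum>t\<in>T. ennreal (w t) * \<phi> t a)" for a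
  have "g y \<le> (\<Sum>t\<in>T. ennreal (w t) * c1)"
    unfolding g_def
  proof (intro sum_mono mult_left_mono)
    fix t assume "t \<in> T"
    then have "\<phi> t y \<le> Max ((\<lambda>t. \<phi> t y) ` T)" using T by (intro Max_ge) auto
    then show "\<phi> t y \<le> c1" using c1 by simp
  qed simp
  also have "\<dots> = c1"
    using w by (simp add: sum_distrib_right[symmetric])
  finally have "g y < c2" using c2 by auto
  moreover have "\<forall>a\<in>A. c2 < g a" using w(3) c3 by (auto simp: g_def intro: less_le_trans)
  moreover have "lsc g" unfolding g_def \<phi>_def divide_ennreal_def
    by (intro lsc_sum lsc_mult lsc_const lsc_coordinate)
  moreover have "mono g" unfolding g_def \<phi>_def
    by (intro monoI sum_mono mult_left_mono divide_right_mono_ennreal) (auto simp: le_fun_def)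
  moreover have "aff g" unfolding g_def using \<open>\<And>t. aff (\<phi> t)\<close> by (intro aff_sum)
  ultimately show ?thesis by blast
qed

subsection \<open>Density of the finitely generated elements\<close>

definition simple_fn :: "('s \<Rightarrow> ennreal) \<Rightarrow> bool" where
  "simple_fn b \<longleftrightarrow> finite {i. b i \<noteq> 0} \<and> (\<forall>i. b i \<noteq> top)"

lemma way_below_simple_fn: "way_below b a \<Longrightarrow> simple_fn b"
proof -
  assume b: "way_below b a"
  have "b i \<noteq> top" for i
    using b by (cases "b i = 0") (auto simp: way_below_def less_top intro: less_le_trans)
  then show "simple_fn b" using b by (simp add: way_below_def simple_fn_def)
qed

text \<open>Finite sets of simple functions whose hull generates an element way below \<open>A\<close>.\<close>

definition approx :: "pk \<Rightarrow> ('s \<Rightarrow> ennreal) set \<Rightarrow> ('s \<Rightarrow> ennreal) set \<Rightarrow> bool" where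
  "approx x F A \<longleftrightarrow> finite F \<and> F \<noteq> {} \<and> (\<forall>f\<in>F. simple_fn f) \<and>
     (x \<noteq> PU \<longrightarrow> (\<forall>f\<in>F. \<exists>a\<in>A. way_below f a)) \<and> (x \<noteq> PL \<longrightarrow> (\<forall>a\<in>A. \<exists>f\<in>F. way_below f a))"

text \<open>The sets of points with \<open>b\<close> way below them are open and cover the compact
  set \<open>A\<close>, so finitely many suffice. \<open>P\<close> carries an additional property
  through the choice, such as lying in a half-space.\<close>

lemma way_below_cover:
  assumes A: "closed A" and P: "\<And>a. a \<in> A \<Longrightarrow> \<exists>b. way_below b a \<and> P b"
  shows "\<exists>F. finite F \<and> (\<forall>f\<in>F. P f \<and> (\<exists>a\<in>A. way_below f a)) \<and> (\<forall>a\<in>A. \<exists>f\<in>F. way_below f a)"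
proof -
  have "A \<subseteq> (\<Union>b\<in>{b. P b \<and> (\<exists>a\<in>A. way_below b a)}. {a. way_below b a})" using P by blast
  then obtain F where "F \<subseteq> {b. P b \<and> (\<exists>a\<in>A. way_below b a)}" "finite F" "A \<subseteq> (\<Union>b\<in>F. {a. way_below b a})"
    by (rule compactE_image[OF closed_imp_compact_ennfun[OF A] open_way_below])
  then show ?thesis by (intro exI[of _ F]) auto
qed

lemma scl_hullE_mono:
  assumes "\<And>f. f \<in> F \<Longrightarrow> \<exists>g\<in>G. f \<le> g" shows "scl (hullE F) \<subseteq> scl (hullE G)"
  unfolding scl_subset_iff
proof (rule hullE_min)
  show "F \<subseteq> scl (hullE G)"
  proof
    fix f assume "f \<in> F"
    then obtain g where "g \<in> G" "f \<le> g" using assms by blast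
    moreover then have "g \<in> scl (hullE G)" using hullE_inc[of G] subset_scl[of "hullE G"] by blast
    ultimately show "f \<in> scl (hullE G)" by (metis scl_down)
  qed
  show "cvx (scl (hullE G))"
    by (rule cvx_scl) (use subset_scl[of "hullE G"] cvxD[OF cvx_hullE, of _ G] in blast)
qed

lemma upE_hullE_mono:
  assumes "\<And>g. g \<in> G \<Longrightarrow> \<exists>f\<in>F. f \<le> g" shows "upE (hullE G) \<subseteq> upE (hullE F)"
proof -
  have "hullE G \<subseteq> upE (hullE F)"
  proof (rule hullE_min)
    show "G \<subseteq> upE (hullE F)" using assms hullE_inc[of F] by (fastforce simp: upE_def)
    show "cvx (upE (hullE F))"
      by (rule cvx_upE) (use subset_upE[of "hullE F"] cvxD[OF cvx_hullE, of _ F] in blast)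
  qed
  then show ?thesis using upE_mono[of "hullE G" "upE (hullE F)"] by simp
qed

lemma ple_hullE:
  assumes "x \<noteq> PU \<Longrightarrow> \<forall>f\<in>F. \<exists>g\<in>G. f \<le> g" "x \<noteq> PL \<Longrightarrow> \<forall>g\<in>G. \<exists>f\<in>F. f \<le> g"
  shows "ple x (hullE F) (hullE G)"
  unfolding ple_def using assms scl_hullE_mono[of F G] upE_hullE_mono[of G F] by blast

lemma approx_exists:
  assumes A: "closed A" "A \<noteq> {}" shows "\<exists>F. approx x F A"
proof (cases "x = PL")
  case True
  then show ?thesis using A by (intro exI[of _ "{\<lambda>_. 0}"]) (auto simp: approx_def simple_fn_def)
next
  case False
  obtain F where F: "finite F" "\<forall>f\<in>F. \<exists>a\<in>A. way_below f a" "\<forall>a\<in>A. \<exists>f\<in>F. way_below f a"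
  proof -
    have "\<And>a. a \<in> A \<Longrightarrow> \<exists>b. way_below b a \<and> True" using way_below_zero by blast
    from way_below_cover[OF A(1), of "\<lambda>_. True", OF this] that show ?thesis by auto
  qed
  moreover have "F \<noteq> {}" using A F(3) by auto
  moreover have "\<forall>f\<in>F. simple_fn f" using F(2) way_below_simple_fn by blast
  ultimately have "approx x F A" unfolding approx_def by simp
  then show ?thesis by blast
qed

lemma approx_insert: "approx x F A \<Longrightarrow> a \<in> A \<Longrightarrow> way_below b a \<Longrightarrow> approx x (insert b F) A"
  unfolding approx_def using way_below_simple_fn[of b a] by auto

text \<open>Elements way below one point have their join way below it. The set \<open>B\<close>
  covers \<open>A\<close> for the upper half and \<open>C\<close> dominates the given elements for
  the lower half; \<open>P\<close> keeps everything above members of \<open>F1\<close> and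
  \<open>F2\<close> when the upper half counts.\<close>

lemma approx_directed:
  assumes A: "closed A" "A \<noteq> {}" and F1: "approx x F1 A" and F2: "approx x F2 A"
  shows "\<exists>F. approx x F A \<and> ple x (hullE F1) (hullE F) \<and> ple x (hullE F2) (hullE F)"
proof -
  define P where "P b \<longleftrightarrow> (x \<noteq> PL \<longrightarrow> (\<exists>f\<in>F1. f \<le> b) \<and> (\<exists>f\<in>F2. f \<le> b))" for b
  have ext: "\<exists>b. way_below b a \<and> f \<le> b \<and> P b" if a: "a \<in> A" and f: "way_below f a" for a f
  proof (cases "x = PL")
    case True then show ?thesis using f by (auto simp: P_def)
  next
    case False
    then have "\<exists>f1\<in>F1. way_below f1 a" "\<exists>f2\<in>F2. way_below f2 a" using F1 F2 a by (simp_all add: approx_def)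
    then obtain f1 f2 where *: "f1 \<in> F1" "way_below f1 a" "f2 \<in> F2" "way_below f2 a" by blast
    let ?b = "\<lambda>i. max (f i) (max (f1 i) (f2 i))"
    have "way_below ?b a" by (intro way_below_sup f *)
    moreover have "f \<le> ?b" "f1 \<le> ?b" "f2 \<le> ?b" by (auto simp: le_fun_def le_max_iff_disj)
    ultimately show ?thesis using * by (auto simp: P_def intro!: exI[of _ ?b])
  qed
  have "\<exists>B. finite B \<and> (\<forall>f\<in>B. P f \<and> (\<exists>a\<in>A. way_below f a)) \<and> (x \<noteq> PL \<longrightarrow> (\<forall>a\<in>A. \<exists>f\<in>B. way_below f a))"
  proof -
    have "\<exists>b. way_below b a \<and> P b" if "a \<in> A" for a using ext[OF that way_below_zero] by blast
    from way_below_cover[OF A(1), of P, OF this] show ?thesis by blast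
  qed
  then obtain B where B: "finite B" "\<forall>f\<in>B. P f \<and> (\<exists>a\<in>A. way_below f a)" "x \<noteq> PL \<longrightarrow> (\<forall>a\<in>A. \<exists>f\<in>B. way_below f a)"
    by blast
  have "\<exists>C. finite C \<and> (\<forall>f\<in>C. P f \<and> (\<exists>a\<in>A. way_below f a)) \<and> (\<forall>f\<in>F1 \<union> F2. x \<noteq> PU \<longrightarrow> (\<exists>g\<in>C. f \<le> g))"
  proof (cases "x = PU")
    case False
    have "\<exists>b. f \<le> b \<and> P b \<and> (\<exists>a\<in>A. way_below b a)" if "f \<in> F1 \<union> F2" for f
      using that F1 F2 False ext unfolding approx_def by (metis Un_iff)
    then obtain h where "\<And>f. f \<in> F1 \<union> F2 \<Longrightarrow> f \<le> h f \<and> P (h f) \<and> (\<exists>a\<in>A. way_below (h f) a)" by metis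
    moreover have "finite (h ` (F1 \<union> F2))" using F1 F2 by (simp add: approx_def)
    ultimately show ?thesis by (intro exI[of _ "h ` (F1 \<union> F2)"]) blast
  qed (auto intro: exI[of _ "{}"])
  then obtain C where C: "finite C" "\<forall>f\<in>C. P f \<and> (\<exists>a\<in>A. way_below f a)"
    "\<forall>f\<in>F1 \<union> F2. x \<noteq> PU \<longrightarrow> (\<exists>g\<in>C. f \<le> g)" by blast
  let ?F = "B \<union> C"
  have ne: "?F \<noteq> {}"
  proof (cases "x = PL")
    case True
    moreover obtain f where "f \<in> F1" using F1 by (auto simp: approx_def)
    ultimately show ?thesis using C(3) by auto
  next
    case False then show ?thesis using B(3) A(2) by auto
  qed
  have "approx x ?F A" unfolding approx_def
    using B C ne way_below_simple_fn by (intro conjI) blast+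
  moreover have "ple x (hullE F1) (hullE ?F)" "ple x (hullE F2) (hullE ?F)"
    using B C by (auto intro!: ple_hullE simp: P_def)
  ultimately show ?thesis by blast
qed

text \<open>In the lower half, any element way below a point of \<open>A\<close> can be adjoined to
  an approximating set. In the upper half, a point outside the saturation is separated by an affine
  \<open>g\<close>: finitely many simple functions in the open half-space cover \<open>A\<close>,
  and their hull stays in the closed half-space, which excludes that point.\<close>

lemma approx_islim:
  assumes A: "A \<in> PCE x"
  shows "islim x {F. approx x F A} hullE A" and approx_directed_fam: "directed_fam x {F. approx x F A} hullE"
proof -
  have c: "closed A" "cvx A" "A \<noteq> {}" using A by (auto simp: PCE_def)
  obtain F0 where F0: "approx x F0 A" using approx_exists[OF c(1,3)] by blast
  show "directed_fam x {F. approx x F A} hullE"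
    unfolding directed_fam_def using F0 approx_directed[OF c(1,3)] by blast
  show "islim x {F. approx x F A} hullE A"
    unfolding islim_def
  proof (intro conjI impI antisym)
    assume x: "x \<noteq> PU"
    show "scl A \<subseteq> scl (\<Union>F\<in>{F. approx x F A}. hullE F)"
      unfolding scl_subset_iff
    proof
      fix a assume a: "a \<in> A"
      have "b \<in> dnE (\<Union>F\<in>{F. approx x F A}. hullE F)" if b: "way_below b a" for b
      proof -
        have "approx x (insert b F0) A" using F0 a b by (rule approx_insert)
        moreover have "b \<in> hullE (insert b F0)" using hullE_inc[of "insert b F0"] by blast
        ultimately show ?thesis by (auto simp: dnE_def)
      qed
      then show "a \<in> scl (\<Union>F\<in>{F. approx x F A}. hullE F)" by (simp add: mem_scl)
    qed
    have "hullE F \<subseteq> scl A" if F: "approx x F A" for F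
    proof (rule hullE_min)
      show "F \<subseteq> scl A"
      proof
        fix f assume "f \<in> F"
        then have "\<exists>a\<in>A. way_below f a" using F x by (simp add: approx_def)
        then obtain a where "a \<in> A" "way_below f a" by blast
        then show "f \<in> scl A" using subset_scl[of A] way_below_imp_le scl_down by (metis subsetD)
      qed
      show "cvx (scl A)" using PCE_generator[OF A] x by (simp add: generator_def)
    qed
    then show "scl (\<Union>F\<in>{F. approx x F A}. hullE F) \<subseteq> scl A"
      unfolding scl_subset_iff by blast
  next
    assume x: "x \<noteq> PL"
    show "upE A \<subseteq> (\<Inter>F\<in>{F. approx x F A}. upE (hullE F))"
    proof (intro INT_greatest)
      fix F assume "F \<in> {F. approx x F A}"
      then have "A \<subseteq> upE (hullE F)" using x hullE_inc[of F] way_below_imp_le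
        by (fastforce simp: approx_def upE_def)
      then show "upE A \<subseteq> upE (hullE F)" using upE_mono[of A "upE (hullE F)"] by simp
    qed
    show "(\<Inter>F\<in>{F. approx x F A}. upE (hullE F)) \<subseteq> upE A"
    proof (rule ccontr)
      assume "\<not> ?thesis"
      then obtain y where y: "y \<notin> upE A" "\<And>F. approx x F A \<Longrightarrow> y \<in> upE (hullE F)" by blast
      obtain g c where g: "lsc g" "mono g" "aff g" "g y < c" "\<forall>a\<in>A. c < g a"
        using separation[OF c(1,2) y(1)] by blast
      have "\<exists>b. way_below b a \<and> c < g b" if "a \<in> A" for a
        using way_below_dense[of "{a. c < g a}" a] g that by (auto simp: lsc_def)
      from way_below_cover[OF c(1), of "\<lambda>b. c < g b", OF this]
      obtain F where F: "finite F" "\<forall>f\<in>F. c < g f \<and> (\<exists>a\<in>A. way_below f a)" "\<forall>a\<in>A. \<exists>f\<in>F. way_below f a" by blast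
      moreover have "F \<noteq> {}" using c(3) F(3) by auto
      ultimately have "approx x F A" unfolding approx_def using way_below_simple_fn by blast
      then obtain z where z: "z \<in> hullE F" "z \<le> y" using y(2) by (auto simp: upE_def)
      have "hullE F \<subseteq> {z. c \<le> g z}"
      proof (rule hullE_min)
        show "F \<subseteq> {z. c \<le> g z}" using F by auto
        show "cvx {z. c \<le> g z}" unfolding cvx_def
        proof (intro ballI allI impI)
          fix a b p assume *: "a \<in> {z. c \<le> g z}" "b \<in> {z. c \<le> g z}" "0 \<le> p \<and> p \<le> (1::real)"
          have "c = ennreal p * c + ennreal (1 - p) * c" using * by (simp add: ennreal_convex_same)
          also have "\<dots> \<le> ennreal p * g a + ennreal (1 - p) * g b"
            using * by (intro add_mono mult_left_mono) auto
          also have "\<dots> = g (mixv p a b)" using * by (simp add: affD[OF g(3)])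
          finally show "mixv p a b \<in> {z. c \<le> g z}" by simp
        qed
      qed
      then have "c \<le> g z" using z by blast
      also have "g z \<le> g y" using g(2) z by (simp add: mono_def)
      finally show False using g(4) by simp
    qed
  qed
qed

subsection \<open>The operations on sets of functions\<close>

text \<open>Convexity of the set itself and independence of the kind of powercone make this stable
  under the operations in a form that serves all three cones; only \<open>klS\<close> leaves it,
  yielding a mere \<open>generator\<close>.\<close>

definition cvx_generator :: "('s \<Rightarrow> ennreal) set \<Rightarrow> bool" where
  "cvx_generator A \<longleftrightarrow> A \<noteq> {} \<and> cvx A \<and> closed (upE A)"

lemma cvx_generator_generator: "cvx_generator A \<Longrightarrow> generator x A"
  by (auto simp: cvx_generator_def intro: generator_cvx)

lemma PCE_cvx_generator: "A \<in> PCE x \<Longrightarrow> cvx_generator A"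
  by (auto simp: cvx_generator_def PCE_def closed_upE)

lemma cvx_generator_hullE: "finite F \<Longrightarrow> F \<noteq> {} \<Longrightarrow> cvx_generator (hullE F)"
  by (simp add: cvx_generator_def cvx_hullE closed_upE_hullE)

lemma cvx_generator_singleton: "cvx_generator {a}"
  by (simp add: cvx_generator_def cvx_singleton closed_upE_singleton)

lemma Op_ple_mono:
  assumes "jcont \<theta>" "\<And>j. A j \<noteq> {}" "\<And>j. B j \<noteq> {}" "\<And>j. ple x (A j) (B j)"
  shows "ple x (Op G \<theta> A) (Op G \<theta> B)"
  unfolding ple_def
proof (intro conjI impI)
  show "scl (Op G \<theta> A) \<subseteq> scl (Op G \<theta> B)" if "x \<noteq> PU"
    by (rule Op_scl_mono[OF assms(1,3)]) (use that assms(4) in \<open>auto simp: ple_def\<close>)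
  show "upE (Op G \<theta> B) \<subseteq> upE (Op G \<theta> A)" if "x \<noteq> PL"
    by (rule Op_upE_mono[OF assms(1)]) (use that assms(4) in \<open>auto simp: ple_def\<close>)
qed

text \<open>Joint continuity: directedness is required with one index that works for all arguments
  simultaneously.\<close>

lemma Op_islim:
  assumes \<theta>: "jcont \<theta>" and G: "compact G" and I: "I \<noteq> {}"
    and dir: "\<And>i i'. i \<in> I \<Longrightarrow> i' \<in> I \<Longrightarrow> \<exists>k\<in>I. \<forall>j. ple x (\<A> i j) (\<A> k j) \<and> ple x (\<A> i' j) (\<A> k j)"
    and g: "\<And>i j. i \<in> I \<Longrightarrow> generator x (\<A> i j)" and ne: "\<And>j. B j \<noteq> {}"
    and lim: "\<And>j. islim x I (\<lambda>i. \<A> i j) (B j)"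
  shows "islim x I (\<lambda>i. Op G \<theta> (\<A> i)) (Op G \<theta> B)"
  unfolding islim_def
proof (intro conjI impI antisym)
  have up: "ple x (\<A> i j) (B j)" if "i \<in> I" for i j using islim_upper[OF lim that] .
  have neA: "\<A> i j \<noteq> {}" if "i \<in> I" for i j using g[OF that] by (auto simp: generator_def)
  { assume x: "x \<noteq> PU"
    show "scl (Op G \<theta> B) \<subseteq> scl (\<Union>i\<in>I. Op G \<theta> (\<A> i))"
    proof (rule Op_scl_limit[OF \<theta> I])
      show "B j \<subseteq> scl (\<Union>i\<in>I. \<A> i j)" for j
        using lim[of j] x subset_scl[of "B j"] by (simp add: islim_def)
      show "\<exists>k\<in>I. \<forall>j. scl (\<A> i j) \<subseteq> scl (\<A> k j) \<and> scl (\<A> i' j) \<subseteq> scl (\<A> k j)"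
        if ii: "i \<in> I" "i' \<in> I" for i i'
      proof -
        obtain k where "k \<in> I" "\<forall>j. ple x (\<A> i j) (\<A> k j) \<and> ple x (\<A> i' j) (\<A> k j)"
          using dir[OF ii] by blast
        then show ?thesis using x by (intro bexI[of _ k]) (auto simp: ple_def)
      qed
    qed (use neA in auto)
    have "scl (Op G \<theta> (\<A> i)) \<subseteq> scl (Op G \<theta> B)" if "i \<in> I" for i
      using up[OF that] x ne by (intro Op_scl_mono \<theta>) (auto simp: ple_def)
    then show "scl (\<Union>i\<in>I. Op G \<theta> (\<A> i)) \<subseteq> scl (Op G \<theta> B)"
      unfolding scl_subset_iff by (rule UN_least)
  }
  { assume x: "x \<noteq> PL"
    have "upE (Op G \<theta> B) \<subseteq> upE (Op G \<theta> (\<A> i))" if "i \<in> I" for i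
      using up[OF that] x by (intro Op_upE_mono \<theta>) (auto simp: ple_def)
    then show "upE (Op G \<theta> B) \<subseteq> (\<Inter>i\<in>I. upE (Op G \<theta> (\<A> i)))" by blast
    show "(\<Inter>i\<in>I. upE (Op G \<theta> (\<A> i))) \<subseteq> upE (Op G \<theta> B)"
    proof (rule Op_upE_limit[OF \<theta> G I])
      show "(\<Inter>i\<in>I. upE (\<A> i j)) \<subseteq> upE (B j)" for j using lim[of j] x by (simp add: islim_def)
      show "\<exists>k\<in>I. \<forall>j. upE (\<A> k j) \<subseteq> upE (\<A> i j) \<and> upE (\<A> k j) \<subseteq> upE (\<A> i' j)"
        if ii: "i \<in> I" "i' \<in> I" for i i'
      proof -
        obtain k where "k \<in> I" "\<forall>j. ple x (\<A> i j) (\<A> k j) \<and> ple x (\<A> i' j) (\<A> k j)"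
          using dir[OF ii] by blast
        then show ?thesis using x by (intro bexI[of _ k]) (auto simp: ple_def)
      qed
      show "closed (upE (\<A> i j))" if "i \<in> I" for i j using g[OF that] x by (simp add: generator_def)
    qed
  }
qed

lemma mix_mixv: "0 \<le> p \<Longrightarrow> p \<le> 1 \<Longrightarrow>
    ennreal p * (x + y) + ennreal (1 - p) * (x' + y') =
    (ennreal p * x + ennreal (1 - p) * x') + (ennreal p * y + ennreal (1 - p) * y')"
  by (simp only: distrib_left add_ac)

definition addS :: "('s \<Rightarrow> ennreal) set \<Rightarrow> ('s \<Rightarrow> ennreal) set \<Rightarrow> ('s \<Rightarrow> ennreal) set" where
  "addS A B = {\<lambda>s. a s + b s | a b. a \<in> A \<and> b \<in> B}"

definition scaleS :: "real \<Rightarrow> ('s \<Rightarrow> ennreal) set \<Rightarrow> ('s \<Rightarrow> ennreal) set" where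
  "scaleS r A = {\<lambda>s. ennreal r * a s | a. a \<in> A}"

definition joinS :: "('s \<Rightarrow> ennreal) set \<Rightarrow> ('s \<Rightarrow> ennreal) set \<Rightarrow> ('s \<Rightarrow> ennreal) set" where
  "joinS A B = {mixv p a b | p a b. p \<in> {0..1} \<and> a \<in> A \<and> b \<in> B}"

text \<open>The Kleisli extension before any closure: a selection of \<open>f\<close> is integrated
  against a member of \<open>A\<close>. Selections are total, so an empty \<open>f t\<close> at any
  \<open>t\<close> empties the result.\<close>

definition klS :: "('s \<Rightarrow> ('s \<Rightarrow> ennreal) set) \<Rightarrow> ('s \<Rightarrow> ennreal) set \<Rightarrow> ('s \<Rightarrow> ennreal) set" where
  "klS f A = {\<lambda>s. \<Sum>\<^sub>\<infinity>t. v t * g t s | v g. v \<in> A \<and> (\<forall>t. g t \<in> f t)}"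

text \<open>The ignored real argument only fits the shape of \<open>Op\<close>, whose parameter set
  is then the singleton {0}.\<close>

definition add_op :: "real \<Rightarrow> (bool \<times> 's \<Rightarrow> ennreal) \<Rightarrow> 's \<Rightarrow> ennreal" where
  "add_op _ h = (\<lambda>s. h (True, s) + h (False, s))"

definition scale_op :: "real \<Rightarrow> real \<Rightarrow> (unit \<times> 's \<Rightarrow> ennreal) \<Rightarrow> 's \<Rightarrow> ennreal" where
  "scale_op r _ h = (\<lambda>s. ennreal r * h ((), s))"

text \<open>Index \<open>None\<close> holds the valuation to be integrated, and index
  \<open>Some t\<close> the value selected at \<open>t\<close>.\<close>

definition kl_op :: "real \<Rightarrow> ('s option \<times> 's \<Rightarrow> ennreal) \<Rightarrow> 's \<Rightarrow> ennreal" where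
  "kl_op _ h = (\<lambda>s. \<Sum>\<^sub>\<infinity>t. h (None, t) * h (Some t, s))"

lemma ennreal_summable [simp]: "(f :: 'a \<Rightarrow> ennreal) summable_on A"
  by (rule nonneg_summable_on_complete) simp

lemma ennreal_infsum: "infsum (f :: 'a \<Rightarrow> ennreal) A = (SUP F\<in>{F. finite F \<and> F \<subseteq> A}. sum f F)"
  by (rule nonneg_infsum_complete) simp

lemma ennreal_infsum_mono: "(\<And>t. t \<in> A \<Longrightarrow> f t \<le> (g t :: ennreal)) \<Longrightarrow> infsum f A \<le> infsum g A"
  by (rule infsum_mono) auto

lemma ennreal_infsum_cmult: "infsum (\<lambda>t. c * f t) A = c * infsum (f :: 'a \<Rightarrow> ennreal) A"
  by (simp add: ennreal_infsum SUP_mult_left_ennreal sum_distrib_left)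

lemma jcont_add_op: "jcont (add_op :: real \<Rightarrow> (bool \<times> 's \<Rightarrow> ennreal) \<Rightarrow> 's \<Rightarrow> ennreal)"
  unfolding jcont_def add_op_def
  by (intro conjI allI monoI lsc_add lsc_snd_coordinate) (auto simp: le_fun_def intro!: add_mono)

lemma jcont_scale_op: "jcont (scale_op r :: real \<Rightarrow> (unit \<times> 's \<Rightarrow> ennreal) \<Rightarrow> 's \<Rightarrow> ennreal)"
  unfolding jcont_def scale_op_def
  by (intro conjI allI monoI lsc_mult lsc_const lsc_snd_coordinate) (auto simp: le_fun_def intro!: mult_left_mono)

text \<open>An infinite sum in [0,oo] is the supremum of its finite partial sums, and suprema of
  lower semicontinuous functions are lower semicontinuous.\<close>

lemma jcont_kl_op: "jcont (kl_op :: real \<Rightarrow> ('s option \<times> 's \<Rightarrow> ennreal) \<Rightarrow> 's \<Rightarrow> ennreal)"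
  unfolding jcont_def
proof (intro conjI allI)
  show "mono (kl_op p :: ('s option \<times> 's \<Rightarrow> ennreal) \<Rightarrow> 's \<Rightarrow> ennreal)" for p
    unfolding kl_op_def by (intro monoI le_funI ennreal_infsum_mono mult_mono) (auto simp: le_fun_def)
  show "lsc (\<lambda>z. kl_op (fst z) (snd z :: 's option \<times> 's \<Rightarrow> ennreal) k)" for k
    unfolding kl_op_def ennreal_infsum by (intro lsc_SUP lsc_sum lsc_mult lsc_snd_coordinate)
qed

lemma addS_Op: "addS A B = Op {0} add_op (\<lambda>j. if j then A else B)"
proof (intro set_eqI iffI)
  fix z assume "z \<in> addS A B"
  then obtain a b where z: "z = (\<lambda>s. a s + b s)" "a \<in> A" "b \<in> B" by (auto simp: addS_def)
  have "add_op 0 (\<lambda>(j, s). (if j then a else b) s) \<in> Op {0} add_op (\<lambda>j. if j then A else B)"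
    using z by (intro OpI) auto
  then show "z \<in> Op {0} add_op (\<lambda>j. if j then A else B)" using z by (simp add: add_op_def)
next
  fix z assume "z \<in> Op {0} add_op (\<lambda>j. if j then A else B)"
  then obtain h where "z = add_op 0 h" "\<And>j. slice h j \<in> (if j then A else B)" by (auto simp: Op_def)
  from this(1) this(2)[of True] this(2)[of False] show "z \<in> addS A B"
    by (auto simp: addS_def add_op_def slice_def)
qed

lemma scaleS_Op: "scaleS r A = Op {0} (scale_op r) (\<lambda>_. A)"
proof (intro set_eqI iffI)
  fix z assume "z \<in> scaleS r A"
  then obtain a where z: "z = (\<lambda>s. ennreal r * a s)" "a \<in> A" by (auto simp: scaleS_def)
  have "scale_op r 0 (\<lambda>(j, s). (\<lambda>_. a) j s) \<in> Op {0} (scale_op r) (\<lambda>_. A)"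
    using z by (intro OpI) (auto simp: slice_def)
  then show "z \<in> Op {0} (scale_op r) (\<lambda>_. A)" using z by (simp add: scale_op_def)
next
  fix z assume "z \<in> Op {0} (scale_op r) (\<lambda>_. A)"
  then show "z \<in> scaleS r A" by (auto simp: Op_def scaleS_def scale_op_def slice_def)
qed

lemma joinS_Op: "joinS A B = Op {0..1} mix_op (\<lambda>j. if j then A else B)"
  by (simp add: joinS_def Op_mix_op)

lemma klS_Op: "klS f A = Op {0} kl_op (case_option A f)"
proof (intro set_eqI iffI)
  fix z assume "z \<in> klS f A"
  then obtain v g where z: "z = (\<lambda>s. \<Sum>\<^sub>\<infinity>t. v t * g t s)" "v \<in> A" "\<And>t. g t \<in> f t" by (auto simp: klS_def)
  have "kl_op 0 (\<lambda>(j, s). case_option v g j s) \<in> Op {0} kl_op (case_option A f)"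
    using z by (intro OpI) (auto split: option.split)
  then show "z \<in> Op {0} kl_op (case_option A f)" using z by (simp add: kl_op_def)
next
  fix z assume "z \<in> Op {0} kl_op (case_option A f)"
  then obtain h where h: "z = kl_op 0 h" "\<And>j. slice h j \<in> case_option A f j" by (auto simp: Op_def)
  have "slice h None \<in> A" using h(2)[of None] by simp
  moreover have "slice h (Some t) \<in> f t" for t using h(2)[of "Some t"] by simp
  ultimately show "z \<in> klS f A" unfolding klS_def
    by (intro CollectI exI[of _ "slice h None"] exI[of _ "\<lambda>t. slice h (Some t)"])
      (auto simp: h(1) kl_op_def slice_def)
qed

lemma cvx_generator_addS: "cvx_generator A \<Longrightarrow> cvx_generator B \<Longrightarrow> cvx_generator (addS A B)"
  unfolding cvx_generator_def
proof (elim conjE, intro conjI)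
  assume *: "A \<noteq> {}" "B \<noteq> {}" "cvx A" "cvx B" "closed (upE A)" "closed (upE B)"
  show "addS A B \<noteq> {}" using * by (auto simp: addS_def)
  show "closed (upE (addS A B))" unfolding addS_Op
    using * by (intro closed_upE_Op jcont_add_op) auto
  show "cvx (addS A B)" unfolding cvx_def
  proof (intro ballI allI impI)
    fix x y p assume "x \<in> addS A B" "y \<in> addS A B" and p: "0 \<le> p \<and> p \<le> (1::real)"
    then obtain a b a' b' where **: "x = (\<lambda>s. a s + b s)" "y = (\<lambda>s. a' s + b' s)" "a \<in> A" "a' \<in> A" "b \<in> B" "b' \<in> B"
      by (auto simp: addS_def)
    have "mixv p x y = (\<lambda>s. mixv p a a' s + mixv p b b' s)"
      using p by (simp add: mixv_def ** mix_mixv)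
    then show "mixv p x y \<in> addS A B"
      using p ** cvxD[OF *(3)] cvxD[OF *(4)] unfolding addS_def by blast
  qed
qed

lemma cvx_generator_scaleS: "cvx_generator A \<Longrightarrow> cvx_generator (scaleS r A)"
  unfolding cvx_generator_def
proof (elim conjE, intro conjI)
  assume *: "A \<noteq> {}" "cvx A" "closed (upE A)"
  show "scaleS r A \<noteq> {}" using * by (auto simp: scaleS_def)
  show "closed (upE (scaleS r A))" unfolding scaleS_Op
    using * by (intro closed_upE_Op jcont_scale_op) auto
  show "cvx (scaleS r A)" unfolding cvx_def
  proof (intro ballI allI impI)
    fix x y p assume "x \<in> scaleS r A" "y \<in> scaleS r A" and p: "0 \<le> p \<and> p \<le> (1::real)"
    then obtain a a' where **: "x = (\<lambda>s. ennreal r * a s)" "y = (\<lambda>s. ennreal r * a' s)" "a \<in> A" "a' \<in> A"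
      by (auto simp: scaleS_def)
    have "mixv p x y = (\<lambda>s. ennreal r * mixv p a a' s)"
      by (simp add: mixv_def ** distrib_left mult.left_commute)
    then show "mixv p x y \<in> scaleS r A"
      using p ** cvxD[OF *(2)] unfolding scaleS_def by blast
  qed
qed

lemma cvx_generator_joinS: "cvx_generator A \<Longrightarrow> cvx_generator B \<Longrightarrow> cvx_generator (joinS A B)"
  unfolding cvx_generator_def
proof (elim conjE, intro conjI)
  assume *: "A \<noteq> {}" "B \<noteq> {}" "cvx A" "cvx B" "closed (upE A)" "closed (upE B)"
  show "joinS A B \<noteq> {}" unfolding joinS_Op Op_empty_iff using * by auto
  show "cvx (joinS A B)" unfolding joinS_def using * by (intro cvx_join)
  show "closed (upE (joinS A B))" unfolding joinS_Op
    using * by (intro closed_upE_Op jcont_mix_op) auto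
qed

text \<open>With infinite weights the weighted sum of two convex combinations need not be attained, only
  bounded from both sides; this is all the Scott closure and the saturation need.\<close>

lemma mix_bounds:
  fixes U V :: ennreal
  assumes A: "cvx A" "a \<in> A" "a' \<in> A"
  shows "(\<exists>l\<in>A. \<forall>i. (U + V) * l i \<le> U * a i + V * a' i) \<and> (\<exists>h\<in>A. \<forall>i. U * a i + V * a' i \<le> (U + V) * h i)"
proof -
  consider "U = top" | "V = top" | u v where "U = ennreal u" "V = ennreal v" "0 \<le> u" "0 \<le> v"
    by (cases U; cases V) auto
  then show ?thesis
  proof cases
    case 3
    then obtain b where "b \<in> A" "\<forall>i. ennreal u * a i + ennreal v * a' i = ennreal (u + v) * b i"
      using mixv_scaled[of u v "u + v" a A a a'] A by blast
    then show ?thesis using 3 by (intro conjI bexI[of _ b]) auto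
  next
    case 1
    \<comment> \<open>With an infinite weight, \<open>a\<close> alone is a lower bound. The equal
      mixture is an upper bound, because it vanishes only where both \<open>a\<close> and
      \<open>a'\<close> do and otherwise becomes infinite after scaling.\<close>
    have m: "mixv (1/2) a a' \<in> A" using A by (intro cvxD) auto
    have "U * a i + V * a' i \<le> top * mixv (1/2) a a' i" for i
    proof (cases "mixv (1/2) a a' i = 0")
      case True then show ?thesis by (simp add: mixv_def)
    qed (simp add: ennreal_top_mult)
    with m have "\<exists>h\<in>A. \<forall>i. U * a i + V * a' i \<le> (U + V) * h i" using 1 by auto
    moreover have "\<forall>i. (U + V) * a i \<le> U * a i + V * a' i" using 1 by simp
    ultimately show ?thesis using A by blast
  next
    case 2
    have m: "mixv (1/2) a a' \<in> A" using A by (intro cvxD) auto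
    have "U * a i + V * a' i \<le> top * mixv (1/2) a a' i" for i
    proof (cases "mixv (1/2) a a' i = 0")
      case True then show ?thesis by (simp add: mixv_def)
    qed (simp add: ennreal_top_mult)
    with m have "\<exists>h\<in>A. \<forall>i. U * a i + V * a' i \<le> (U + V) * h i" using 2 by auto
    moreover have "\<forall>i. (U + V) * a' i \<le> U * a i + V * a' i" using 2 by simp
    ultimately show ?thesis using A by blast
  qed
qed

text \<open>At each state \<open>t\<close> the weights \<open>p * v t\<close> and
  \<open>(1 - p) * v' t\<close> add up to the mixture of the valuations, so
  \<open>mix_bounds\<close> can be applied state by state to the two selected values.\<close>

lemma klS_mix_bounds:
  assumes A: "cvx A" and f: "\<And>t. cvx (f t)" and xy: "x \<in> klS f A" "y \<in> klS f A"
    and p: "0 \<le> p" "p \<le> 1"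
  shows "(\<exists>l\<in>klS f A. l \<le> mixv p x y) \<and> (\<exists>h\<in>klS f A. mixv p x y \<le> h)"
proof -
  from xy obtain v g v' g' where *: "x = (\<lambda>s. \<Sum>\<^sub>\<infinity>t. v t * g t s)" "v \<in> A" "\<And>t. g t \<in> f t"
    "y = (\<lambda>s. \<Sum>\<^sub>\<infinity>t. v' t * g' t s)" "v' \<in> A" "\<And>t. g' t \<in> f t" by (auto simp: klS_def)
  have m: "mixv p x y = (\<lambda>s. \<Sum>\<^sub>\<infinity>t. (ennreal p * v t) * g t s + (ennreal (1 - p) * v' t) * g' t s)"
    by (simp add: mixv_def * infsum_add ennreal_infsum_cmult[symmetric] mult.assoc)
  have w: "mixv p v v' \<in> A" using A * p by (intro cvxD)
  have "\<exists>l\<in>f t. \<forall>i. mixv p v v' t * l i \<le> (ennreal p * v t) * g t i + (ennreal (1 - p) * v' t) * g' t i" for t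
    unfolding mixv_def using mix_bounds[OF f *(3,6)] by blast
  then obtain l where l: "\<And>t. l t \<in> f t"
    "\<And>t i. mixv p v v' t * l t i \<le> (ennreal p * v t) * g t i + (ennreal (1 - p) * v' t) * g' t i" by metis
  have "\<exists>l\<in>f t. \<forall>i. (ennreal p * v t) * g t i + (ennreal (1 - p) * v' t) * g' t i \<le> mixv p v v' t * l i" for t
    unfolding mixv_def using mix_bounds[OF f *(3,6)] by blast
  then obtain h where h: "\<And>t. h t \<in> f t"
    "\<And>t i. (ennreal p * v t) * g t i + (ennreal (1 - p) * v' t) * g' t i \<le> mixv p v v' t * h t i" by metis
  have "(\<lambda>s. \<Sum>\<^sub>\<infinity>t. mixv p v v' t * l t s) \<in> klS f A" "(\<lambda>s. \<Sum>\<^sub>\<infinity>t. mixv p v v' t * h t s) \<in> klS f A"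
    using w l(1) h(1) unfolding klS_def by blast+
  moreover have "(\<lambda>s. \<Sum>\<^sub>\<infinity>t. mixv p v v' t * l t s) \<le> mixv p x y" unfolding m
    by (intro le_funI ennreal_infsum_mono l)
  moreover have "mixv p x y \<le> (\<lambda>s. \<Sum>\<^sub>\<infinity>t. mixv p v v' t * h t s)" unfolding m
    by (intro le_funI ennreal_infsum_mono h)
  ultimately show ?thesis by blast
qed

lemma cvx_scl_klS: "cvx A \<Longrightarrow> (\<And>t. cvx (f t)) \<Longrightarrow> cvx (scl (klS f A))"
proof (rule cvx_scl)
  fix a b p assume *: "cvx A" "\<And>t. cvx (f t)" "a \<in> klS f A" "b \<in> klS f A" "0 \<le> p" "p \<le> (1::real)"
  obtain h where "h \<in> klS f A" "mixv p a b \<le> h" using klS_mix_bounds[OF *] by blast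
  then show "mixv p a b \<in> scl (klS f A)" using subset_scl[of "klS f A"] by (metis scl_down subsetD)
qed

lemma cvx_upE_klS: "cvx A \<Longrightarrow> (\<And>t. cvx (f t)) \<Longrightarrow> cvx (upE (klS f A))"
proof (rule cvx_upE)
  fix a b p assume *: "cvx A" "\<And>t. cvx (f t)" "a \<in> klS f A" "b \<in> klS f A" "0 \<le> p" "p \<le> (1::real)"
  show "mixv p a b \<in> upE (klS f A)" using klS_mix_bounds[OF *] by (auto simp: upE_def)
qed

lemma klS_eq_empty: "klS f A = {} \<longleftrightarrow> A = {} \<or> (\<exists>t. f t = {})"
  unfolding klS_Op Op_empty_iff by (auto simp: split_option_ex)

lemma generator_klS: "cvx_generator A \<Longrightarrow> (\<And>t. cvx_generator (f t)) \<Longrightarrow> generator x (klS f A)"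
proof -
  assume *: "cvx_generator A" "\<And>t. cvx_generator (f t)"
  then have "closed (upE (klS f A))" unfolding klS_Op
    by (intro closed_upE_Op jcont_kl_op) (auto simp: cvx_generator_def split: option.split)
  then show ?thesis using * by (auto simp: generator_def cvx_generator_def klS_eq_empty cvx_scl_klS cvx_upE_klS)
qed

subsection \<open>Valuations on a discrete space as functions\<close>

text \<open>A continuous valuation on a discrete space is determined by its point masses, which turns the
  valuation cone into the full function space.\<close>

definition val :: "('s \<Rightarrow> ennreal) \<Rightarrow> 's val" where "val w = (\<lambda>U. infsum w U)"
definition unval :: "'s val \<Rightarrow> 's \<Rightarrow> ennreal" where "unval v = (\<lambda>s. v {s})"
definition em :: "('s \<Rightarrow> ennreal) set \<Rightarrow> 's val set" where "em A = val ` A"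

lemma unval_val [simp]: "unval (val w) = w"
  by (simp add: unval_def val_def)

lemma val_inj [simp]: "val a = val b \<longleftrightarrow> a = b"
  by (metis unval_val)

lemma infsum_split: "infsum (w :: 's \<Rightarrow> ennreal) (U \<union> V) = infsum w U + infsum w (V - U)"
  using infsum_Un_disjoint[of w U "V - U"] by simp

lemma infsum_subset_mono: "U \<subseteq> V \<Longrightarrow> infsum (w :: 's \<Rightarrow> ennreal) U \<le> infsum w V"
  using infsum_split[of w U V] by (simp add: Un_absorb1)

lemma directed_finite_subset:
  assumes "finite F" "F \<subseteq> \<Union>\<D>" "\<D> \<noteq> {}" "\<forall>A\<in>\<D>. \<forall>B\<in>\<D>. \<exists>C\<in>\<D>. A \<union> B \<subseteq> C"
  shows "\<exists>D\<in>\<D>. F \<subseteq> D"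
  using assms(1,2)
proof (induction F)
  case empty then show ?case using assms(3) by auto
next
  case (insert a F)
  then obtain A B where AB: "A \<in> \<D>" "F \<subseteq> A" "B \<in> \<D>" "a \<in> B" by auto
  then obtain C where "C \<in> \<D>" "A \<union> B \<subseteq> C" using assms(4) by blast
  then show ?case using AB by (intro bexI[of _ C]) auto
qed

text \<open>Continuity holds because a finite subset of a directed union is contained in one of its
  members.\<close>

lemma val_cval: "val w \<in> cval"
  unfolding cval_def
proof (intro CollectI conjI allI impI)
  show "val w {} = 0" by (simp add: val_def)
  show "val w U \<le> val w V" if "U \<subseteq> V" for U V
    using that by (simp add: val_def infsum_subset_mono)
  show "val w U + val w V = val w (U \<union> V) + val w (U \<inter> V)" for U V
  proof -
    have "infsum w V = infsum w (U \<inter> V) + infsum w (V - U)"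
      using infsum_split[of w "U \<inter> V" V] by (simp add: Un_absorb1 Diff_Int)
    then show ?thesis by (simp add: val_def infsum_split[of w U V] ac_simps)
  qed
  fix \<D> :: "'a set set"
  assume D: "\<D> \<noteq> {} \<and> (\<forall>A\<in>\<D>. \<forall>B\<in>\<D>. \<exists>C\<in>\<D>. A \<union> B \<subseteq> C)"
  show "val w (\<Union>\<D>) = (SUP U\<in>\<D>. val w U)"
  proof (rule antisym)
    show "val w (\<Union>\<D>) \<le> (SUP U\<in>\<D>. val w U)" unfolding val_def ennreal_infsum[of w "\<Union>\<D>"]
    proof (rule SUP_least)
      fix F assume F: "F \<in> {F. finite F \<and> F \<subseteq> \<Union>\<D>}"
      then obtain U where U: "U \<in> \<D>" "F \<subseteq> U" using directed_finite_subset[of F \<D>] D by auto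
      have "sum w F \<le> infsum w U" using infsum_subset_mono[OF U(2), of w] F by simp
      also have "\<dots> \<le> (SUP U\<in>\<D>. infsum w U)" using U by (intro SUP_upper)
      finally show "sum w F \<le> (SUP U\<in>\<D>. infsum w U)" .
    qed
    show "(SUP U\<in>\<D>. val w U) \<le> val w (\<Union>\<D>)" unfolding val_def
      by (intro SUP_least infsum_subset_mono) auto
  qed
qed

text \<open>Modularity makes the valuation additive on finite sets, and every set is the directed
  union of its finite subsets, so continuity extends the formula.\<close>

lemma val_unval:
  assumes v: "v \<in> cval" shows "val (unval v) = v"
proof
  fix U
  have fin: "v F = sum (unval v) F" if "finite F" for F
    using that
  proof (induction F)
    case empty then show ?case using v by (simp add: cval_def)
  next
    case (insert a F)
    have "v {a} + v F = v ({a} \<union> F) + v ({a} \<inter> F)" using v unfolding cval_def by blast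
    then show ?case using insert v by (simp add: unval_def cval_def)
  qed
  have "v (\<Union>{F. finite F \<and> F \<subseteq> U}) = (SUP F\<in>{F. finite F \<and> F \<subseteq> U}. v F)"
  proof -
    have ne: "{F. finite F \<and> F \<subseteq> U} \<noteq> {} \<and> (\<forall>A\<in>{F. finite F \<and> F \<subseteq> U}. \<forall>B\<in>{F. finite F \<and> F \<subseteq> U}.
        \<exists>C\<in>{F. finite F \<and> F \<subseteq> U}. A \<union> B \<subseteq> C)"
    proof (intro conjI ballI)
      show "{F. finite F \<and> F \<subseteq> U} \<noteq> {}" by blast
      fix A B assume "A \<in> {F. finite F \<and> F \<subseteq> U}" "B \<in> {F. finite F \<and> F \<subseteq> U}"
      then show "\<exists>C\<in>{F. finite F \<and> F \<subseteq> U}. A \<union> B \<subseteq> C" by (intro bexI[of _ "A \<union> B"]) auto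
    qed
    have "\<forall>\<D>. \<D> \<noteq> {} \<and> (\<forall>A\<in>\<D>. \<forall>B\<in>\<D>. \<exists>C\<in>\<D>. A \<union> B \<subseteq> C) \<longrightarrow> v (\<Union>\<D>) = (SUP U\<in>\<D>. v U)"
      using v unfolding cval_def by simp
    from mp[OF spec[OF this] ne] show ?thesis .
  qed
  moreover have "\<Union>{F. finite F \<and> F \<subseteq> U} = U"
  proof
    show "U \<subseteq> \<Union>{F. finite F \<and> F \<subseteq> U}"
    proof
      fix x assume "x \<in> U"
      then show "x \<in> \<Union>{F. finite F \<and> F \<subseteq> U}" by (intro UnionI[of "{x}"]) auto
    qed
  qed auto
  ultimately show "val (unval v) U = v U" by (simp add: val_def ennreal_infsum fin)
qed

lemma val_le [simp]: "val a \<le> val b \<longleftrightarrow> a \<le> b"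
proof
  assume "val a \<le> val b"
  then have "unval (val a) \<le> unval (val b)" by (auto simp: le_fun_def unval_def)
  then show "a \<le> b" by simp
qed (auto simp: val_def le_fun_def intro: ennreal_infsum_mono)

lemma cval_eq_em: "(cval :: 'a val set) = em UNIV"
proof
  show "(cval :: 'a val set) \<subseteq> em UNIV"
  proof
    fix v :: "'a val" assume "v \<in> cval"
    then have "v = val (unval v)" by (simp add: val_unval)
    then show "v \<in> em UNIV" unfolding em_def by blast
  qed
  show "em UNIV \<subseteq> (cval :: 'a val set)" using val_cval by (auto simp: em_def)
qed

lemma cvalE: "v \<in> cval \<Longrightarrow> (\<And>w. v = val w \<Longrightarrow> P) \<Longrightarrow> P"
  using val_unval by metis

lemma em_iff [simp]: "val a \<in> em A \<longleftrightarrow> a \<in> A" by (auto simp: em_def)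
lemma em_cval: "em A \<subseteq> cval" using val_cval by (auto simp: em_def)
lemma em_unval: "B \<subseteq> cval \<Longrightarrow> em (unval ` B) = B"
  using val_unval by (force simp: em_def image_image)
lemma em_subset [simp]: "em A \<subseteq> em B \<longleftrightarrow> A \<subseteq> B" by (auto simp: em_def)
lemma em_inj [simp]: "em A = em B \<longleftrightarrow> A = B" by (metis em_subset subset_antisym order_refl)
lemma em_empty [simp]: "em A = {} \<longleftrightarrow> A = {}" by (simp add: em_def)
lemma em_Int: "em (A \<inter> B) = em A \<inter> em B" by (auto simp: em_def)
lemma em_Union: "em (\<Union>\<A>) = (\<Union>A\<in>\<A>. em A)" by (auto simp: em_def)
lemma em_Compl: "cval - em A = em (- A)" by (auto simp: em_def elim!: cvalE intro: val_cval)
lemma bex_em [simp]: "(\<exists>v\<in>em A. P v) \<longleftrightarrow> (\<exists>a\<in>A. P (val a))" by (auto simp: em_def)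
lemma ball_em [simp]: "(\<forall>v\<in>em A. P v) \<longleftrightarrow> (\<forall>a\<in>A. P (val a))" by (auto simp: em_def)
lemma ball_cval: "(\<forall>v\<in>cval. P v) \<longleftrightarrow> (\<forall>a. P (val a))" by (simp add: cval_eq_em)

lemma upc_em [simp]: "upc (em A) = em (upE A)"
proof (intro set_eqI iffI)
  fix v assume "v \<in> upc (em A)"
  then obtain w a where "v = val w" "a \<in> A" "val a \<le> val w" by (auto simp: upc_def elim!: cvalE)
  then show "v \<in> em (upE A)" by (auto simp: upE_def)
next
  fix v assume "v \<in> em (upE A)"
  then obtain w where "v = val w" "w \<in> upE A" by (auto simp: em_def)
  then show "v \<in> upc (em A)" by (auto simp: upE_def upc_def val_cval)
qed
lemma dnc_em [simp]: "dnc (em A) = em (dnE A)"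
proof (intro set_eqI iffI)
  fix v assume "v \<in> dnc (em A)"
  then obtain w a where "v = val w" "a \<in> A" "val w \<le> val a" by (auto simp: dnc_def elim!: cvalE)
  then show "v \<in> em (dnE A)" by (auto simp: dnE_def)
next
  fix v assume "v \<in> em (dnE A)"
  then obtain w where "v = val w" "w \<in> dnE A" by (auto simp: em_def)
  then show "v \<in> dnc (em A)" by (auto simp: dnE_def dnc_def val_cval)
qed

lemma val_add: "val (\<lambda>s. a s + b s) = vadd (val a) (val b)"
  by (simp add: val_def vadd_def infsum_add)
lemma val_scale: "val (\<lambda>s. ennreal r * a s) = vscale r (val a)"
  by (simp add: val_def vscale_def ennreal_infsum_cmult)
lemma val_mixv: "val (mixv p a b) = vadd (vscale p (val a)) (vscale (1 - p) (val b))"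
  by (simp add: mixv_def val_add val_scale)

lemma vconvex_em [simp]: "vconvex (em A) \<longleftrightarrow> cvx A"
  unfolding vconvex_def cvx_def by (simp add: val_mixv[symmetric])

lemma order_convex_em: "order_convex (em A) \<longleftrightarrow> (\<forall>a\<in>A. \<forall>c\<in>A. \<forall>b. a \<le> b \<and> b \<le> c \<longrightarrow> b \<in> A)"
  by (simp add: order_convex_def ball_cval)

lemma val_finite_support:
  assumes "finite S" "\<And>s. s \<notin> S \<Longrightarrow> w s = 0"
  shows "val w = (\<lambda>U. \<Sum>s\<in>S. if s \<in> U then w s else 0)"
proof
  fix U
  have "infsum w U = infsum w (U \<inter> S)" by (rule infsum_cong_neutral) (use assms in auto)
  also have "\<dots> = sum w (U \<inter> S)" using assms(1) by simp
  also have "\<dots> = (\<Sum>s\<in>S. if s \<in> U then w s else 0)"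
    using assms(1) by (simp add: sum.inter_restrict[symmetric] Int_commute)
  finally show "val w U = (\<Sum>s\<in>S. if s \<in> U then w s else 0)" by (simp add: val_def)
qed

lemma simple_val_iff: "simple_val v \<longleftrightarrow> (\<exists>w. simple_fn w \<and> v = val w)"
proof
  assume "simple_val v"
  then obtain S r where *: "finite S" "\<forall>s. 0 \<le> r s"
    "v = (\<lambda>U. \<Sum>s\<in>S. if s \<in> U then ennreal (r s) else 0)" by (auto simp: simple_val_def)
  define w where "w s = (if s \<in> S then ennreal (r s) else 0)" for s
  have "val w = (\<lambda>U. \<Sum>s\<in>S. if s \<in> U then w s else 0)"
    using * by (intro val_finite_support) (auto simp: w_def)
  also have "\<dots> = v" unfolding *(3) by (intro ext sum.cong) (auto simp: w_def)
  finally have "val w = v" .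
  moreover have "{i. w i \<noteq> 0} \<subseteq> S" by (auto simp: w_def)
  then have "simple_fn w" using * finite_subset by (auto simp: simple_fn_def w_def)
  ultimately show "\<exists>w. simple_fn w \<and> v = val w" by blast
next
  assume "\<exists>w. simple_fn w \<and> v = val w"
  then obtain w where w: "simple_fn w" "v = val w" by blast
  have "v = (\<lambda>U. \<Sum>s\<in>{s. w s \<noteq> 0}. if s \<in> U then ennreal (enn2real (w s)) else 0)"
    unfolding w(2) using w(1) by (subst val_finite_support[of "{s. w s \<noteq> 0}"])
      (auto simp: simple_fn_def less_top intro!: ext sum.cong)
  then show "simple_val v" unfolding simple_val_def using w(1)
    by (intro exI[of _ "{s. w s \<noteq> 0}"] exI[of _ "\<lambda>s. enn2real (w s)"]) (auto simp: simple_fn_def)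
qed

lemma basicF_iff: "basicF F \<longleftrightarrow> (\<exists>G. F = em G \<and> finite G \<and> G \<noteq> {} \<and> (\<forall>g\<in>G. simple_fn g))"
proof
  assume F: "basicF F"
  have "F \<subseteq> cval" using F val_cval by (fastforce simp: basicF_def simple_val_iff)
  then have "F = em (unval ` F)" using em_unval by blast
  moreover have "\<forall>g\<in>unval ` F. simple_fn g" using F by (auto simp: basicF_def simple_val_iff)
  ultimately show "\<exists>G. F = em G \<and> finite G \<and> G \<noteq> {} \<and> (\<forall>g\<in>G. simple_fn g)" using F
    by (intro exI[of _ "unval ` F"]) (auto simp: basicF_def)
next
  assume "\<exists>G. F = em G \<and> finite G \<and> G \<noteq> {} \<and> (\<forall>g\<in>G. simple_fn g)"
  then show "basicF F" by (auto simp: basicF_def em_def simple_val_iff)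
qed

text \<open>The last summand is split off and the others are renormalised by \<open>1 - p n\<close>;
  a last weight equal to 1 is treated apart, as nothing remains to renormalise.\<close>

lemma convex_combination_mem:
  assumes A: "vconvex A"
  shows "(n::nat) > 0 \<Longrightarrow> (\<forall>i<n. 0 \<le> p i \<and> v i \<in> A) \<Longrightarrow> (\<Sum>i<n. p i) = 1 \<Longrightarrow>
    (\<lambda>U. \<Sum>i<n. ennreal (p i) * v i U) \<in> A"
proof (induction n arbitrary: p)
  case (Suc n)
  show ?case
  proof (cases "p n = 1 \<or> n = 0")
    case True
    then have p1: "p n = 1" using Suc.prems(3) by auto
    then have "(\<Sum>i<n. p i) = 0" using Suc.prems(3) by simp
    then have "\<forall>i<n. p i = 0" using Suc.prems(2) by (subst (asm) sum_nonneg_eq_0_iff) auto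
    then have "(\<lambda>U. \<Sum>i<Suc n. ennreal (p i) * v i U) = v n" using p1 by (auto intro!: ext)
    then show ?thesis using Suc.prems by simp
  next
    case False
    have s: "(\<Sum>i<n. p i) = 1 - p n" using Suc.prems(3) by simp
    moreover have "0 \<le> (\<Sum>i<n. p i)" using Suc.prems(2) by (intro sum_nonneg) auto
    ultimately have pn: "p n < 1" "0 \<le> p n" using False Suc.prems(2) by auto
    define q where "q i = p i / (1 - p n)" for i
    have "(\<Sum>i<n. q i) = 1" using s pn by (simp add: q_def sum_divide_distrib[symmetric])
    then have m: "(\<lambda>U. \<Sum>i<n. ennreal (q i) * v i U) \<in> A"
      using Suc.IH[of q] False Suc.prems(2) pn by (auto simp: q_def)
    have "(\<lambda>U. \<Sum>i<Suc n. ennreal (p i) * v i U) =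
      vadd (vscale (p n) (v n)) (vscale (1 - p n) (\<lambda>U. \<Sum>i<n. ennreal (q i) * v i U))"
    proof
      fix U
      have "ennreal (1 - p n) * (\<Sum>i<n. ennreal (q i) * v i U) = (\<Sum>i<n. ennreal (p i) * v i U)"
        unfolding sum_distrib_left using Suc.prems(2) pn
        by (intro sum.cong) (auto simp: q_def ennreal_mult_quot)
      then show "(\<Sum>i<Suc n. ennreal (p i) * v i U) =
        vadd (vscale (p n) (v n)) (vscale (1 - p n) (\<lambda>U. \<Sum>i<n. ennreal (q i) * v i U)) U"
        by (simp add: vadd_def vscale_def add.commute)
    qed
    then show ?thesis using A m Suc.prems(2) pn unfolding vconvex_def by auto
  qed
qed simp

lemma vconv_vconvex: "vconvex (vconv F)"
  unfolding vconvex_def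
proof (intro ballI allI impI)
  fix a b :: "'a val" and r :: real
  assume a: "a \<in> vconv F" and b: "b \<in> vconv F" and r: "0 \<le> r \<and> r \<le> 1"
  obtain n p v where a': "a = (\<lambda>U. \<Sum>i<n. ennreal (p i) * v i U)" "n > 0" "\<forall>i<n. 0 \<le> p i \<and> v i \<in> F"
    "(\<Sum>i<(n::nat). p i) = 1" using a unfolding vconv_def by blast
  obtain m q w where b': "b = (\<lambda>U. \<Sum>i<m. ennreal (q i) * w i U)" "m > 0" "\<forall>i<m. 0 \<le> q i \<and> w i \<in> F"
    "(\<Sum>i<(m::nat). q i) = 1" using b unfolding vconv_def by blast
  \<comment> \<open>The two families are concatenated and their weights scaled by \<open>r\<close>
    and \<open>1 - r\<close>.\<close>
  define P where "P i = (if i < n then r * p i else (1 - r) * q (i - n))" for i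
  define V where "V i = (if i < n then v i else w (i - n))" for i
  have split: "(\<Sum>i<n + m. f i) = (\<Sum>i<n. f i) + (\<Sum>i<m. f (n + i))" for f :: "nat \<Rightarrow> 'z::comm_monoid_add"
    by (induction m) (auto simp: add.assoc)
  have "vadd (vscale r a) (vscale (1 - r) b) = (\<lambda>U. \<Sum>i<n + m. ennreal (P i) * V i U)"
    using a'(3) b'(3) r unfolding split
    by (auto simp: vadd_def vscale_def a'(1) b'(1) P_def V_def sum_distrib_left ennreal_mult mult.assoc
        intro!: ext arg_cong2[where f = "(+)"] sum.cong)
  moreover have "(\<Sum>i<n + m. P i) = 1"
    unfolding split using a'(4) b'(4) by (simp add: P_def sum_distrib_left[symmetric])
  moreover have "\<forall>i<n + m. 0 \<le> P i \<and> V i \<in> F"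
    using a'(3) b'(3) r by (auto simp: P_def V_def)
  moreover have "n + m > 0" using a'(2) by simp
  ultimately show "vadd (vscale r a) (vscale (1 - r) b) \<in> vconv F" unfolding vconv_def by blast
qed

text \<open>Reconciles the n-ary combinations of the definition with the least set closed under
  binary mixtures.\<close>

lemma vconv_em: "vconv (em F) = em (hullE F)"
proof
  have "vconvex (em (hullE F))" by (simp add: cvx_hullE)
  note comb = convex_combination_mem[OF this]
  show "vconv (em F) \<subseteq> em (hullE F)"
  proof
    fix a assume "a \<in> vconv (em F)"
    then obtain n p v where a: "a = (\<lambda>U. \<Sum>i<n. ennreal (p i) * v i U)" "n > 0"
      "\<forall>i<n. 0 \<le> p i \<and> v i \<in> em F" "(\<Sum>i<(n::nat). p i) = 1" unfolding vconv_def by blast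
    have "em F \<subseteq> em (hullE F)" using hullE_inc[of F] by simp
    then have "\<forall>i<n. 0 \<le> p i \<and> v i \<in> em (hullE F)" using a(3) by blast
    then show "a \<in> em (hullE F)" unfolding a(1) using a(2,4) by (intro comb)
  qed
  then have c: "vconv (em F) \<subseteq> cval" using em_cval by blast
  have "F \<subseteq> unval ` vconv (em F)"
  proof
    fix f assume "f \<in> F"
    then have "(\<lambda>U. \<Sum>i<(1::nat). ennreal 1 * val f U) \<in> vconv (em F)"
      unfolding vconv_def by (intro CollectI exI[of _ 1] exI[of _ "\<lambda>_. 1"] exI[of _ "\<lambda>_. val f"]) simp
    then have "val f \<in> vconv (em F)" by simp
    then show "f \<in> unval ` vconv (em F)" by (metis image_eqI unval_val)
  qed
  moreover have "cvx (unval ` vconv (em F))"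
    using vconv_vconvex[of "em F"] em_unval[OF c] by (metis vconvex_em)
  ultimately have "hullE F \<subseteq> unval ` vconv (em F)" by (rule hullE_min)
  then show "em (hullE F) \<subseteq> vconv (em F)" using em_unval[OF c] em_subset by blast
qed

lemma em_of_empty [simp]: "em {} = {}" by (simp add: em_def)

subsection \<open>Scott and Lawson topologies of the valuation cone\<close>

text \<open>Justifies the name \<open>way_below\<close>. The pointwise supremum of \<open>D\<close>
  dominates the least upper bound, and directedness meets the finitely many strict conditions at one
  member.\<close>

lemma is_lub_em:
  assumes "directed_by (\<le>) (em D)" "is_lub_in cval (\<le>) (em D) (val w)" and b: "way_below b w"
  shows "\<exists>d\<in>D. b \<le> d"
proof -
  have dir: "D \<noteq> {}" "\<forall>a\<in>D. \<forall>b\<in>D. \<exists>c\<in>D. a \<le> c \<and> b \<le> c"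
    using assms(1) by (auto simp: directed_by_def)
  have lub: "\<And>d. d \<in> D \<Longrightarrow> d \<le> w" "\<And>z. \<forall>d\<in>D. d \<le> z \<Longrightarrow> w \<le> z"
    using assms(2) by (auto simp: is_lub_in_def ball_cval)
  have wi: "w i \<le> (SUP d\<in>D. d i)" for i
  proof -
    have "\<forall>d\<in>D. d \<le> (\<lambda>i. SUP d\<in>D. d i)" by (auto simp: le_fun_def intro: SUP_upper)
    from le_funD[OF lub(2)[OF this], of i] show ?thesis by simp
  qed
  have "\<exists>d\<in>D. \<forall>i\<in>J. b i \<le> d i" if "finite J" "J \<subseteq> {i. b i \<noteq> 0}" for J
    using that
  proof (induction J)
    case empty then show ?case using dir by auto
  next
    case (insert i J)
    then obtain d where d: "d \<in> D" "\<forall>i\<in>J. b i \<le> d i" by auto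
    have "b i < (SUP d\<in>D. d i)" using b insert.prems wi[of i] by (auto simp: way_below_def intro: less_le_trans)
    then obtain d' where d': "d' \<in> D" "b i < d' i" by (auto simp: less_SUP_iff)
    obtain c where c: "c \<in> D" "d \<le> c" "d' \<le> c" using dir(2) d(1) d'(1) by blast
    have "b j \<le> c j" if "j \<in> insert i J" for j
      using that d(2) d'(2) c(2,3) by (auto simp: le_fun_def intro: order_trans less_imp_le)
    then show ?case using c(1) by blast
  qed
  from this[of "{i. b i \<noteq> 0}"] obtain d where d: "d \<in> D" "\<And>i. b i \<noteq> 0 \<Longrightarrow> b i \<le> d i"
    using b by (auto simp: way_below_def)
  have "b i \<le> d i" for i using d(2)[of i] by (cases "b i = 0") auto
  then have "b \<le> d" by (simp add: le_fun_def)
  then show ?thesis using d(1) by blast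
qed

lemma scott_open_em: "open W \<Longrightarrow> upE W = W \<Longrightarrow> scott_open cval (\<le>) (em W)"
  unfolding scott_open_def
proof (intro conjI ballI allI impI)
  assume W: "open W" "upE W = W"
  show "em W \<subseteq> cval" by (rule em_cval)
  show "b \<in> em W" if "a \<in> em W" "b \<in> cval" "a \<le> b" for a b
    using that W(2) by (auto simp: em_def upE_def elim!: cvalE) blast
  fix D y assume D: "D \<subseteq> cval" "directed_by (\<le>) D" "is_lub_in cval (\<le>) D y" and y: "y \<in> em W"
  obtain w where w: "y = val w" "w \<in> W" using y by (auto simp: em_def)
  obtain b where b: "b \<in> W" "way_below b w" using way_below_dense[OF W(1) w(2)] by blast
  have "D = em (unval ` D)" using em_unval[OF D(1)] by simp
  then obtain d where "d \<in> unval ` D" "b \<le> d" using is_lub_em[of "unval ` D" w b] D b w by auto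
  then have "val d \<in> D" "d \<in> W" using W(2) b(1) \<open>D = em (unval ` D)\<close> em_iff[of d "unval ` D"]
    by (auto simp: upE_def)
  then show "D \<inter> em W \<noteq> {}" by auto
qed

text \<open>The elements way below \<open>a\<close> are directed with supremum \<open>a\<close>, so
  a Scott open set around \<open>a\<close> contains one of them, say \<open>b\<close>. The points
  with \<open>b\<close> way below them then form a product-open neighbourhood of \<open>a\<close>
  inside the set.\<close>

lemma scott_open_imp:
  assumes U: "scott_open cval (\<le>) U"
  shows "\<exists>W. open W \<and> upE W = W \<and> U = em W"
proof -
  have sub: "U \<subseteq> cval" using U by (simp add: scott_open_def)
  define W where "W = unval ` U"
  have UW: "U = em W" using em_unval[OF sub] by (simp add: W_def)
  have up: "\<And>a b. a \<in> W \<Longrightarrow> a \<le> b \<Longrightarrow> b \<in> W"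
  proof -
    fix a b assume "a \<in> W" "a \<le> b"
    then have "val a \<in> U" "val b \<in> cval" "val a \<le> val b" by (auto simp: UW val_cval)
    then have "val b \<in> U" using U unfolding scott_open_def by blast
    then show "b \<in> W" by (simp add: UW)
  qed
  have "open W"
  proof (subst open_subopen, intro ballI)
    fix a assume a: "a \<in> W"
    define D where "D = {b. way_below b a}"
    have "directed_by (\<le>) (em D)"
      unfolding directed_by_def
    proof (intro conjI)
      show "em D \<noteq> {}" using way_below_zero[of a] unfolding D_def em_empty by blast
      have "\<exists>c\<in>D. b \<le> c \<and> b' \<le> c" if "b \<in> D" "b' \<in> D" for b b'
        using that way_below_sup[of b a b'] by (intro bexI[of _ "\<lambda>i. max (b i) (b' i)"]) (auto simp: D_def le_fun_def)
      then show "\<forall>a\<in>em D. \<forall>b\<in>em D. \<exists>c\<in>em D. a \<le> c \<and> b \<le> c" by simp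
    qed
    moreover have "is_lub_in cval (\<le>) (em D) (val a)"
    proof -
      have "a \<le> z" if z: "\<And>d. d \<in> D \<Longrightarrow> d \<le> z" for z
      proof -
        have "closed {c. c \<le> z}" by (intro closed_le_fun continuous_intros)
        then have "a \<in> {c. c \<le> z}" by (rule closed_way_below_limit) (use z in \<open>auto simp: D_def\<close>)
        then show ?thesis by simp
      qed
      then show ?thesis by (auto simp: is_lub_in_def val_cval ball_cval D_def way_below_imp_le)
    qed
    moreover have "val a \<in> U" using a by (simp add: UW)
    ultimately have "em D \<inter> U \<noteq> {}" using U em_cval[of D] unfolding scott_open_def by blast
    then obtain b where b: "way_below b a" "b \<in> W" by (auto simp: UW D_def em_def)
    have "{c. way_below b c} \<subseteq> W" using up[OF b(2)] way_below_imp_le by blast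
    then show "\<exists>T. open T \<and> a \<in> T \<and> T \<subseteq> W" using open_way_below[of b] b(1) by blast
  qed
  moreover have "upE W = W" using up by (auto simp: upE_def)
  ultimately show ?thesis using UW by blast
qed

lemma upE_Int_ident: "upE A = A \<Longrightarrow> upE B = B \<Longrightarrow> upE (A \<inter> B) = A \<inter> B"
  unfolding upE_def by blast

lemma openin_VS: "openin VS U \<longleftrightarrow> (\<exists>W. open W \<and> upE W = W \<and> U = em W)"
proof
  assume "openin VS U"
  then have "generate_topology_on {U. scott_open cval (\<le>) U} U"
    by (simp add: VS_def scott_top_def openin_topology_generated_by_iff)
  then show "\<exists>W. open W \<and> upE W = W \<and> U = em W"
  proof induction
    case Empty then show ?case by (intro exI[of _ "{}"]) auto
  next
    case (Int a b)
    then obtain A B where "open A" "upE A = A" "a = em A" "open B" "upE B = B" "b = em B" by blast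
    then show ?case by (intro exI[of _ "A \<inter> B"]) (auto simp: em_Int upE_Int_ident)
  next
    case (UN K)
    then obtain h where h: "\<And>k. k \<in> K \<Longrightarrow> open (h k) \<and> upE (h k) = h k \<and> k = em (h k)" by metis
    have "\<Union>K = em (\<Union>(h ` K))" unfolding em_Union using h by auto
    moreover have "upE (\<Union>(h ` K)) = \<Union>(h ` K)" using h unfolding upE_def by blast
    ultimately show ?case using h by (intro exI[of _ "\<Union>(h ` K)"]) auto
  next
    case (Basis s)
    then show ?case by (intro scott_open_imp) auto
  qed
next
  assume "\<exists>W. open W \<and> upE W = W \<and> U = em W"
  then show "openin VS U" unfolding VS_def scott_top_def
    by (auto intro!: topology_generated_by_Basis scott_open_em)
qed

lemma topspace_VS: "topspace VS = (cval :: 's val set)"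
proof
  show "topspace VS \<subseteq> (cval :: 's val set)"
    using openin_VS[of "topspace VS :: 's val set"] em_cval by (auto simp: openin_topspace)
  have "openin VS (em UNIV :: 's val set)" unfolding openin_VS by (intro exI[of _ UNIV]) (auto simp: upE_def)
  then show "(cval :: 's val set) \<subseteq> topspace VS" unfolding cval_eq_em by (rule openin_subset)
qed

lemma upE_Compl: "upE (- A) = - A \<longleftrightarrow> dnE A = A"
  unfolding upE_def dnE_def by blast

lemma closedin_VS: "closedin VS B \<longleftrightarrow> (\<exists>A. closed A \<and> dnE A = A \<and> B = em A)"
proof
  assume B: "closedin VS B"
  then have sub: "B \<subseteq> cval" by (simp add: closedin_def topspace_VS)
  obtain W where W: "open W" "upE W = W" "cval - B = em W"
    using B by (auto simp: closedin_def topspace_VS openin_VS)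
  have "B = em (- W)" using W(3) sub em_Compl[of W] by blast
  moreover have "dnE (- W) = - W" using upE_Compl[of "- W"] W(2) by simp
  ultimately show "\<exists>A. closed A \<and> dnE A = A \<and> B = em A" using W(1) by (intro exI[of _ "- W"]) (auto simp: closed_def)
next
  assume "\<exists>A. closed A \<and> dnE A = A \<and> B = em A"
  then obtain A where A: "closed A" "dnE A = A" "B = em A" by blast
  then have "openin VS (em (- A))" unfolding openin_VS using upE_Compl[of A] by (intro exI[of _ "- A"]) auto
  then show "closedin VS B" using A(3) em_cval[of A] by (simp add: closedin_def topspace_VS em_Compl)
qed

lemma closure_of_VS: "VS closure_of (em X) = em (scl X)"
proof
  show "VS closure_of (em X) \<subseteq> em (scl X)"
  proof (rule closure_of_minimal)
    show "em X \<subseteq> em (scl X)" using subset_scl[of X] by simp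
    show "closedin VS (em (scl X))" unfolding closedin_VS by (intro exI[of _ "scl X"]) simp
  qed
  have "closedin VS (VS closure_of (em X))" by simp
  then obtain A where A: "closed A" "dnE A = A" "VS closure_of (em X) = em A" unfolding closedin_VS by blast
  have "em X \<subseteq> em A" using closure_of_subset[of "em X" VS] em_cval[of X] A(3) by (simp add: topspace_VS)
  then have "scl X \<subseteq> A" using A by (intro scl_least) auto
  then show "em (scl X) \<subseteq> VS closure_of (em X)" using A(3) by simp
qed

lemma openin_VL_imp:
  assumes "openin VL U"
  shows "\<exists>W. open W \<and> U = em W"
proof -
  have "generate_topology_on ({U. scott_open cval (\<le>) U} \<union> {cval - {y\<in>cval. a \<le> y} | a. a \<in> cval}) U"
    using assms by (simp add: VL_def lawson_top_def openin_topology_generated_by_iff)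
  then show ?thesis
  proof induction
    case Empty then show ?case by (intro exI[of _ "{}"]) auto
  next
    case (Int a b)
    then obtain A B where "open A" "a = em A" "open B" "b = em B" by blast
    then show ?case by (intro exI[of _ "A \<inter> B"]) (auto simp: em_Int)
  next
    case (UN K)
    then obtain h where h: "\<And>k. k \<in> K \<Longrightarrow> open (h k) \<and> k = em (h k)" by metis
    have "\<Union>K = em (\<Union>(h ` K))" unfolding em_Union using h by auto
    then show ?case using h by (intro exI[of _ "\<Union>(h ` K)"]) auto
  next
    case (Basis s)
    then consider "scott_open cval (\<le>) s" | a where "a \<in> cval" "s = cval - {y\<in>cval. a \<le> y}" by blast
    then show ?case
    proof cases
      case 1 then show ?thesis using scott_open_imp by blast
    next
      case 2
      then obtain w where w: "a = val w" by (auto elim: cvalE)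
      have "{y\<in>cval. a \<le> y} = em {y. w \<le> y}"
        unfolding w by (auto simp: val_cval elim!: cvalE) (auto simp: em_def val_cval)
      then have "s = em (- {y. w \<le> y})" using 2(2) em_Compl by metis
      moreover have "closed {y. w \<le> y}" by (intro closed_le_fun continuous_intros)
      ultimately show ?thesis by (auto simp: closed_def)
    qed
  qed
qed

lemma topspace_VL: "topspace VL = (cval :: 's val set)"
proof
  show "topspace VL \<subseteq> (cval :: 's val set)"
    using openin_VL_imp[of "topspace VL :: 's val set"] em_cval by (auto simp: openin_topspace)
  have "scott_open cval (\<le>) (em UNIV :: 's val set)" by (rule scott_open_em) (auto simp: upE_def)
  then have "openin VL (em UNIV :: 's val set)" unfolding VL_def lawson_top_def
    by (intro topology_generated_by_Basis) auto
  then show "(cval :: 's val set) \<subseteq> topspace VL" unfolding cval_eq_em by (rule openin_subset)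
qed

lemma openin_VL_coordinate:
  assumes "open X" shows "openin VL (em {w :: 's \<Rightarrow> ennreal. w i \<in> X})"
proof -
  have "generate_topology (range (\<lambda>a. {..<a}) \<union> range (\<lambda>a. {a<..})) X"
    using assms open_generated_order[where 'a = ennreal] by metis
  then show ?thesis
  proof induction
    case UNIV
    have "em {w :: 's \<Rightarrow> ennreal. w i \<in> UNIV} = topspace VL" by (simp add: topspace_VL cval_eq_em)
    then show ?case by simp
  next
    case (Int a b)
    have "em {w :: 's \<Rightarrow> ennreal. w i \<in> a \<inter> b} = em {w. w i \<in> a} \<inter> em {w. w i \<in> b}"
      unfolding em_Int[symmetric] by (rule arg_cong[where f = em]) auto
    then show ?case using Int by auto
  next
    case (UN K)
    have "em {w :: 's \<Rightarrow> ennreal. w i \<in> \<Union>K} = (\<Union>k\<in>K. em {w. w i \<in> k})"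
      by (auto simp: em_def)
    then show ?case using UN by auto
  next
    case (Basis s)
    then consider c where "s = {..<c}" | c where "s = {c<..}" by blast
    then show ?case
    proof cases
      case 1
      \<comment> \<open>The sublevel set is the complement of the principal upper set of the
        function with value \<open>c\<close> at \<open>i\<close> alone, hence subbasic in the Lawson
        topology.\<close>
      let ?z = "\<lambda>j. if j = i then c else 0 :: ennreal"
      have "- {y. ?z \<le> y} = {w. w i < c}" by (auto simp: le_fun_def not_le)
      moreover have "{y\<in>cval. val ?z \<le> y} = em {y. ?z \<le> y}"
        by (auto simp: val_cval elim!: cvalE) (auto simp: em_def val_cval)
      ultimately have "em {w. w i \<in> s} = cval - {y\<in>cval. val ?z \<le> y}"
        using 1 em_Compl[of "{y. ?z \<le> y}"] by simp
      then show ?thesis unfolding VL_def lawson_top_def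
        using val_cval[of ?z] by (auto intro!: topology_generated_by_Basis)
    next
      case 2
      have "open {w :: 's \<Rightarrow> ennreal. w i \<in> s}" using 2 lsc_coordinate[of i] by (simp add: lsc_def)
      moreover have "upE {w :: 's \<Rightarrow> ennreal. w i \<in> s} = {w. w i \<in> s}"
        using 2 by (auto simp: upE_def le_fun_def intro: less_le_trans)
      ultimately show ?thesis unfolding VL_def lawson_top_def
        by (intro topology_generated_by_Basis) (auto intro: scott_open_em)
    qed
  qed
qed

lemma continuous_map_unval: "continuous_map VL euclidean (unval :: 's val \<Rightarrow> _)"
proof -
  have "continuous_map VL euclidean (\<lambda>v :: 's val. unval v i)" for i
    unfolding continuous_map
  proof (intro conjI allI impI)
    fix X :: "ennreal set" assume "openin euclidean X"
    then have "openin VL (em {w :: 's \<Rightarrow> ennreal. w i \<in> X})" by (intro openin_VL_coordinate) simp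
    also have "em {w :: 's \<Rightarrow> ennreal. w i \<in> X} = {v \<in> topspace VL. unval v i \<in> X}"
      by (auto simp: topspace_VL val_cval em_def elim!: cvalE)
    finally show "openin VL {v \<in> topspace VL. unval v i \<in> X}" .
  qed auto
  then have "continuous_map VL (product_topology (\<lambda>_. euclidean) UNIV) (unval :: 's val \<Rightarrow> _)"
    by (simp add: continuous_map_componentwise_UNIV)
  then show ?thesis by (simp add: euclidean_product_topology)
qed

lemma openin_VL: "openin VL U \<longleftrightarrow> (\<exists>W. open W \<and> U = em W)"
proof
  assume "\<exists>W. open W \<and> U = em W"
  then obtain W where W: "open W" "U = em W" by blast
  have "openin VL {v \<in> topspace VL. unval v \<in> W}"
    using continuous_map_unval W(1) by (auto simp: continuous_map)
  also have "{v \<in> topspace VL. unval v \<in> W} = em W"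
    by (auto simp: topspace_VL val_cval em_def elim!: cvalE)
  finally show "openin VL U" using W(2) by simp
qed (rule openin_VL_imp)

lemma continuous_map_val_VL: "continuous_map euclidean VL (val :: ('s \<Rightarrow> ennreal) \<Rightarrow> _)"
  unfolding continuous_map
proof (intro conjI allI impI)
  show "(val :: ('s \<Rightarrow> ennreal) \<Rightarrow> _) ` topspace euclidean \<subseteq> topspace VL" by (auto simp: topspace_VL val_cval)
  fix U :: "'s val set" assume "openin VL U"
  then obtain W where "open W" "U = em W" using openin_VL by blast
  then show "openin euclidean {x :: 's \<Rightarrow> ennreal. x \<in> topspace euclidean \<and> val x \<in> U}" by simp
qed

lemma continuous_map_val_VS: "continuous_map euclidean VS (val :: ('s \<Rightarrow> ennreal) \<Rightarrow> _)"
  unfolding continuous_map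
proof (intro conjI allI impI)
  show "(val :: ('s \<Rightarrow> ennreal) \<Rightarrow> _) ` topspace euclidean \<subseteq> topspace VS" by (auto simp: topspace_VS val_cval)
  fix U :: "'s val set" assume "openin VS U"
  then obtain W where "open W" "U = em W" using openin_VS by blast
  then show "openin euclidean {x :: 's \<Rightarrow> ennreal. x \<in> topspace euclidean \<and> val x \<in> U}" by simp
qed

lemma compact_imp_closed_ennfun:
  assumes "compact (A :: ('i \<Rightarrow> ennreal) set)" shows "closed A"
proof -
  have "Hausdorff_space (euclidean :: ennreal topology)"
    using separation_t2[where 'a = ennreal] by (auto simp: Hausdorff_space_def disjnt_def)
  then have "Hausdorff_space (product_topology (\<lambda>i::'i. euclidean :: ennreal topology) UNIV)"
    by (simp add: Hausdorff_space_product_topology)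
  then have "Hausdorff_space (euclidean :: ('i \<Rightarrow> ennreal) topology)" by (simp add: euclidean_product_topology)
  then show ?thesis using compactin_imp_closedin[of euclidean A] assms by simp
qed

lemma compactin_VL: "compactin VL B \<longleftrightarrow> (\<exists>A. closed A \<and> B = em A)"
proof
  assume B: "compactin VL B"
  then have "B \<subseteq> cval" using compactin_subset_topspace topspace_VL by blast
  then have "B = em (unval ` B)" by (simp add: em_unval)
  moreover have "compactin euclidean (unval ` B)" using B continuous_map_unval by (rule image_compactin)
  ultimately show "\<exists>A. closed A \<and> B = em A" using compact_imp_closed_ennfun by (auto intro!: exI[of _ "unval ` B"])
next
  assume "\<exists>A. closed A \<and> B = em A"
  then obtain A where "compactin euclidean A" "B = val ` A" using closed_imp_compact_ennfun by (auto simp: em_def)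
  then show "compactin VL B" using image_compactin[OF _ continuous_map_val_VL] by blast
qed

text \<open>If \<open>y\<close> lies outside a saturated set, every member exceeds \<open>y\<close>
  strictly in some coordinate. A finite subcover by these Scott open conditions leaves a product
  neighbourhood of \<open>y\<close> outside the set, so Scott compactness gives closedness.\<close>

lemma compactin_VS_upper: "compactin VS B \<and> upc B = B \<longleftrightarrow> (\<exists>A. closed A \<and> upE A = A \<and> B = em A)"
proof
  assume "\<exists>A. closed A \<and> upE A = A \<and> B = em A"
  then obtain A where A: "compactin euclidean A" "upE A = A" "B = em A"
    using closed_imp_compact_ennfun by auto
  have "compactin VS B" unfolding A(3) em_def using A(1) continuous_map_val_VS by (rule image_compactin)
  then show "compactin VS B \<and> upc B = B" using A(2,3) by simp
next
  assume B: "compactin VS B \<and> upc B = B"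
  then have "B \<subseteq> cval" using compactin_subset_topspace topspace_VS by blast
  then obtain A where A: "B = em A" using em_unval by metis
  have up: "upE A = A" using B by (simp add: A)
  have "open (- A)"
  proof (subst open_subopen, intro ballI)
    fix y assume y: "y \<in> - A"
    define \<U> where "\<U> = (\<lambda>c. em {z. snd c < z (fst c)}) ` {c. y (fst c) < snd c}"
    have "openin VS U" if "U \<in> \<U>" for U
    proof -
      from that obtain c where "U = em {z. snd c < z (fst c)}" by (auto simp: \<U>_def)
      moreover have "upE {z. snd c < z (fst c)} = {z. snd c < z (fst c)}"
        by (auto simp: upE_def le_fun_def intro: less_le_trans)
      moreover have "open {z. snd c < z (fst c)}" using lsc_coordinate[of "fst c"] by (simp add: lsc_def)
      ultimately show ?thesis unfolding openin_VS by blast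
    qed
    moreover have "B \<subseteq> \<Union>\<U>"
    proof
      fix b assume "b \<in> B"
      then obtain a where a: "b = val a" "a \<in> A" by (auto simp: A em_def)
      have "\<not> a \<le> y" using a(2) y up by (auto simp: upE_def)
      then obtain i where "y i < a i" by (auto simp: le_fun_def not_le)
      then obtain d where "y i < d" "d < a i" using dense by blast
      then show "b \<in> \<Union>\<U>" unfolding \<U>_def a(1) by (intro UN_I[of "(i, d)"]) auto
    qed
    ultimately obtain \<F> where F: "finite \<F>" "\<F> \<subseteq> \<U>" "B \<subseteq> \<Union>\<F>"
      using B unfolding compactin_def by meson
    obtain C where C: "C \<subseteq> {c. y (fst c) < snd c}" "finite C" "\<F> = (\<lambda>c. em {z. snd c < z (fst c)}) ` C"
      using finite_subset_image[OF F(1) F(2)[unfolded \<U>_def]] by blast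
    let ?T = "\<Inter>c\<in>C. {z. z (fst c) < snd c}"
    have "open ?T" using C(2)
      by (auto intro!: open_INT open_Collect_less continuous_coordinate continuous_on_const)
    moreover have "y \<in> ?T" using C(1) by auto
    moreover have "?T \<subseteq> - A"
    proof
      fix z assume z: "z \<in> ?T"
      show "z \<in> - A"
      proof
        assume "z \<in> A"
        then have "val z \<in> B" by (simp add: A)
        then have "val z \<in> \<Union>\<F>" using F(3) by blast
        then obtain c where "c \<in> C" "snd c < z (fst c)" using C(3) by auto
        then show False using z by auto
      qed
    qed
    ultimately show "\<exists>T. open T \<and> y \<in> T \<and> T \<subseteq> - A" by blast
  qed
  then show "\<exists>A. closed A \<and> upE A = A \<and> B = em A" using A up by (auto simp: closed_def)
qed

subsection \<open>Transfer of the power constructions\<close>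

lemma PC_eq: "PC x = em ` PCE x"
proof (intro set_eqI iffI)
  fix B :: "'a val set"
  assume B: "B \<in> PC x"
  show "B \<in> em ` PCE x"
  proof (cases x)
    case PL
    then obtain A where "closed A" "dnE A = A" "B = em A" using B by (auto simp: closedin_VS)
    then show ?thesis using B PL by (intro image_eqI[of _ _ A]) (auto simp: PCE_def)
  next
    case PU
    then have "compactin VS B \<and> upc B = B" using B by simp
    then obtain A where "closed A" "upE A = A" "B = em A" unfolding compactin_VS_upper by blast
    then show ?thesis using B PU by (intro image_eqI[of _ _ A]) (auto simp: PCE_def)
  next
    case PB
    then obtain A where "closed A" "B = em A" using B by (auto simp: compactin_VL)
    moreover have "order_convex B" "vconvex B" "B \<noteq> {}" using B PB by simp_all
    ultimately have "A \<noteq> {} \<and> cvx A \<and> closed A \<and> (\<forall>a\<in>A. \<forall>c\<in>A. \<forall>b. a \<le> b \<and> b \<le> c \<longrightarrow> b \<in> A)"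
      by (simp only: order_convex_em vconvex_em em_empty simp_thms)
    then have "A \<in> PCE x" unfolding PCE_def PB mem_Collect_eq pk.case .
    then show ?thesis using \<open>B = em A\<close> by blast
  qed
next
  fix B :: "'a val set"
  assume "B \<in> em ` PCE x"
  then obtain A where A: "A \<in> PCE x" "B = em A" by blast
  show "B \<in> PC x"
  proof (cases x)
    case PL then show ?thesis using A by (auto simp: PCE_def closedin_VS)
  next
    case PU
    then have "compactin VS B \<and> upc B = B" unfolding compactin_VS_upper using A by (auto simp: PCE_def)
    then show ?thesis using PU A by (auto simp: PCE_def)
  next
    case PB
    have "A \<noteq> {} \<and> cvx A \<and> closed A \<and> (\<forall>a\<in>A. \<forall>c\<in>A. \<forall>b. a \<le> b \<and> b \<le> c \<longrightarrow> b \<in> A)"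
      using A(1) unfolding PCE_def PB mem_Collect_eq pk.case .
    then have "B \<noteq> {} \<and> vconvex B \<and> compactin VL B \<and> order_convex B"
      unfolding A(2) order_convex_em vconvex_em em_empty compactin_VL
      by (elim conjE) (intro conjI exI[of _ A], assumption+, rule refl, assumption)
    then show ?thesis unfolding PB PC.simps by blast
  qed
qed

lemma em_PC [simp]: "em A \<in> PC x \<longleftrightarrow> A \<in> PCE x"
  by (auto simp: PC_eq)

lemma basic_em: "basic x (em F) = em (elt x (hullE F))"
  by (cases x) (simp_all add: vconv_em closure_of_VS elt_def em_Int)

text \<open>\<open>pc_le\<close> compares lower closures where \<open>ple\<close> compares Scott
  closures; for members of the cone the two coincide.\<close>

lemma pc_le_em: "A \<in> PCE x \<Longrightarrow> B \<in> PCE x \<Longrightarrow> pc_le x (em A) (em B) \<longleftrightarrow> ple x A B"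
  using PCE_scl[of A x] PCE_scl[of B x] by (cases x) (simp_all add: ple_def)

lemma PC_E: "B \<in> PC x \<Longrightarrow> (\<And>A. A \<in> PCE x \<Longrightarrow> B = em A \<Longrightarrow> P) \<Longrightarrow> P"
  by (auto simp: PC_eq)

lemma subset_PC_E: assumes "D \<subseteq> PC x" obtains D' where "D' \<subseteq> PCE x" "D = em ` D'"
  using assms unfolding PC_eq by (meson subset_imageE)

lemma is_lub_PC: "D \<subseteq> PCE x \<Longrightarrow> y \<in> PCE x \<Longrightarrow>
    is_lub_in (PC x) (pc_le x) (em ` D) (em y) \<longleftrightarrow> is_lub_in (PCE x) (ple x) D y"
  unfolding is_lub_in_def PC_eq by (auto simp: pc_le_em subset_iff)

lemma is_lub_PC_E:
  assumes "is_lub_in (PC x) (pc_le x) (em ` D) y" "D \<subseteq> PCE x"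
  obtains y' where "y = em y'" "y' \<in> PCE x" "is_lub_in (PCE x) (ple x) D y'"
proof -
  have "y \<in> PC x" using assms(1) by (simp add: is_lub_in_def)
  then obtain y' where "y' \<in> PCE x" "y = em y'" by (rule PC_E)
  then show ?thesis using that assms is_lub_PC by blast
qed

lemma directed_PC: "D \<subseteq> PCE x \<Longrightarrow> directed_by (pc_le x) (em ` D) \<longleftrightarrow> directed_fam x D (\<lambda>A. A)"
proof -
  assume D: "D \<subseteq> PCE x"
  then have le: "pc_le x (em a) (em b) = ple x a b" if "a \<in> D" "b \<in> D" for a b
    using that by (intro pc_le_em) auto
  have "(\<exists>c\<in>D. pc_le x (em a) (em c) \<and> pc_le x (em b) (em c)) \<longleftrightarrow> (\<exists>c\<in>D. ple x a c \<and> ple x b c)"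
    if "a \<in> D" "b \<in> D" for a b
    by (intro bex_cong refl) (simp add: le that)
  then show ?thesis by (simp add: directed_by_def directed_fam_def)
qed

subsection \<open>Unique continuous extensions\<close>

text \<open>The value {} off the cone is the one that \<open>pc_cont\<close> prescribes, and it
  makes the descriptions unique as total functions.\<close>

definition lift1 :: "pk \<Rightarrow> (('s \<Rightarrow> ennreal) set \<Rightarrow> ('s \<Rightarrow> ennreal) set) \<Rightarrow> 's val set \<Rightarrow> 's val set" where
  "lift1 x h B = (if B \<in> PC x then em (h (unval ` B)) else {})"

lemma unval_em [simp]: "unval ` em A = A"
  by (simp add: em_def image_image)

lemma lift1_em [simp]: "A \<in> PCE x \<Longrightarrow> lift1 x h (em A) = em (h A)"
  by (simp add: lift1_def)

definition econt :: "pk \<Rightarrow> (('s \<Rightarrow> ennreal) set \<Rightarrow> ('s \<Rightarrow> ennreal) set) \<Rightarrow> bool" where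
  "econt x h \<longleftrightarrow> (\<forall>A\<in>PCE x. h A \<in> PCE x) \<and>
     (\<forall>D Y. D \<subseteq> PCE x \<longrightarrow> directed_fam x D (\<lambda>A. A) \<longrightarrow> Y \<in> PCE x \<longrightarrow> islim x D (\<lambda>A. A) Y \<longrightarrow> islim x D h (h Y))"

lemma pc_cont_lift1:
  fixes h :: "('s \<Rightarrow> ennreal) set \<Rightarrow> ('s \<Rightarrow> ennreal) set"
  assumes h: "econt x h" shows "pc_cont x (lift1 x h)"
  unfolding pc_cont_def
proof (intro conjI ballI allI impI)
  show "lift1 x h B \<in> PC x" if "B \<in> PC x" for B :: "'s val set"
    using that h by (auto elim!: PC_E simp: econt_def)
  show "lift1 x h B = {}" if "B \<notin> PC x" for B :: "'s val set" using that by (simp add: lift1_def)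
  fix D and y :: "'s val set" assume D: "D \<subseteq> PC x" "directed_by (pc_le x) D" "is_lub_in (PC x) (pc_le x) D y"
  obtain E where E: "E \<subseteq> PCE x" "D = em ` E" using D(1) by (rule subset_PC_E)
  obtain y' where y: "y = em y'" "y' \<in> PCE x" "is_lub_in (PCE x) (ple x) E y'"
    using D(3) E unfolding E(2) by (blast elim: is_lub_PC_E)
  have dir: "directed_fam x E (\<lambda>A. A)" using D(2) E directed_PC by blast
  have "islim x E (\<lambda>A. A) y'" using y(3) dir E(1) by (intro is_lub_islim) auto
  then have "islim x E h (h y')" using h E(1) dir y(2) unfolding econt_def by blast
  moreover have hE: "h y' \<in> PCE x" "h ` E \<subseteq> PCE x" using h y(2) E(1) by (auto simp: econt_def)
  ultimately have "is_lub_in (PC x) (pc_le x) (em ` h ` E) (em (h y'))"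
    using is_lub_PC[OF hE(2,1)] islim_is_lub[of x E h "h y'"] by simp
  moreover have "lift1 x h ` D = em ` h ` E" unfolding E(2) image_image
  proof (rule image_cong[OF refl])
    fix A assume "A \<in> E"
    then show "lift1 x h (em A) = em (h A)" by (rule lift1_em[OF subsetD[OF E(1)]])
  qed
  ultimately show "is_lub_in (PC x) (pc_le x) (lift1 x h ` D) (lift1 x h y)" using y by simp
qed

lemma is_lub_PC_unique:
  assumes "is_lub_in (PC x) (pc_le x) D y" "is_lub_in (PC x) (pc_le x) D y'"
  shows "y = y'"
proof -
  have "y \<in> PC x" "y' \<in> PC x" using assms by (auto simp: is_lub_in_def)
  then obtain A B where AB: "A \<in> PCE x" "y = em A" "B \<in> PCE x" "y' = em B" by (auto elim!: PC_E)
  have "pc_le x y y'" "pc_le x y' y" using assms by (auto simp: is_lub_in_def)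
  then have "A = B" using AB by (intro ple_antisym) (auto simp: pc_le_em)
  with AB show ?thesis by simp
qed

text \<open>Recasts the density statement \<open>approx_islim\<close> as a directed set of basic
  elements with a least upper bound, the form to which \<open>pc_cont\<close> applies.\<close>

lemma approx_basic:
  assumes A: "A \<in> PCE x"
  defines "D \<equiv> (\<lambda>F. elt x (hullE F)) ` {F. approx x F A}"
  shows "D \<subseteq> PCE x" "directed_by (pc_le x) (em ` D)" "is_lub_in (PC x) (pc_le x) (em ` D) (em A)"
    "\<And>B. B \<in> em ` D \<Longrightarrow> \<exists>F. basicF F \<and> B = basic x F"
proof -
  have g: "generator x (hullE F)" if "approx x F A" for F
    using that by (intro generator_hullE) (auto simp: approx_def)
  show D: "D \<subseteq> PCE x" using g elt_PCE by (auto simp: D_def)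
  have "islim x {F. approx x F A} (\<lambda>F. elt x (hullE F)) A"
    by (rule islim_cong[OF approx_islim(1)[OF A]]) (auto intro: g ple_elt elt_ple)
  then have "is_lub_in (PCE x) (ple x) D A" unfolding D_def using A by (rule islim_is_lub)
  then show "is_lub_in (PC x) (pc_le x) (em ` D) (em A)" using D A is_lub_PC by blast
  have "directed_fam x D (\<lambda>A. A)"
    unfolding directed_fam_def
  proof (intro conjI ballI)
    show "D \<noteq> {}" using approx_directed_fam[OF A] by (simp add: directed_fam_def D_def)
    fix B C assume "B \<in> D" "C \<in> D"
    then obtain F1 F2 where F: "approx x F1 A" "B = elt x (hullE F1)" "approx x F2 A" "C = elt x (hullE F2)"
      by (auto simp: D_def)
    then obtain F where "approx x F A" "ple x (hullE F1) (hullE F)" "ple x (hullE F2) (hullE F)"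
      using approx_directed_fam[OF A] by (auto simp: directed_fam_def)
    then show "\<exists>E\<in>D. ple x B E \<and> ple x C E" using F g by (auto simp: D_def)
  qed
  then show "directed_by (pc_le x) (em ` D)" using directed_PC[OF D] by simp
  fix B assume "B \<in> em ` D"
  then obtain F where "approx x F A" "B = em (elt x (hullE F))" by (auto simp: D_def)
  then show "\<exists>F. basicF F \<and> B = basic x F"
    by (intro exI[of _ "em F"]) (auto simp: basicF_iff basic_em approx_def)
qed

lemma pc_cont_unique:
  assumes h: "pc_cont x h" and h': "pc_cont x h'"
    and eq: "\<And>F. basicF F \<Longrightarrow> h (basic x F) = h' (basic x F)"
  shows "h = h'"
proof
  fix B
  show "h B = h' B"
  proof (cases "B \<in> PC x")
    case False then show ?thesis using h h' by (simp add: pc_cont_def)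
  next
    case True
    then obtain A where A: "A \<in> PCE x" "B = em A" by (rule PC_E)
    define D where "D = em ` (\<lambda>F. elt x (hullE F)) ` {F. approx x F A}"
    note ab = approx_basic[OF A(1), folded D_def]
    have DPC: "D \<subseteq> PC x" using ab(1) unfolding D_def PC_eq by blast
    have "is_lub_in (PC x) (pc_le x) (h ` D) (h B)" "is_lub_in (PC x) (pc_le x) (h' ` D) (h' B)"
      using h h' DPC ab(2,3) unfolding pc_cont_def A(2) by blast+
    moreover have "h ` D = h' ` D" using ab(4) eq by (intro image_cong) auto
    ultimately show ?thesis using is_lub_PC_unique by simp
  qed
qed

text \<open>Evaluates the definite descriptions: any continuous map with the right values on basic
  elements is the one described.\<close>

lemma the_pc_cont:
  assumes h: "pc_cont x h" and R: "\<And>F. basicF F \<Longrightarrow> h (basic x F) = R F"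
  shows "(THE h. pc_cont x h \<and> (\<forall>F. basicF F \<longrightarrow> h (basic x F) = R F)) = h"
  by (rule the_equality) (use assms in \<open>auto intro!: pc_cont_unique\<close>)

lemma basic_PC: "basicF F \<Longrightarrow> basic x F \<in> PC x"
  by (auto simp: basicF_iff basic_em intro!: elt_PCE generator_hullE)

text \<open>Uniqueness in one argument is used twice: first with the first argument basic, then with
  the second argument arbitrary in the cone.\<close>

lemma pc_cont2_unique:
  assumes h: "pc_cont2 x h" and h': "pc_cont2 x h'"
    and eq: "\<And>F G. basicF F \<Longrightarrow> basicF G \<Longrightarrow> h (basic x F) (basic x G) = h' (basic x F) (basic x G)"
  shows "h = h'"
proof -
  have 1: "h (basic x F) = h' (basic x F)" if "basicF F" for F
    using h h' basic_PC[OF that, of x] eq[OF that] unfolding pc_cont2_def by (intro pc_cont_unique) auto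
  have 2: "(\<lambda>A. h A B) = (\<lambda>A. h' A B)" if "B \<in> PC x" for B
    using h h' that 1 unfolding pc_cont2_def by (intro pc_cont_unique) auto
  have "h A B = h' A B" for A B
  proof (cases "B \<in> PC x")
    case True then show ?thesis using fun_cong[OF 2[OF True], of A] by simp
  next
    case False
    show ?thesis
    proof (cases "A \<in> PC x")
      case True
      then have "pc_cont x (h A)" "pc_cont x (h' A)" using h h' by (auto simp: pc_cont2_def)
      then show ?thesis using False by (simp add: pc_cont_def)
    qed (use h h' in \<open>simp add: pc_cont2_def\<close>)
  qed
  then show ?thesis by blast
qed

lemma the_pc_cont2:
  assumes h: "pc_cont2 x h" and R: "\<And>F G. basicF F \<Longrightarrow> basicF G \<Longrightarrow> h (basic x F) (basic x G) = R F G"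
  shows "(THE h. pc_cont2 x h \<and> (\<forall>F G. basicF F \<longrightarrow> basicF G \<longrightarrow> h (basic x F) (basic x G) = R F G)) = h"
  by (rule the_equality) (use assms in \<open>auto intro!: pc_cont2_unique\<close>)

definition lift2 :: "pk \<Rightarrow> (('s \<Rightarrow> ennreal) set \<Rightarrow> ('s \<Rightarrow> ennreal) set \<Rightarrow> ('s \<Rightarrow> ennreal) set) \<Rightarrow>
    's val set \<Rightarrow> 's val set \<Rightarrow> 's val set" where
  "lift2 x h A B = (if A \<in> PC x \<and> B \<in> PC x then em (h (unval ` A) (unval ` B)) else {})"

lemma lift2_em [simp]: "A \<in> PCE x \<Longrightarrow> B \<in> PCE x \<Longrightarrow> lift2 x h (em A) (em B) = em (h A B)"
  by (simp add: lift2_def)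

lemma pc_cont2_lift2:
  assumes "\<And>A. A \<in> PCE x \<Longrightarrow> econt x (h A)" "\<And>B. B \<in> PCE x \<Longrightarrow> econt x (\<lambda>A. h A B)"
  shows "pc_cont2 x (lift2 x (h :: ('a \<Rightarrow> ennreal) set \<Rightarrow> _))"
  unfolding pc_cont2_def
proof (intro conjI ballI allI impI)
  fix A :: "'a val set" assume "A \<in> PC x"
  then obtain A' where A': "A' \<in> PCE x" "A = em A'" by (rule PC_E)
  have "lift2 x h A = lift1 x (h A')" "(\<lambda>B. lift2 x h B A) = lift1 x (\<lambda>B. h B A')"
    using A' by (auto simp: lift2_def lift1_def fun_eq_iff)
  then show "pc_cont x (lift2 x h A)" "pc_cont x (\<lambda>B. lift2 x h B A)"
    using assms A'(1) by (auto intro: pc_cont_lift1)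
qed (simp add: lift2_def)

lemma islim_const: "I \<noteq> {} \<Longrightarrow> islim x I (\<lambda>_. C) C"
  by (simp add: islim_def)

text \<open>Separate continuity as a special case of joint continuity: the variable occupies the
  positions in \<open>J\<close>, and the other positions hold constant families.\<close>

lemma econt_Op:
  fixes \<theta> :: "'g::topological_space \<Rightarrow> ('j \<times> 's \<Rightarrow> ennreal) \<Rightarrow> 's \<Rightarrow> ennreal"
  assumes \<theta>: "jcont \<theta>" and G: "compact G" and C: "\<And>j. j \<notin> J \<Longrightarrow> generator x (C j)"
    and g: "\<And>A. A \<in> PCE x \<Longrightarrow> generator x (Op G \<theta> (\<lambda>j. if j \<in> J then A else C j))"
  shows "econt x (\<lambda>A. elt x (Op G \<theta> (\<lambda>j. if j \<in> J then A else C j)))"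
  unfolding econt_def
proof (intro conjI ballI allI impI)
  show "elt x (Op G \<theta> (\<lambda>j. if j \<in> J then A else C j)) \<in> PCE x" if "A \<in> PCE x" for A
    using that by (intro elt_PCE g)
  fix D and Y :: "('s \<Rightarrow> ennreal) set" assume D: "D \<subseteq> PCE x" "directed_fam x D (\<lambda>A. A)" and Y: "Y \<in> PCE x" "islim x D (\<lambda>A. A) Y"
  have ne: "D \<noteq> {}" using D(2) by (simp add: directed_fam_def)
  have "islim x D (\<lambda>A. Op G \<theta> (\<lambda>j. if j \<in> J then A else C j)) (Op G \<theta> (\<lambda>j. if j \<in> J then Y else C j))"
  proof (rule Op_islim[OF \<theta> G ne])
    fix A B assume AB: "A \<in> D" "B \<in> D"
    then obtain E where "E \<in> D" "ple x A E" "ple x B E" using D(2) by (auto simp: directed_fam_def)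
    then show "\<exists>k\<in>D. \<forall>j. ple x (if j \<in> J then A else C j) (if j \<in> J then k else C j) \<and>
        ple x (if j \<in> J then B else C j) (if j \<in> J then k else C j)"
      by (intro bexI[of _ E]) auto
  next
    show "generator x (if j \<in> J then A else C j)" if "A \<in> D" for A j
      using that D(1) C PCE_generator by auto
    show "(if j \<in> J then Y else C j) \<noteq> {}" for j
      using PCE_generator[OF Y(1)] C[of j] by (auto simp: generator_def)
    show "islim x D (\<lambda>A. if j \<in> J then A else C j) (if j \<in> J then Y else C j)" for j
      using Y(2) islim_const[OF ne] by auto
  qed
  then show "islim x D (\<lambda>A. elt x (Op G \<theta> (\<lambda>j. if j \<in> J then A else C j)))
      (elt x (Op G \<theta> (\<lambda>j. if j \<in> J then Y else C j)))"
  proof (rule islim_cong)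
    show "ple x (Op G \<theta> (\<lambda>j. if j \<in> J then A else C j)) (elt x (Op G \<theta> (\<lambda>j. if j \<in> J then A else C j))) \<and>
      ple x (elt x (Op G \<theta> (\<lambda>j. if j \<in> J then A else C j))) (Op G \<theta> (\<lambda>j. if j \<in> J then A else C j))"
      if A: "A \<in> D" for A
      using ple_elt[OF g[OF subsetD[OF D(1) A]]] elt_ple[OF g[OF subsetD[OF D(1) A]]] by (rule conjI)
    show "ple x (Op G \<theta> (\<lambda>j. if j \<in> J then Y else C j)) (elt x (Op G \<theta> (\<lambda>j. if j \<in> J then Y else C j)))"
      "ple x (elt x (Op G \<theta> (\<lambda>j. if j \<in> J then Y else C j))) (Op G \<theta> (\<lambda>j. if j \<in> J then Y else C j))"
      using ple_elt[OF g[OF Y(1)]] elt_ple[OF g[OF Y(1)]] .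
  qed
qed

definition peq :: "pk \<Rightarrow> ('s \<Rightarrow> ennreal) set \<Rightarrow> ('s \<Rightarrow> ennreal) set \<Rightarrow> bool" where
  "peq x X Y \<longleftrightarrow> ple x X Y \<and> ple x Y X"

lemma peq_sym: "peq x X Y \<Longrightarrow> peq x Y X" by (simp add: peq_def)
lemma peq_trans: "peq x X Y \<Longrightarrow> peq x Y Z \<Longrightarrow> peq x X Z" unfolding peq_def using ple_trans by blast
lemma elt_cong: "peq x X Y \<Longrightarrow> elt x X = elt x Y" by (simp add: peq_def elt_eqI)

lemma addS_ple:
  assumes "ple x A A'" "ple x B B'" "A \<noteq> {}" "B \<noteq> {}" "A' \<noteq> {}" "B' \<noteq> {}"
  shows "ple x (addS A B) (addS A' B')"
  unfolding addS_Op using assms by (intro Op_ple_mono jcont_add_op) auto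

lemma scaleS_ple:
  assumes "ple x A A'" "A \<noteq> {}" "A' \<noteq> {}"
  shows "ple x (scaleS r A) (scaleS r A')"
  unfolding scaleS_Op using assms by (intro Op_ple_mono jcont_scale_op) auto

lemma joinS_ple:
  assumes "ple x A A'" "ple x B B'" "A \<noteq> {}" "B \<noteq> {}" "A' \<noteq> {}" "B' \<noteq> {}"
  shows "ple x (joinS A B) (joinS A' B')"
  unfolding joinS_Op using assms by (intro Op_ple_mono jcont_mix_op) auto

lemma klS_ple:
  assumes "ple x A A'" "\<And>t. ple x (f t) (f' t)" "A \<noteq> {}" "\<And>t. f t \<noteq> {}" "A' \<noteq> {}" "\<And>t. f' t \<noteq> {}"
  shows "ple x (klS f A) (klS f' A')"
  unfolding klS_Op using assms by (intro Op_ple_mono jcont_kl_op) (auto split: option.split)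

lemma generator_ne: "generator x X \<Longrightarrow> X \<noteq> {}" by (simp add: generator_def)
lemma elt_ne: "generator x X \<Longrightarrow> elt x X \<noteq> {}" using elt_PCE by (fastforce simp: PCE_def)

lemma addS_elt:
  assumes "generator x X" "generator x Y" shows "peq x (addS (elt x X) (elt x Y)) (addS X Y)"
  unfolding peq_def using assms[THEN elt_ne] assms[THEN generator_ne] assms[THEN ple_elt] assms[THEN elt_ple]
  by (intro conjI addS_ple)

lemma scaleS_elt:
  assumes "generator x X" shows "peq x (scaleS r (elt x X)) (scaleS r X)"
  unfolding peq_def using assms[THEN elt_ne] assms[THEN generator_ne] assms[THEN ple_elt] assms[THEN elt_ple]
  by (intro conjI scaleS_ple)

lemma joinS_elt:
  assumes "generator x X" "generator x Y" shows "peq x (joinS (elt x X) (elt x Y)) (joinS X Y)"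
  unfolding peq_def using assms[THEN elt_ne] assms[THEN generator_ne] assms[THEN ple_elt] assms[THEN elt_ple]
  by (intro conjI joinS_ple)

lemma klS_elt:
  assumes "generator x X" "\<And>t. f t \<noteq> {}" shows "peq x (klS f (elt x X)) (klS f X)"
  unfolding peq_def using assms(1)[THEN elt_ne] assms(1)[THEN generator_ne] assms(1)[THEN ple_elt]
    assms(1)[THEN elt_ple] assms(2) ple_refl
  by (intro conjI klS_ple)

subsection \<open>Scalar multiplication, addition and formal union\<close>

text \<open>Scaling is affine, so images and preimages of convex sets under it are convex; one
  inclusion uses the image, the other the preimage.\<close>

lemma hullE_scaleS: "hullE (scaleS r F) = scaleS r (hullE F)"
proof
  have eq: "mixv p (\<lambda>s. ennreal r * a s) (\<lambda>s. ennreal r * b s) = (\<lambda>s. ennreal r * mixv p a b s)" for p a b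
    by (simp add: mixv_def distrib_left mult.left_commute)
  have "cvx (scaleS r (hullE F))" unfolding cvx_def
  proof (intro ballI allI impI)
    fix a b p assume "a \<in> scaleS r (hullE F)" "b \<in> scaleS r (hullE F)" "0 \<le> p \<and> p \<le> (1::real)"
    then show "mixv p a b \<in> scaleS r (hullE F)"
      using cvxD[OF cvx_hullE, of _ F] by (auto simp: scaleS_def eq)
  qed
  then show "hullE (scaleS r F) \<subseteq> scaleS r (hullE F)"
    using hullE_inc[of F] by (intro hullE_min) (auto simp: scaleS_def)
  have "hullE F \<subseteq> {a. (\<lambda>s. ennreal r * a s) \<in> hullE (scaleS r F)}"
  proof (rule hullE_min)
    show "F \<subseteq> {a. (\<lambda>s. ennreal r * a s) \<in> hullE (scaleS r F)}"
      using hullE_inc[of "scaleS r F"] by (auto simp: scaleS_def)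
    show "cvx {a. (\<lambda>s. ennreal r * a s) \<in> hullE (scaleS r F)}"
      unfolding cvx_def using cvxD[OF cvx_hullE, of _ "scaleS r F"] by (auto simp: eq[symmetric])
  qed
  then show "scaleS r (hullE F) \<subseteq> hullE (scaleS r F)" by (auto simp: scaleS_def)
qed

lemma mixv_add:
  "0 \<le> p \<Longrightarrow> p \<le> 1 \<Longrightarrow> mixv p (\<lambda>s. a s + b s) (\<lambda>s. a' s + b' s) = (\<lambda>s. mixv p a a' s + mixv p b b' s)"
  by (simp add: mixv_def mix_mixv)

lemma cvx_translate: "cvx A \<Longrightarrow> cvx {b. (\<lambda>s. a s + b s) \<in> A}"
  unfolding cvx_def
proof (intro ballI allI impI)
  fix b b' p assume A: "\<forall>a\<in>A. \<forall>b\<in>A. \<forall>p. 0 \<le> p \<and> p \<le> 1 \<longrightarrow> mixv p a b \<in> A"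
    and b: "b \<in> {b. (\<lambda>s. a s + b s) \<in> A}" "b' \<in> {b. (\<lambda>s. a s + b s) \<in> A}" and p: "0 \<le> p \<and> p \<le> (1::real)"
  have "mixv p (\<lambda>s. a s + b s) (\<lambda>s. a s + b' s) \<in> A" using A b p by blast
  then show "mixv p b b' \<in> {b. (\<lambda>s. a s + b s) \<in> A}" using p by (simp add: mixv_add mixv_same)
qed

text \<open>With one summand fixed, addition is affine in the other. The hull can therefore be taken
  in one summand after the other.\<close>

lemma hullE_addS: "hullE (addS F G) = addS (hullE F) (hullE G)"
proof
  have "cvx (addS (hullE F) (hullE G))" unfolding cvx_def
  proof (intro ballI allI impI)
    fix x y p assume "x \<in> addS (hullE F) (hullE G)" "y \<in> addS (hullE F) (hullE G)" and p: "0 \<le> p \<and> p \<le> (1::real)"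
    then obtain a b a' b' where *: "x = (\<lambda>s. a s + b s)" "y = (\<lambda>s. a' s + b' s)" "a \<in> hullE F" "a' \<in> hullE F"
      "b \<in> hullE G" "b' \<in> hullE G" by (auto simp: addS_def)
    have "mixv p a a' \<in> hullE F" "mixv p b b' \<in> hullE G" using * p by (auto intro!: cvxD[OF cvx_hullE])
    then show "mixv p x y \<in> addS (hullE F) (hullE G)" using p unfolding addS_def *(1,2) by (auto simp: mixv_add)
  qed
  then show "hullE (addS F G) \<subseteq> addS (hullE F) (hullE G)"
    using hullE_inc[of F] hullE_inc[of G] by (intro hullE_min) (auto simp: addS_def)
  let ?H = "hullE (addS F G)"
  have 1: "hullE G \<subseteq> {b. (\<lambda>s. a s + b s) \<in> ?H}" if "a \<in> F" for a
    using that hullE_inc[of "addS F G"] by (intro hullE_min cvx_translate cvx_hullE) (auto simp: addS_def)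
  have "hullE F \<subseteq> {a. (\<lambda>s. b s + a s) \<in> ?H}" if "b \<in> hullE G" for b
    using that 1 by (intro hullE_min cvx_translate cvx_hullE) (auto simp: add.commute)
  then have 2: "(\<lambda>s. b s + a s) \<in> ?H" if "a \<in> hullE F" "b \<in> hullE G" for a b using that by blast
  show "addS (hullE F) (hullE G) \<subseteq> ?H"
  proof
    fix z assume "z \<in> addS (hullE F) (hullE G)"
    then obtain a b where "z = (\<lambda>s. a s + b s)" "a \<in> hullE F" "b \<in> hullE G" by (auto simp: addS_def)
    then show "z \<in> ?H" using 2[of a b] by (simp add: add.commute)
  qed
qed

lemma vminkowski_em: "vminkowski (em F) (em G) = em (addS F G)"
proof -
  have "vminkowski (em F) (em G) = (\<lambda>(a, b). vadd (val a) (val b)) ` (F \<times> G)"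
    by (auto simp: vminkowski_def em_def)
  also have "\<dots> = val ` (\<lambda>(a, b) s. a s + b s) ` (F \<times> G)"
    by (simp add: image_image val_add case_prod_unfold)
  also have "(\<lambda>(a, b) s. a s + b s) ` (F \<times> G) = addS F G" by (auto simp: addS_def)
  finally show ?thesis by (simp add: em_def)
qed

lemma vscale_em: "vscale r ` em F = em (scaleS r F)"
proof -
  have "scaleS r F = (\<lambda>a s. ennreal r * a s) ` F" by (auto simp: scaleS_def)
  then show ?thesis by (simp add: em_def image_image val_scale)
qed

lemma em_Un: "em (A \<union> B) = em A \<union> em B" by (auto simp: em_def)

lemma pscale_em:
  assumes "A \<in> PCE x" shows "pscale x r (em A) = em (elt x (scaleS r A))"
proof -
  have c: "econt x (\<lambda>A :: ('a \<Rightarrow> ennreal) set. elt x (scaleS r A))"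
  proof -
    have "econt x (\<lambda>A :: ('a \<Rightarrow> ennreal) set. elt x (Op {0} (scale_op r) (\<lambda>j. if j \<in> UNIV then A else {})))"
      by (rule econt_Op[OF jcont_scale_op])
        (auto simp: scaleS_Op[symmetric] intro: cvx_generator_generator cvx_generator_scaleS PCE_cvx_generator)
    then show ?thesis by (simp add: scaleS_Op)
  qed
  have "pscale x r = lift1 x (\<lambda>A :: ('a \<Rightarrow> ennreal) set. elt x (scaleS r A))"
    unfolding pscale_def
  proof (rule the_pc_cont[OF pc_cont_lift1[OF c]])
    fix F :: "'a val set" assume "basicF F"
    then obtain G where G: "F = em G" "finite G" "G \<noteq> {}" by (auto simp: basicF_iff)
    then have g: "generator x (hullE G)" by (intro generator_hullE)
    then show "lift1 x (\<lambda>A. elt x (scaleS r A)) (basic x F) = basic x (vscale r ` F)"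
      by (simp add: G(1) basic_em vscale_em elt_PCE hullE_scaleS elt_cong[OF scaleS_elt])
  qed
  then show ?thesis using assms by simp
qed

lemma fam_True: "(\<lambda>j. if j \<in> {True} then A else B) = (\<lambda>j. if j then A else B)"
  and fam_False: "(\<lambda>j. if j \<in> {False} then B else A) = (\<lambda>j. if j then A else B)"
  by auto

lemma padd_eq: "padd x = lift2 x (\<lambda>A B :: ('a \<Rightarrow> ennreal) set. elt x (addS A B))"
proof -
  have n: "generator x (addS A B)" if "A \<in> PCE x" "B \<in> PCE x" for A B :: "('a \<Rightarrow> ennreal) set"
    using that by (intro cvx_generator_generator cvx_generator_addS PCE_cvx_generator)
  have c1: "econt x (\<lambda>B. elt x (addS A B))" if "A \<in> PCE x" for A :: "('a \<Rightarrow> ennreal) set"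
  proof -
    have "econt x (\<lambda>B. elt x (Op {0} add_op (\<lambda>j. if j \<in> {False} then B else A)))"
      by (rule econt_Op[OF jcont_add_op])
        (simp, rule PCE_generator[OF that], unfold fam_False addS_Op[symmetric], rule n[OF that])
    then show ?thesis by (simp only: fam_False addS_Op)
  qed
  have c2: "econt x (\<lambda>A. elt x (addS A B))" if "B \<in> PCE x" for B :: "('a \<Rightarrow> ennreal) set"
  proof -
    have "econt x (\<lambda>A. elt x (Op {0} add_op (\<lambda>j. if j \<in> {True} then A else B)))"
      by (rule econt_Op[OF jcont_add_op])
        (simp, rule PCE_generator[OF that], unfold fam_True addS_Op[symmetric], rule n[OF _ that])
    then show ?thesis by (simp only: fam_True addS_Op)
  qed
  show ?thesis
    unfolding padd_def
  proof (rule the_pc_cont2[OF pc_cont2_lift2])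
    fix F G :: "'a val set" assume "basicF F" "basicF G"
    then obtain F' G' where G: "F = em F'" "finite F'" "F' \<noteq> {}" "G = em G'" "finite G'" "G' \<noteq> {}"
      by (auto simp: basicF_iff)
    then have g: "generator x (hullE F')" "generator x (hullE G')" by (auto intro: generator_hullE)
    then show "lift2 x (\<lambda>A B. elt x (addS A B)) (basic x F) (basic x G) = basic x (vminkowski F G)"
      by (simp add: G(1,4) basic_em vminkowski_em elt_PCE hullE_addS elt_cong[OF addS_elt])
  qed (use c1 c2 in auto)
qed

lemma padd_em: "A \<in> PCE x \<Longrightarrow> B \<in> PCE x \<Longrightarrow> padd x (em A) (em B) = em (elt x (addS A B))"
  by (simp add: padd_eq)

text \<open>Needed because the commutation law of a fold ranges over all sets, including those
  outside the cone.\<close>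

lemma padd_nonPC: "B \<notin> PC x \<Longrightarrow> padd x A B = {}"
  by (simp add: padd_eq lift2_def)

lemma punion_eq: "punion x = lift2 x (\<lambda>A B :: ('a \<Rightarrow> ennreal) set. elt x (joinS A B))"
proof -
  have n: "generator x (joinS A B)" if "A \<in> PCE x" "B \<in> PCE x" for A B :: "('a \<Rightarrow> ennreal) set"
    using that by (intro cvx_generator_generator cvx_generator_joinS PCE_cvx_generator)
  have c1: "econt x (\<lambda>B. elt x (joinS A B))" if "A \<in> PCE x" for A :: "('a \<Rightarrow> ennreal) set"
  proof -
    have "econt x (\<lambda>B. elt x (Op {0..1} mix_op (\<lambda>j. if j \<in> {False} then B else A)))"
      by (rule econt_Op[OF jcont_mix_op])
        (simp, rule PCE_generator[OF that], unfold fam_False joinS_Op[symmetric], rule n[OF that])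
    then show ?thesis by (simp only: fam_False joinS_Op)
  qed
  have c2: "econt x (\<lambda>A. elt x (joinS A B))" if "B \<in> PCE x" for B :: "('a \<Rightarrow> ennreal) set"
  proof -
    have "econt x (\<lambda>A. elt x (Op {0..1} mix_op (\<lambda>j. if j \<in> {True} then A else B)))"
      by (rule econt_Op[OF jcont_mix_op])
        (simp, rule PCE_generator[OF that], unfold fam_True joinS_Op[symmetric], rule n[OF _ that])
    then show ?thesis by (simp only: fam_True joinS_Op)
  qed
  show ?thesis
    unfolding punion_def
  proof (rule the_pc_cont2[OF pc_cont2_lift2])
    fix F G :: "'a val set" assume "basicF F" "basicF G"
    then obtain F' G' where G: "F = em F'" "finite F'" "F' \<noteq> {}" "G = em G'" "finite G'" "G' \<noteq> {}"
      by (auto simp: basicF_iff)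
    then have g: "generator x (hullE F')" "generator x (hullE G')" by (auto intro: generator_hullE)
    then show "lift2 x (\<lambda>A B. elt x (joinS A B)) (basic x F) (basic x G) = basic x (F \<union> G)"
      using G by (simp add: basic_em em_Un[symmetric] elt_PCE hullE_Un_Op joinS_Op[symmetric] elt_cong[OF joinS_elt])
  qed (use c1 c2 in auto)
qed

lemma punion_em: "A \<in> PCE x \<Longrightarrow> B \<in> PCE x \<Longrightarrow> punion x (em A) (em B) = em (elt x (joinS A B))"
  by (simp add: punion_eq)

lemma punion_nonPC: "B \<notin> PC x \<Longrightarrow> punion x A B = {}"
  by (simp add: punion_eq lift2_def)

subsection \<open>The Kleisli extension\<close>

lemma klS_UN: "klS f A = (\<Union>v\<in>A. klS f {v})"
  by (auto simp: klS_def)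

text \<open>One selection serves both valuations. Only an inclusion is stated, since the right-hand
  side allows a different selection for each.\<close>

lemma klS_mixv_subset:
  assumes p: "0 \<le> p" "p \<le> 1"
  shows "klS f {mixv p v v'} \<subseteq> {mixv p a b | a b. a \<in> klS f {v} \<and> b \<in> klS f {v'}}"
proof
  fix z assume "z \<in> klS f {mixv p v v'}"
  then obtain g where g: "z = (\<lambda>s. \<Sum>\<^sub>\<infinity>t. mixv p v v' t * g t s)" "\<And>t. g t \<in> f t" by (auto simp: klS_def)
  have "z = mixv p (\<lambda>s. \<Sum>\<^sub>\<infinity>t. v t * g t s) (\<lambda>s. \<Sum>\<^sub>\<infinity>t. v' t * g t s)"
    unfolding g(1) mixv_def by (simp add: distrib_right mult.assoc infsum_add ennreal_infsum_cmult)
  moreover have "(\<lambda>s. \<Sum>\<^sub>\<infinity>t. v t * g t s) \<in> klS f {v}" "(\<lambda>s. \<Sum>\<^sub>\<infinity>t. v' t * g t s) \<in> klS f {v'}"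
    using g(2) by (auto simp: klS_def)
  ultimately show "z \<in> {mixv p a b | a b. a \<in> klS f {v} \<and> b \<in> klS f {v'}}" by blast
qed

lemma klS_hullE: "klS f (hullE F) \<subseteq> hullE (\<Union>v\<in>F. klS f {v})" (is "_ \<subseteq> ?H")
proof -
  have "hullE F \<subseteq> {v. klS f {v} \<subseteq> ?H}"
  proof (rule hullE_min)
    show "F \<subseteq> {v. klS f {v} \<subseteq> ?H}" using hullE_inc[of "\<Union>v\<in>F. klS f {v}"] by blast
    show "cvx {v. klS f {v} \<subseteq> ?H}" unfolding cvx_def
    proof (intro ballI allI impI)
      fix v v' p assume *: "v \<in> {v. klS f {v} \<subseteq> ?H}" "v' \<in> {v. klS f {v} \<subseteq> ?H}" "0 \<le> p \<and> p \<le> (1::real)"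
      have "{mixv p a b | a b. a \<in> klS f {v} \<and> b \<in> klS f {v'}} \<subseteq> ?H"
        using * by (auto intro!: cvxD[OF cvx_hullE])
      then show "mixv p v v' \<in> {v. klS f {v} \<subseteq> ?H}" using klS_mixv_subset[of p f v v'] * by auto
    qed
  qed
  then show ?thesis by (subst klS_UN) blast
qed

lemma klS_mono: "A \<subseteq> B \<Longrightarrow> klS f A \<subseteq> klS f B"
  unfolding klS_def by blast

lemma ple_hullE_UN:
  assumes "\<And>i. i \<in> I \<Longrightarrow> ple x (X i) (Y i)"
  shows "ple x (hullE (\<Union>i\<in>I. X i)) (hullE (\<Union>i\<in>I. Y i))"
  unfolding ple_def
proof (intro conjI impI)
  let ?X = "hullE (\<Union>i\<in>I. X i)" and ?Y = "hullE (\<Union>i\<in>I. Y i)"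
  { assume x: "x \<noteq> PU"
    have "X i \<subseteq> scl ?Y" if "i \<in> I" for i
    proof -
      have "X i \<subseteq> scl (Y i)" using assms[OF that] x by (simp add: ple_def scl_subset_iff)
      also have "scl (Y i) \<subseteq> scl ?Y" using hullE_inc[of "\<Union>i\<in>I. Y i"] that by (intro scl_mono) blast
      finally show ?thesis .
    qed
    moreover have "cvx (scl ?Y)"
      by (rule cvx_scl) (use subset_scl[of ?Y] cvxD[OF cvx_hullE, of _ "\<Union>i\<in>I. Y i"] in blast)
    ultimately show "scl ?X \<subseteq> scl ?Y" unfolding scl_subset_iff by (intro hullE_min UN_least) auto
  }
  { assume x: "x \<noteq> PL"
    have "Y i \<subseteq> upE ?X" if "i \<in> I" for i
    proof -
      have "Y i \<subseteq> upE (X i)" using assms[OF that] x subset_upE[of "Y i"] by (auto simp: ple_def)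
      also have "upE (X i) \<subseteq> upE ?X" using hullE_inc[of "\<Union>i\<in>I. X i"] that by (intro upE_mono) blast
      finally show ?thesis .
    qed
    moreover have "cvx (upE ?X)"
      by (rule cvx_upE) (use subset_upE[of ?X] cvxD[OF cvx_hullE, of _ "\<Union>i\<in>I. X i"] in blast)
    ultimately have "?Y \<subseteq> upE ?X" by (intro hullE_min UN_least) auto
    then show "upE ?Y \<subseteq> upE ?X" using upE_mono[of ?Y "upE ?X"] by simp
  }
qed

text \<open>The Kleisli image of the hull lies between the union and the hull of the union. Its
  Scott closure and saturation are convex even where the image itself is not, so both sets generate
  the same element.\<close>

lemma klS_hullE_peq:
  assumes F: "finite F" "F \<noteq> {}" and f: "\<And>t. cvx_generator (f t)"
  shows "peq x (hullE (\<Union>v\<in>F. klS f {v})) (klS f (hullE F))"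
proof -
  let ?H = "hullE (\<Union>v\<in>F. klS f {v})"
  have g: "generator x (klS f (hullE F))" by (intro generator_klS cvx_generator_hullE F f)
  have sub1: "(\<Union>v\<in>F. klS f {v}) \<subseteq> klS f (hullE F)" using hullE_inc[of F] klS_UN[of f "hullE F"] by blast
  have sub2: "klS f (hullE F) \<subseteq> ?H" by (rule klS_hullE)
  have "?H \<subseteq> scl (klS f (hullE F))" if "x \<noteq> PU"
    using that g sub1 subset_scl[of "klS f (hullE F)"] by (intro hullE_min) (auto simp: generator_def)
  moreover have "?H \<subseteq> upE (klS f (hullE F))" if "x \<noteq> PL"
    using that g sub1 subset_upE[of "klS f (hullE F)"] by (intro hullE_min) (auto simp: generator_def)
  moreover have "scl (klS f (hullE F)) \<subseteq> scl ?H" "upE (klS f (hullE F)) \<subseteq> upE ?H"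
    using sub2 by (intro scl_mono upE_mono; assumption)+
  ultimately show ?thesis unfolding peq_def ple_def
    using upE_mono[of ?H "upE (klS f (hullE F))"] by (auto simp: scl_subset_iff)
qed

lemma klS_finite_support:
  assumes T: "finite T" "\<And>t. t \<notin> T \<Longrightarrow> w t = 0"
  shows "klS f {w} = {\<lambda>s. \<Sum>t\<in>T. w t * g t s | g. \<forall>t. g t \<in> f t}"
proof -
  have "(\<Sum>\<^sub>\<infinity>t. w t * g t s) = (\<Sum>t\<in>T. w t * g t s)" for g :: "'a \<Rightarrow> 'a \<Rightarrow> ennreal" and s
  proof -
    have "(\<Sum>\<^sub>\<infinity>t. w t * g t s) = (\<Sum>\<^sub>\<infinity>t\<in>T. w t * g t s)"
      by (rule infsum_cong_neutral) (use T in auto)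
    then show ?thesis using T(1) by simp
  qed
  then show ?thesis by (simp add: klS_def)
qed

lemma addS_commute: "addS A B = addS B A"
proof -
  have "addS A B \<subseteq> addS B A" for A B :: "('s \<Rightarrow> ennreal) set"
  proof
    fix z assume "z \<in> addS A B"
    then obtain a b where "z = (\<lambda>s. a s + b s)" "a \<in> A" "b \<in> B" by (auto simp: addS_def)
    then show "z \<in> addS B A" unfolding addS_def
      by (intro CollectI exI[of _ b] exI[of _ a]) (simp add: add.commute)
  qed
  then show ?thesis by blast
qed

lemma addS_assoc: "addS A (addS B C) = addS (addS A B) C"
proof -
  have sub: "addS A (addS B C) \<subseteq> addS (addS A B) C" for A B C :: "('s \<Rightarrow> ennreal) set"
  proof
    fix z assume "z \<in> addS A (addS B C)"
    then obtain a b c where z: "z = (\<lambda>s. a s + (b s + c s))" "a \<in> A" "b \<in> B" "c \<in> C"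
      by (auto simp: addS_def)
    then have "(\<lambda>s. a s + b s) \<in> addS A B" by (auto simp: addS_def)
    then show "z \<in> addS (addS A B) C" unfolding addS_def[of "addS A B"] using z
      by (intro CollectI exI[of _ "\<lambda>s. a s + b s"] exI[of _ c]) (simp add: add.assoc)
  qed
  have "addS (addS A B) C = addS C (addS B A)" by (metis addS_commute)
  also have "\<dots> \<subseteq> addS (addS C B) A" by (rule sub)
  also have "\<dots> = addS A (addS B C)" by (metis addS_commute)
  finally show ?thesis using sub by blast
qed

lemma addS_left_commute: "addS A (addS B C) = addS B (addS A C)"
  by (metis addS_assoc addS_commute)

lemma empty_notin_PC: "{} \<notin> PC x"
  by (cases x) auto

lemma klS_insert:
  assumes T: "finite T" "s \<notin> T" and f: "\<And>t. f t \<noteq> {}" and r: "w s = ennreal r"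
  shows "addS (scaleS r (f s)) (klS f {\<lambda>t. if t \<in> T then w t else 0}) = klS f {\<lambda>t. if t \<in> insert s T then w t else 0}"
proof -
  have eq: "klS f {\<lambda>t. if t \<in> T then w t else 0} = {\<lambda>z. \<Sum>t\<in>T. w t * g t z | g. \<forall>t. g t \<in> f t}" if "finite T" for T
  proof -
    have "(\<Sum>t\<in>T. (if t \<in> T then w t else 0) * g t z) = (\<Sum>t\<in>T. w t * g t z)" for g :: "'a \<Rightarrow> 'a \<Rightarrow> ennreal" and z
      by (intro sum.cong) auto
    then show ?thesis using that by (subst klS_finite_support[of T]) auto
  qed
  show ?thesis unfolding eq[OF T(1)] eq[OF finite.insertI[OF T(1)]]
  proof (intro set_eqI iffI)
    fix z assume "z \<in> addS (scaleS r (f s)) {\<lambda>z. \<Sum>t\<in>T. w t * g t z | g. \<forall>t. g t \<in> f t}"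
    then obtain a g where z: "z = (\<lambda>y. ennreal r * a y + (\<Sum>t\<in>T. w t * g t y))" "a \<in> f s" "\<And>t. g t \<in> f t"
      by (auto simp: addS_def scaleS_def)
    \<comment> \<open>Since \<open>s\<close> is not in \<open>T\<close>, the selection is free at
      \<open>s\<close> and may be redefined as \<open>a\<close> there.\<close>
    have "(\<Sum>t\<in>T. w t * (g(s := a)) t y) = (\<Sum>t\<in>T. w t * g t y)" for y
      using T(2) by (intro sum.cong) auto
    then have "z = (\<lambda>y. \<Sum>t\<in>insert s T. w t * (g(s := a)) t y)" using T by (simp add: z(1) r)
    moreover have "\<forall>t. (g(s := a)) t \<in> f t" using z by simp
    ultimately show "z \<in> {\<lambda>z. \<Sum>t\<in>insert s T. w t * g t z | g. \<forall>t. g t \<in> f t}" by blast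
  next
    fix z assume "z \<in> {\<lambda>z. \<Sum>t\<in>insert s T. w t * g t z | g. \<forall>t. g t \<in> f t}"
    then obtain g where z: "z = (\<lambda>y. \<Sum>t\<in>insert s T. w t * g t y)" "\<And>t. g t \<in> f t" by auto
    have "z = (\<lambda>y. (ennreal r * g s y) + (\<Sum>t\<in>T. w t * g t y))" using T by (simp add: z(1) r)
    moreover have "(\<lambda>y. ennreal r * g s y) \<in> scaleS r (f s)" using z(2) by (auto simp: scaleS_def)
    ultimately show "z \<in> addS (scaleS r (f s)) {\<lambda>z. \<Sum>t\<in>T. w t * g t z | g. \<forall>t. g t \<in> f t}"
      unfolding addS_def using z(2) by (intro CollectI exI[of _ "\<lambda>y. ennreal r * g s y"]
          exI[of _ "\<lambda>y. \<Sum>t\<in>T. w t * g t y"]) auto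
  qed
qed

text \<open>Induction over the finite support, each state contributing one scaled summand. Values of
  a simple function are finite, so \<open>enn2real\<close>, which sends top to 0, loses
  nothing.\<close>

lemma psum_em:
  fixes f :: "'s \<Rightarrow> ('s \<Rightarrow> ennreal) set"
  assumes f: "\<And>t. f t \<in> PCE x" and v: "simple_fn v"
  shows "psum x (\<lambda>t. em (f t)) (val v) = em (elt x (klS f {v}))"
proof -
  define c where "c s = elt x (scaleS (enn2real (v s)) (f s))" for s
  have gs: "generator x (scaleS r (f s))" for r s by (intro cvx_generator_generator cvx_generator_scaleS PCE_cvx_generator[OF f])
  have cP: "c s \<in> PCE x" for s unfolding c_def by (intro elt_PCE gs)
  define comb where "comb s A = padd x (em (c s)) A" for s A
  have ga: "generator x (addS A B)" if "A \<in> PCE x" "B \<in> PCE x" for A B :: "('s \<Rightarrow> ennreal) set"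
    using that by (intro cvx_generator_generator cvx_generator_addS PCE_cvx_generator)
  have comb_em: "comb s (em A) = em (elt x (addS (c s) A))" if "A \<in> PCE x" for s A
    unfolding comb_def using cP that by (rule padd_em)
  have comb_bad: "comb s A = {}" if "A \<notin> PC x" for s A
    unfolding comb_def using that by (rule padd_nonPC)
  have absorb: "elt x (addS A (elt x (addS B C))) = elt x (addS A (addS B C))"
    if "A \<in> PCE x" "B \<in> PCE x" "C \<in> PCE x" for A B C :: "('s \<Rightarrow> ennreal) set"
    using elt_cong[OF addS_elt[OF PCE_generator[OF that(1)] ga[OF that(2,3)]]] elt_PCE_ident[OF that(1)] by simp
  \<comment> \<open>Inside the cone this is commutativity of addition up to generated elements.
    Outside it, both orders give {}, since {} is again outside the cone.\<close>
  interpret comp_fun_commute comb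
  proof
    fix s t
    show "comb t \<circ> comb s = comb s \<circ> comb t"
    proof
      fix A
      show "(comb t \<circ> comb s) A = (comb s \<circ> comb t) A"
      proof (cases "A \<in> PC x")
        case True
        then obtain B where B: "B \<in> PCE x" "A = em B" by (rule PC_E)
        have P: "elt x (addS (c s) B) \<in> PCE x" for s by (intro elt_PCE ga cP B)
        show ?thesis unfolding B(2)
          by (simp add: comb_em B(1) P absorb cP addS_left_commute)
      qed (simp add: comb_bad empty_notin_PC)
    qed
  qed
  have eq: "psum x (\<lambda>t. em (f t)) (val v) = Finite_Set.fold comb (pzero x) {s. v s \<noteq> 0}"
    unfolding psum_def comb_def c_def by (simp add: val_def pscale_em[OF f])
  have fold: "Finite_Set.fold comb (pzero x) T = em (elt x (klS f {\<lambda>t. if t \<in> T then v t else 0}))"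
    if "finite T" for T
    using that
  proof (induction T)
    case empty
    have "klS f {\<lambda>t. 0} = {\<lambda>s. 0}"
    proof -
      have "\<forall>t. \<exists>a. a \<in> f t" using generator_ne[OF PCE_generator[OF f]] by (simp add: ex_in_conv)
      then have "\<exists>g. \<forall>t. g t \<in> f t" by (rule choice)
      then show ?thesis by (auto simp: klS_def)
    qed
    moreover have "pzero x = em (elt x {\<lambda>s :: 's. 0})"
    proof -
      have "{vzero} = em {\<lambda>s :: 's. 0}" by (auto simp: em_def vzero_def val_def)
      then show ?thesis unfolding pzero_def by (simp only: basic_em hullE_ident[OF cvx_singleton])
    qed
    ultimately show ?case by simp
  next
    case (insert s T)
    have gk: "generator x (klS f {\<lambda>t. if t \<in> T then v t else 0})" by (intro generator_klS cvx_generator_singleton PCE_cvx_generator[OF f])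
    have "Finite_Set.fold comb (pzero x) (insert s T) = comb s (em (elt x (klS f {\<lambda>t. if t \<in> T then v t else 0})))"
      using insert by simp
    also have "\<dots> = em (elt x (addS (c s) (elt x (klS f {\<lambda>t. if t \<in> T then v t else 0}))))"
      by (intro comb_em elt_PCE gk)
    also have "elt x (addS (c s) (elt x (klS f {\<lambda>t. if t \<in> T then v t else 0}))) =
      elt x (addS (scaleS (enn2real (v s)) (f s)) (klS f {\<lambda>t. if t \<in> T then v t else 0}))"
      unfolding c_def by (intro elt_cong addS_elt gs gk)
    also have "addS (scaleS (enn2real (v s)) (f s)) (klS f {\<lambda>t. if t \<in> T then v t else 0}) =
      klS f {\<lambda>t. if t \<in> insert s T then v t else 0}"
      using insert v PCE_generator[OF f] generator_ne by (intro klS_insert) (auto simp: simple_fn_def less_top)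
    finally show ?case .
  qed
  have "(\<lambda>t. if t \<in> {s. v s \<noteq> 0} then v t else 0) = v" by auto
  then show ?thesis unfolding eq using fold[of "{s. v s \<noteq> 0}"] v by (simp add: simple_fn_def)
qed

lemma joinS_hullE:
  "cvx A \<Longrightarrow> cvx B \<Longrightarrow> A \<noteq> {} \<Longrightarrow> B \<noteq> {} \<Longrightarrow> joinS A B = hullE (A \<union> B)"
  by (simp add: joinS_def hullE_Un hullE_ident)

lemma hullE_hullE_Un: "hullE (A \<union> hullE B) = hullE (A \<union> B)"
proof
  show "hullE (A \<union> hullE B) \<subseteq> hullE (A \<union> B)"
    using hullE_inc[of "A \<union> B"] hullE_mono[of B "A \<union> B"] by (intro hullE_min cvx_hullE) auto
  show "hullE (A \<union> B) \<subseteq> hullE (A \<union> hullE B)" using hullE_inc[of B] by (intro hullE_mono) auto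
qed

text \<open>The fold starts from an arbitrarily chosen member and meets the same member again; the
  hull of a union absorbs the repetition.\<close>

lemma pbig_em:
  assumes C: "finite \<C>" "\<C> \<noteq> {}" "\<C> \<subseteq> PCE x"
  shows "pbig x (em ` \<C>) = em (elt x (hullE (\<Union>\<C>)))"
proof -
  have nicejoin: "cvx_generator (hullE (A \<union> \<Union>\<D>))" if "finite \<D>" "\<D> \<subseteq> PCE x" "A \<in> PCE x"
    for A and \<D> :: "('a \<Rightarrow> ennreal) set set"
    using that
  proof (induction \<D>)
    case empty
    then have "cvx_generator A" by (intro PCE_cvx_generator)
    then show ?case by (simp add: hullE_ident cvx_generator_def)
  next
    case (insert B \<D>)
    have n: "cvx_generator B" "cvx_generator (hullE (A \<union> \<Union>\<D>))" using insert PCE_cvx_generator by auto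
    then have "joinS B (hullE (A \<union> \<Union>\<D>)) = hullE (B \<union> (A \<union> \<Union>\<D>))"
      by (simp add: joinS_hullE cvx_generator_def hullE_hullE_Un)
    also have "B \<union> (A \<union> \<Union>\<D>) = A \<union> \<Union>(insert B \<D>)" by auto
    finally show ?case using cvx_generator_joinS[OF n] by simp
  qed
  have gj: "generator x (joinS A B)" if "A \<in> PCE x" "B \<in> PCE x" for A B :: "('a \<Rightarrow> ennreal) set"
    using that by (intro cvx_generator_generator cvx_generator_joinS PCE_cvx_generator)
  have absorb: "elt x (joinS A (elt x X)) = elt x (joinS A X)" if "A \<in> PCE x" "generator x X" for A X :: "('a \<Rightarrow> ennreal) set"
    using elt_cong[OF joinS_elt[OF PCE_generator[OF that(1)] that(2)]] elt_PCE_ident[OF that(1)] by simp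
  have pj: "punion x (em A) (em (elt x X)) = em (elt x (joinS A X))" if "A \<in> PCE x" "generator x X" for A X :: "('a \<Rightarrow> ennreal) set"
    using punion_em[OF that(1) elt_PCE[OF that(2)]] absorb[OF that] by simp
  have jc: "joinS A (joinS B X) = joinS B (joinS A X)" if "A \<in> PCE x" "B \<in> PCE x" "X \<in> PCE x" for A B X :: "('a \<Rightarrow> ennreal) set"
  proof -
    have n: "cvx_generator A" "cvx_generator B" "cvx_generator X" using that PCE_cvx_generator by auto
    have "joinS A (joinS B X) = hullE (A \<union> (B \<union> X))" if "cvx_generator A" "cvx_generator B" for A B :: "('a \<Rightarrow> ennreal) set"
    proof -
      have BX: "joinS B X = hullE (B \<union> X)" using that n(3) by (simp add: joinS_hullE cvx_generator_def)
      have "joinS A (joinS B X) = hullE (A \<union> joinS B X)"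
        using cvx_generator_joinS[OF that(2) n(3)] that by (simp add: joinS_hullE cvx_generator_def)
      then show ?thesis unfolding BX by (simp add: hullE_hullE_Un)
    qed
    then show ?thesis using n by (simp add: Un_left_commute)
  qed
  have comm: "comp_fun_commute_on (em ` PCE x) (punion x :: 'a val set \<Rightarrow> _)"
  proof
    fix A B :: "'a val set" assume AB: "A \<in> em ` PCE x" "B \<in> em ` PCE x"
    then obtain A' B' where A': "A' \<in> PCE x" "A = em A'" "B' \<in> PCE x" "B = em B'" by auto
    show "punion x B \<circ> punion x A = punion x A \<circ> punion x B"
    proof
      fix Z
      show "(punion x B \<circ> punion x A) Z = (punion x A \<circ> punion x B) Z"
      proof (cases "Z \<in> PC x")
        case True
        then obtain Z' where Z': "Z' \<in> PCE x" "Z = em Z'" by (rule PC_E)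
        then show ?thesis using A' by (simp add: punion_em pj gj jc)
      next
        case False
        then show ?thesis by (simp add: punion_nonPC empty_notin_PC)
      qed
    qed
  qed
  obtain A0 where A0: "A0 \<in> \<C>" "(SOME A. A \<in> em ` \<C>) = em A0"
    using someI_ex[of "\<lambda>A. A \<in> em ` \<C>"] C(2) by auto
  then have A0P: "A0 \<in> PCE x" using C(3) by auto
  have fold: "Finite_Set.fold (punion x) (em A0) (em ` \<D>) = em (elt x (hullE (A0 \<union> \<Union>\<D>)))"
    if "finite \<D>" "\<D> \<subseteq> PCE x" for \<D>
    using that
  proof (induction \<D>)
    case empty
    then show ?case using A0P PCE_cvx_generator[OF A0P] by (simp add: hullE_ident cvx_generator_def elt_PCE_ident)
  next
    case (insert B \<D>)
    then have B: "B \<in> PCE x" and n: "cvx_generator (hullE (A0 \<union> \<Union>\<D>))" using nicejoin A0P by auto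
    have "Finite_Set.fold (punion x) (em A0) (em ` insert B \<D>) =
      punion x (em B) (Finite_Set.fold (punion x) (em A0) (em ` \<D>))"
      using insert by (simp add: comp_fun_commute_on.fold_insert[OF comm] image_iff image_mono)
    also have "\<dots> = em (elt x (joinS B (hullE (A0 \<union> \<Union>\<D>))))"
      using insert n B by (simp add: pj cvx_generator_generator)
    also have "joinS B (hullE (A0 \<union> \<Union>\<D>)) = hullE (B \<union> (A0 \<union> \<Union>\<D>))"
      using n PCE_cvx_generator[OF B] by (simp add: joinS_hullE cvx_generator_def hullE_hullE_Un)
    also have "B \<union> (A0 \<union> \<Union>\<D>) = A0 \<union> \<Union>(insert B \<D>)" by auto
    finally show ?case .
  qed
  have "A0 \<union> \<Union>\<C> = \<Union>\<C>" using A0(1) by auto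
  then show ?thesis unfolding pbig_def A0(2) using fold[OF C(1,3)] by simp
qed

lemma kleisli_em:
  fixes f :: "'s \<Rightarrow> ('s \<Rightarrow> ennreal) set"
  assumes f: "\<And>t. f t \<in> PCE x" and A: "A \<in> PCE x"
  shows "kleisli x (\<lambda>t. em (f t)) (em A) = em (elt x (klS f A))"
proof -
  have fn: "cvx_generator (f t)" for t by (rule PCE_cvx_generator[OF f])
  have fam: "(\<lambda>j. if j \<in> {None} then A else case_option {} f j) = case_option A f" for A
    by (auto simp: fun_eq_iff split: option.split)
  have "econt x (\<lambda>A. elt x (Op {0} kl_op (\<lambda>j. if j \<in> {None} then A else case_option {} f j)))"
  proof (rule econt_Op[OF jcont_kl_op])
    show "generator x (case_option {} f j)" if "j \<notin> {None}" for j
      using that PCE_generator[OF f] by (cases j) auto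
    show "generator x (Op {0} kl_op (\<lambda>j. if j \<in> {None} then A else case_option {} f j))" if "A \<in> PCE x" for A
      unfolding fam klS_Op[symmetric] using that by (intro generator_klS PCE_cvx_generator fn)
  qed simp
  then have c: "econt x (\<lambda>A. elt x (klS f A))" by (simp only: fam klS_Op)
  have "kleisli x (\<lambda>t. em (f t)) = lift1 x (\<lambda>A. elt x (klS f A))"
    unfolding kleisli_def
  proof (rule the_pc_cont[OF pc_cont_lift1[OF c]])
    fix F :: "'s val set" assume "basicF F"
    then obtain G where G: "F = em G" "finite G" "G \<noteq> {}" "\<forall>g\<in>G. simple_fn g" by (auto simp: basicF_iff)
    have g: "generator x (hullE G)" using G by (intro generator_hullE)
    have g1: "generator x (klS f {v})" for v by (intro generator_klS cvx_generator_singleton fn)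
    have ps: "psum x (\<lambda>t. em (f t)) ` F = em ` (\<lambda>v. elt x (klS f {v})) ` G"
      unfolding G(1) em_def[of G] image_image using G(4) by (intro image_cong refl psum_em f) auto
    then have "pbig x (psum x (\<lambda>t. em (f t)) ` F) = em (elt x (hullE (\<Union>v\<in>G. elt x (klS f {v}))))"
    proof -
      have "(\<lambda>v. elt x (klS f {v})) ` G \<subseteq> PCE x" using elt_PCE[OF g1] by auto
      then show ?thesis using pbig_em[of "(\<lambda>v. elt x (klS f {v})) ` G" x] G(2,3)
        unfolding ps by simp
    qed
    also have "elt x (hullE (\<Union>v\<in>G. elt x (klS f {v}))) = elt x (klS f (hullE G))"
    proof (rule elt_cong)
      \<comment> \<open>The images of single valuations are first stripped of their closures under
        the hull, after which \<open>klS_hullE_peq\<close> applies.\<close>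
      have "peq x (hullE (\<Union>v\<in>G. elt x (klS f {v}))) (hullE (\<Union>v\<in>G. klS f {v}))"
        unfolding peq_def by (intro conjI ple_hullE_UN ple_elt elt_ple g1)
      then show "peq x (hullE (\<Union>v\<in>G. elt x (klS f {v}))) (klS f (hullE G))"
        using klS_hullE_peq[OF G(2,3) fn] by (rule peq_trans)
    qed
    also have "\<dots> = elt x (klS f (elt x (hullE G)))"
      using fn by (intro elt_cong peq_sym[OF klS_elt] g) (auto simp: cvx_generator_def)
    finally show "lift1 x (\<lambda>A. elt x (klS f A)) (basic x F) = pbig x (psum x (\<lambda>t. em (f t)) ` F)"
      by (simp add: G(1) basic_em elt_PCE[OF g])
  qed
  then show ?thesis using A by simp
qed

subsection \<open>Egli-Milner domination\<close>

text \<open>The relation involves no topological closure and does not depend on the kind of cone; by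
  \<open>EM_ple\<close> it implies the order in all three.\<close>

definition EM :: "('s \<Rightarrow> ennreal) set \<Rightarrow> ('s \<Rightarrow> ennreal) set \<Rightarrow> bool" where
  "EM X Y \<longleftrightarrow> X \<subseteq> dnE Y \<and> Y \<subseteq> upE X"

lemma EM_refl [simp]: "EM X X" using subset_dnE subset_upE by (auto simp: EM_def)

lemma EM_trans: "EM X Y \<Longrightarrow> EM Y Z \<Longrightarrow> EM X Z"
  unfolding EM_def using dnE_mono[of Y "dnE Z"] upE_mono[of Y "upE X"] by auto

lemma EM_ple: "EM X Y \<Longrightarrow> ple x X Y"
proof -
  assume E: "EM X Y"
  have "dnE Y \<subseteq> scl Y" using dnE_mono[OF subset_scl[of Y]] by simp
  then have "X \<subseteq> scl Y" using E by (auto simp: EM_def)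
  then show ?thesis using E upE_mono[of Y "upE X"] by (auto simp: ple_def scl_subset_iff EM_def)
qed

lemma EM_zero: "Y \<noteq> {} \<Longrightarrow> EM {\<lambda>_. 0} Y"
  by (auto simp: EM_def dnE_def upE_def le_fun_def)

lemma EM_UN: "(\<And>i. i \<in> I \<Longrightarrow> EM (X i) (Y i)) \<Longrightarrow> EM (\<Union>i\<in>I. X i) (\<Union>i\<in>I. Y i)"
  unfolding EM_def dnE_def upE_def by fast

lemma cvx_dnE:
  assumes "\<And>a b p. a \<in> X \<Longrightarrow> b \<in> X \<Longrightarrow> 0 \<le> p \<Longrightarrow> p \<le> 1 \<Longrightarrow> mixv p a b \<in> dnE X"
  shows "cvx (dnE X)"
  unfolding cvx_def
proof (intro ballI allI impI)
  fix a b p assume "a \<in> dnE X" "b \<in> dnE X" "0 \<le> p \<and> p \<le> (1::real)"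
  then obtain a' b' where "a' \<in> X" "b' \<in> X" "a \<le> a'" "b \<le> b'" by (auto simp: dnE_def)
  then have "mixv p a' b' \<in> dnE X" "mixv p a b \<le> mixv p a' b'"
    using assms \<open>0 \<le> p \<and> p \<le> 1\<close> by (auto intro: mixv_mono)
  then show "mixv p a b \<in> dnE X" by (auto simp: dnE_def intro: order_trans)
qed

lemma cvx_dnE_cvx: "cvx X \<Longrightarrow> cvx (dnE X)"
  using subset_dnE[of X] by (intro cvx_dnE) (auto dest: cvxD)

lemma cvx_upE_cvx: "cvx X \<Longrightarrow> cvx (upE X)"
  using subset_upE[of X] by (intro cvx_upE) (auto dest: cvxD)

lemma EM_hullE:
  assumes "EM X Y" shows "EM (hullE X) (hullE Y)"
  unfolding EM_def
proof
  have "X \<subseteq> dnE (hullE Y)" using assms dnE_mono[OF hullE_inc[of Y]] by (auto simp: EM_def)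
  then show "hullE X \<subseteq> dnE (hullE Y)" by (intro hullE_min cvx_dnE_cvx cvx_hullE)
  have "Y \<subseteq> upE (hullE X)" using assms upE_mono[OF hullE_inc[of X]] by (auto simp: EM_def)
  then show "hullE Y \<subseteq> upE (hullE X)" by (intro hullE_min cvx_upE_cvx cvx_hullE)
qed

text \<open>Dominating valuations and dominating selected values are chosen independently, and
  integration is monotone in both.\<close>

lemma EM_klS:
  assumes f: "\<And>t. EM (f t) (f' t)" and A: "EM A A'"
  shows "EM (klS f A) (klS f' A')"
  unfolding EM_def
proof
  show "klS f A \<subseteq> dnE (klS f' A')"
  proof
    fix z assume "z \<in> klS f A"
    then obtain v g where z: "z = (\<lambda>s. \<Sum>\<^sub>\<infinity>t. v t * g t s)" "v \<in> A" "\<And>t. g t \<in> f t" by (auto simp: klS_def)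
    have "\<exists>v'\<in>A'. v \<le> v'" using A z(2) by (auto simp: EM_def dnE_def)
    then obtain v' where v': "v' \<in> A'" "v \<le> v'" by blast
    have "\<forall>t. \<exists>h. h \<in> f' t \<and> g t \<le> h" using f z(3) unfolding EM_def dnE_def by blast
    then obtain g' where g': "\<And>t. g' t \<in> f' t" "\<And>t. g t \<le> g' t" by metis
    have "(\<lambda>s. \<Sum>\<^sub>\<infinity>t. v' t * g' t s) \<in> klS f' A'" using v'(1) g'(1) by (auto simp: klS_def)
    moreover have "z \<le> (\<lambda>s. \<Sum>\<^sub>\<infinity>t. v' t * g' t s)" unfolding z(1)
      by (intro le_funI ennreal_infsum_mono mult_mono) (use v' g' in \<open>auto simp: le_fun_def\<close>)
    ultimately show "z \<in> dnE (klS f' A')" by (auto simp: dnE_def)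
  qed
  show "klS f' A' \<subseteq> upE (klS f A)"
  proof
    fix z assume "z \<in> klS f' A'"
    then obtain v g where z: "z = (\<lambda>s. \<Sum>\<^sub>\<infinity>t. v t * g t s)" "v \<in> A'" "\<And>t. g t \<in> f' t" by (auto simp: klS_def)
    have "\<exists>v'\<in>A. v' \<le> v" using A z(2) by (auto simp: EM_def upE_def)
    then obtain v' where v': "v' \<in> A" "v' \<le> v" by blast
    have "\<forall>t. \<exists>h. h \<in> f t \<and> h \<le> g t" using f z(3) unfolding EM_def upE_def by blast
    then obtain g' where g': "\<And>t. g' t \<in> f t" "\<And>t. g' t \<le> g t" by metis
    have "(\<lambda>s. \<Sum>\<^sub>\<infinity>t. v' t * g' t s) \<in> klS f A" using v'(1) g'(1) by (auto simp: klS_def)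
    moreover have "(\<lambda>s. \<Sum>\<^sub>\<infinity>t. v' t * g' t s) \<le> z" unfolding z(1)
      by (intro le_funI ennreal_infsum_mono mult_mono) (use v' g' in \<open>auto simp: le_fun_def\<close>)
    ultimately show "z \<in> upE (klS f A)" by (auto simp: upE_def)
  qed
qed

text \<open>Kleisli images of hulls may fail to be convex, so equality is replaced by domination in
  both directions; the bounds of \<open>klS_mix_bounds\<close> make the lower and upper closures
  convex.\<close>

lemma EM_klS_hullE:
  assumes f: "\<And>t. cvx (f t)"
  shows "EM (klS f (hullE X)) (hullE (klS f X))" "EM (hullE (klS f X)) (klS f (hullE X))"
proof -
  have 1: "klS f (hullE X) \<subseteq> hullE (klS f X)" using klS_hullE[of f X] klS_UN[of f X] by simp
  have 2: "klS f X \<subseteq> klS f (hullE X)" by (intro klS_mono hullE_inc)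
  have bounds: "(\<exists>l\<in>klS f (hullE X). l \<le> mixv p a b) \<and> (\<exists>h\<in>klS f (hullE X). mixv p a b \<le> h)"
    if "a \<in> klS f (hullE X)" "b \<in> klS f (hullE X)" "0 \<le> p" "p \<le> 1" for a b p
    using klS_mix_bounds[OF cvx_hullE f that] .
  have up: "hullE (klS f X) \<subseteq> upE (klS f (hullE X))"
  proof (rule hullE_min)
    show "klS f X \<subseteq> upE (klS f (hullE X))" using 2 subset_upE[of "klS f (hullE X)"] by blast
    show "cvx (upE (klS f (hullE X)))" by (rule cvx_upE) (use bounds in \<open>auto simp: upE_def\<close>)
  qed
  have dn: "hullE (klS f X) \<subseteq> dnE (klS f (hullE X))"
  proof (rule hullE_min)
    show "klS f X \<subseteq> dnE (klS f (hullE X))" using 2 subset_dnE[of "klS f (hullE X)"] by blast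
    show "cvx (dnE (klS f (hullE X)))" by (rule cvx_dnE) (use bounds in \<open>auto simp: dnE_def\<close>)
  qed
  show "EM (klS f (hullE X)) (hullE (klS f X))" "EM (hullE (klS f X)) (klS f (hullE X))"
    using 1 up dn subset_upE[of "hullE (klS f X)"] subset_dnE[of "hullE (klS f X)"] by (auto simp: EM_def)
qed

subsection \<open>Finite mixtures\<close>

text \<open>Selections are total, although values where \<open>\<mu>\<close> vanishes do not matter.\<close>

definition Gen :: "('z \<Rightarrow> real) \<Rightarrow> ('z \<Rightarrow> ('s \<Rightarrow> ennreal) set) \<Rightarrow> ('s \<Rightarrow> ennreal) set" where
  "Gen \<mu> V = {\<lambda>i. \<Sum>z\<in>{z. \<mu> z \<noteq> 0}. ennreal (\<mu> z) * k z i | k. \<forall>z. k z \<in> V z}"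

lemma GenI: "(\<And>z. k z \<in> V z) \<Longrightarrow> (\<lambda>i. \<Sum>z\<in>{z. \<mu> z \<noteq> 0}. ennreal (\<mu> z) * k z i) \<in> Gen \<mu> V"
  by (auto simp: Gen_def)

lemma Gen_ne: "(\<And>z. V z \<noteq> {}) \<Longrightarrow> Gen \<mu> V \<noteq> {}"
proof -
  assume "\<And>z. V z \<noteq> {}"
  then have "\<forall>z. \<exists>a. a \<in> V z" by (simp add: ex_in_conv)
  then obtain k where "\<And>z. k z \<in> V z" by metis
  then have "(\<lambda>i. \<Sum>z\<in>{z. \<mu> z \<noteq> 0}. ennreal (\<mu> z) * k z i) \<in> Gen \<mu> V" by (rule GenI)
  then show ?thesis by blast
qed

lemma Gen_cong:
  assumes "\<And>z. V z \<noteq> {}" "\<And>z. V' z \<noteq> {}" "\<And>z. \<mu> z \<noteq> 0 \<Longrightarrow> V z = V' z"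
  shows "Gen \<mu> V = Gen \<mu> V'"
proof -
  have "Gen \<mu> V \<subseteq> Gen \<mu> V'" if "\<And>z. V' z \<noteq> {}" "\<And>z. \<mu> z \<noteq> 0 \<Longrightarrow> V z = V' z" for V V' :: "'a \<Rightarrow> ('b \<Rightarrow> ennreal) set"
  proof
    fix x assume "x \<in> Gen \<mu> V"
    then obtain k where k: "x = (\<lambda>i. \<Sum>z\<in>{z. \<mu> z \<noteq> 0}. ennreal (\<mu> z) * k z i)" "\<And>z. k z \<in> V z"
      by (auto simp: Gen_def)
    define k' where "k' z = (if \<mu> z = 0 then SOME a. a \<in> V' z else k z)" for z
    have "k' z \<in> V' z" for z using that k(2)[of z] some_in_eq[of "V' z"] by (auto simp: k'_def)
    moreover have "x = (\<lambda>i. \<Sum>z\<in>{z. \<mu> z \<noteq> 0}. ennreal (\<mu> z) * k' z i)"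
      unfolding k(1) by (intro ext sum.cong) (auto simp: k'_def)
    ultimately show "x \<in> Gen \<mu> V'" by (auto simp: Gen_def)
  qed
  from this[of V' V] this[of V V'] show ?thesis using assms by auto
qed

lemma Gen_EM:
  assumes ne: "\<And>z. V z \<noteq> {}" "\<And>z. V' z \<noteq> {}" and em: "\<And>z. \<mu> z \<noteq> 0 \<Longrightarrow> EM (V z) (V' z)"
  shows "EM (Gen \<mu> V) (Gen \<mu> V')"
proof -
  \<comment> \<open>Domination is known only on the support of \<open>\<mu>\<close>; off the support
    the target is replaced by \<open>V\<close>, which does not change the set of mixtures.\<close>
  define W where "W z = (if \<mu> z = 0 then V z else V' z)" for z
  have "Gen \<mu> V' = Gen \<mu> W" using ne by (intro Gen_cong) (auto simp: W_def)
  have em': "EM (V z) (W z)" for z using em by (simp add: W_def)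
  have mono: "(\<lambda>i. \<Sum>z\<in>{z. \<mu> z \<noteq> 0}. ennreal (\<mu> z) * k z i) \<le> (\<lambda>i. \<Sum>z\<in>{z. \<mu> z \<noteq> 0}. ennreal (\<mu> z) * k' z i)"
    if "\<And>z. k z \<le> k' z" for k k' :: "'a \<Rightarrow> 'b \<Rightarrow> ennreal"
    using that by (intro le_funI sum_mono mult_left_mono) (auto simp: le_fun_def)
  have "EM (Gen \<mu> V) (Gen \<mu> W)" unfolding EM_def
  proof
    show "Gen \<mu> V \<subseteq> dnE (Gen \<mu> W)"
    proof
      fix x assume "x \<in> Gen \<mu> V"
      then obtain k where k: "x = (\<lambda>i. \<Sum>z\<in>{z. \<mu> z \<noteq> 0}. ennreal (\<mu> z) * k z i)" "\<And>z. k z \<in> V z"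
        by (auto simp: Gen_def)
      have "\<forall>z. \<exists>h. h \<in> W z \<and> k z \<le> h" using em' k(2) unfolding EM_def dnE_def by blast
      then obtain k' where "\<And>z. k' z \<in> W z" "\<And>z. k z \<le> k' z" by metis
      then show "x \<in> dnE (Gen \<mu> W)" using mono[of k k'] GenI[of k' W \<mu>] unfolding k(1) dnE_def by blast
    qed
    show "Gen \<mu> W \<subseteq> upE (Gen \<mu> V)"
    proof
      fix x assume "x \<in> Gen \<mu> W"
      then obtain k where k: "x = (\<lambda>i. \<Sum>z\<in>{z. \<mu> z \<noteq> 0}. ennreal (\<mu> z) * k z i)" "\<And>z. k z \<in> W z"
        by (auto simp: Gen_def)
      have "\<forall>z. \<exists>h. h \<in> V z \<and> h \<le> k z" using em' k(2) unfolding EM_def upE_def by blast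
      then obtain k' where "\<And>z. k' z \<in> V z" "\<And>z. k' z \<le> k z" by metis
      then show "x \<in> upE (Gen \<mu> V)" using mono[of k' k] GenI[of k' V \<mu>] unfolding k(1) upE_def by blast
    qed
  qed
  then show ?thesis using \<open>Gen \<mu> V' = Gen \<mu> W\<close> by simp
qed

lemma cvx_Gen:
  assumes V: "\<And>z. cvx (V z)" shows "cvx (Gen \<mu> V)"
  unfolding cvx_def
proof (intro ballI allI impI)
  fix x y p assume "x \<in> Gen \<mu> V" "y \<in> Gen \<mu> V" and p: "0 \<le> p \<and> p \<le> (1::real)"
  then obtain k l where *: "x = (\<lambda>i. \<Sum>z\<in>{z. \<mu> z \<noteq> 0}. ennreal (\<mu> z) * k z i)" "\<And>z. k z \<in> V z"
    "y = (\<lambda>i. \<Sum>z\<in>{z. \<mu> z \<noteq> 0}. ennreal (\<mu> z) * l z i)" "\<And>z. l z \<in> V z" by (auto simp: Gen_def)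
  have "mixv p x y = (\<lambda>i. \<Sum>z\<in>{z. \<mu> z \<noteq> 0}. ennreal (\<mu> z) * mixv p (k z) (l z) i)"
    by (simp add: mixv_def * sum_distrib_left distrib_left sum.distrib mult.left_commute)
  moreover have "mixv p (k z) (l z) \<in> V z" for z using V * p by (intro cvxD) auto
  ultimately show "mixv p x y \<in> Gen \<mu> V" by (auto simp: Gen_def)
qed

lemma cvx_affine_vimage: "cvx A \<Longrightarrow> cvx {b. (\<lambda>s. a s + c * b s) \<in> A}"
  unfolding cvx_def
proof (intro ballI allI impI)
  fix b b' p assume A: "\<forall>a\<in>A. \<forall>b\<in>A. \<forall>p. 0 \<le> p \<and> p \<le> 1 \<longrightarrow> mixv p a b \<in> A"
    and b: "b \<in> {b. (\<lambda>s. a s + c * b s) \<in> A}" "b' \<in> {b. (\<lambda>s. a s + c * b s) \<in> A}" and p: "0 \<le> p \<and> p \<le> (1::real)"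
  have "mixv p (\<lambda>s. a s + c * b s) (\<lambda>s. a s + c * b' s) \<in> A" using A b p by blast
  also have "mixv p (\<lambda>s. a s + c * b s) (\<lambda>s. a s + c * b' s) =
    (\<lambda>s. mixv p a a s + mixv p (\<lambda>s. c * b s) (\<lambda>s. c * b' s) s)" using p by (simp add: mixv_add)
  also have "\<dots> = (\<lambda>s. a s + c * mixv p b b' s)"
    using p by (simp add: mixv_same) (simp add: mixv_def distrib_left mult.left_commute)
  finally show "mixv p b b' \<in> {b. (\<lambda>s. a s + c * b s) \<in> A}" by simp
qed

text \<open>A mixture is affine in each selected value separately, so the positions of the support
  can be convexified one at a time; \<open>T\<close> holds the positions already treated.\<close>

lemma Gen_hullE:
  assumes fin: "finite {z. \<mu> z \<noteq> 0}" and ne: "\<And>z. V z \<noteq> {}"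
  shows "Gen \<mu> (\<lambda>z. hullE (V z)) = hullE (Gen \<mu> V)"
proof
  let ?S = "{z. \<mu> z \<noteq> 0}"
  have *: "\<forall>k. (\<forall>z. k z \<in> (if z \<in> T then hullE (V z) else V z)) \<longrightarrow>
      (\<lambda>i. \<Sum>z\<in>?S. ennreal (\<mu> z) * k z i) \<in> hullE (Gen \<mu> V)" if "finite T" "T \<subseteq> ?S" for T
    using that
  proof (induction T)
    case empty
    then show ?case using hullE_inc[of "Gen \<mu> V"] by (auto simp: Gen_def)
  next
    case (insert y T)
    show ?case
    proof (intro allI impI)
      fix k assume k: "\<forall>z. k z \<in> (if z \<in> insert y T then hullE (V z) else V z)"
      define a where "a i = (\<Sum>z\<in>?S - {y}. ennreal (\<mu> z) * k z i)" for i
      have split: "(\<Sum>z\<in>?S. ennreal (\<mu> z) * (k(y := b)) z i) = a i + ennreal (\<mu> y) * b i" for b i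
        unfolding a_def using fin insert.prems
        by (subst sum.remove[of _ y]) (auto simp: add.commute intro!: sum.cong)
      have "hullE (V y) \<subseteq> {b. (\<lambda>i. a i + ennreal (\<mu> y) * b i) \<in> hullE (Gen \<mu> V)}"
      proof (rule hullE_min)
        show "V y \<subseteq> {b. (\<lambda>i. a i + ennreal (\<mu> y) * b i) \<in> hullE (Gen \<mu> V)}"
        proof
          fix b assume b: "b \<in> V y"
          have "(k(y := b)) z \<in> (if z \<in> T then hullE (V z) else V z)" for z
            using k[rule_format, of z] b insert.hyps by auto
          then have "(\<lambda>i. \<Sum>z\<in>?S. ennreal (\<mu> z) * (k(y := b)) z i) \<in> hullE (Gen \<mu> V)"
            using insert.IH insert.prems by blast
          then show "b \<in> {b. (\<lambda>i. a i + ennreal (\<mu> y) * b i) \<in> hullE (Gen \<mu> V)}" by (simp only: split mem_Collect_eq)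
        qed
      qed (intro cvx_affine_vimage cvx_hullE)
      moreover have "k y \<in> hullE (V y)" using k[rule_format, of y] by simp
      ultimately have "(\<lambda>i. a i + ennreal (\<mu> y) * k y i) \<in> hullE (Gen \<mu> V)" by blast
      then show "(\<lambda>i. \<Sum>z\<in>?S. ennreal (\<mu> z) * k z i) \<in> hullE (Gen \<mu> V)"
        using split[of "k y"] by simp
    qed
  qed
  have "Gen \<mu> (\<lambda>z. hullE (V z)) = Gen \<mu> (\<lambda>z. if z \<in> ?S then hullE (V z) else V z)"
    using ne by (intro Gen_cong) auto
  then show "Gen \<mu> (\<lambda>z. hullE (V z)) \<subseteq> hullE (Gen \<mu> V)"
    using *[OF fin] by (auto simp: Gen_def)
  have "Gen \<mu> V \<subseteq> Gen \<mu> (\<lambda>z. hullE (V z))" using hullE_inc[of "V _"] by (fastforce simp: Gen_def)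
  then show "hullE (Gen \<mu> V) \<subseteq> Gen \<mu> (\<lambda>z. hullE (V z))" by (intro hullE_min cvx_Gen cvx_hullE)
qed

lemma convex_sum:
  assumes A: "cvx A" "A \<noteq> {}" and S: "finite S" and u: "\<And>z. z \<in> S \<Longrightarrow> 0 \<le> u z" "\<And>z. z \<in> S \<Longrightarrow> a z \<in> A"
  shows "\<exists>b\<in>A. \<forall>i. (\<Sum>z\<in>S. ennreal (u z) * a z i) = ennreal (\<Sum>z\<in>S. u z) * b i"
  using S u
proof (induction S)
  case empty then show ?case using A by auto
next
  case (insert y S)
  then obtain b where b: "b \<in> A" "\<forall>i. (\<Sum>z\<in>S. ennreal (u z) * a z i) = ennreal (\<Sum>z\<in>S. u z) * b i" by auto
  have "0 \<le> (\<Sum>z\<in>S. u z)" using insert.prems by (intro sum_nonneg) auto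
  then obtain c where "c \<in> A" "\<forall>i. ennreal (u y) * a y i + ennreal (\<Sum>z\<in>S. u z) * b i = ennreal (u y + (\<Sum>z\<in>S. u z)) * c i"
    using mixv_scaled[of "u y" "\<Sum>z\<in>S. u z" _ b A "a y" b] A b(1) insert.prems by auto
  then show ?case using insert.hyps b(2) by (intro bexI[of _ c]) simp_all
qed

lemma infsum_sum_ennreal:
  "finite S \<Longrightarrow> (\<Sum>\<^sub>\<infinity>t. \<Sum>z\<in>S. (h z t :: ennreal)) = (\<Sum>z\<in>S. \<Sum>\<^sub>\<infinity>t. h z t)"
  by (induction S rule: finite_induct) (simp_all add: infsum_add)

text \<open>Different outcomes \<open>z\<close> may bring different selections at the same state
  \<open>t\<close>. Their weights are finite because the valuations are simple, so convexity of
  \<open>f t\<close> merges the selections into one, and equality holds.\<close>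

lemma klS_Gen:
  fixes V :: "'z \<Rightarrow> ('s \<Rightarrow> ennreal) set"
  assumes fin: "finite {z. \<mu> z \<noteq> 0}" and pos: "\<And>z. 0 \<le> \<mu> z"
    and f: "\<And>t. cvx (f t)" "\<And>t. f t \<noteq> {}" and V: "\<And>z v. \<mu> z \<noteq> 0 \<Longrightarrow> v \<in> V z \<Longrightarrow> simple_fn v" and ne: "\<And>z. V z \<noteq> {}"
  shows "klS f (Gen \<mu> V) = Gen \<mu> (\<lambda>z. klS f (V z))"
proof
  let ?S = "{z. \<mu> z \<noteq> 0}"
  show "klS f (Gen \<mu> V) \<subseteq> Gen \<mu> (\<lambda>z. klS f (V z))"
  proof
    fix x assume "x \<in> klS f (Gen \<mu> V)"
    then obtain k g where k: "x = (\<lambda>s. \<Sum>\<^sub>\<infinity>t. (\<Sum>z\<in>?S. ennreal (\<mu> z) * k z t) * g t s)" "\<And>z. k z \<in> V z" "\<And>t. g t \<in> f t"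
      by (auto simp: klS_def Gen_def)
    have "x = (\<lambda>s. \<Sum>z\<in>?S. ennreal (\<mu> z) * (\<Sum>\<^sub>\<infinity>t. k z t * g t s))"
      unfolding k(1) by (simp add: sum_distrib_right infsum_sum_ennreal[OF fin] mult.assoc ennreal_infsum_cmult)
    moreover have "(\<lambda>s. \<Sum>\<^sub>\<infinity>t. k z t * g t s) \<in> klS f (V z)" for z using k by (auto simp: klS_def)
    ultimately show "x \<in> Gen \<mu> (\<lambda>z. klS f (V z))" unfolding Gen_def
      by (intro CollectI exI[of _ "\<lambda>z s. \<Sum>\<^sub>\<infinity>t. k z t * g t s"]) simp
  qed
  show "Gen \<mu> (\<lambda>z. klS f (V z)) \<subseteq> klS f (Gen \<mu> V)"
  proof
    fix x assume "x \<in> Gen \<mu> (\<lambda>z. klS f (V z))"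
    then obtain k where k: "x = (\<lambda>s. \<Sum>z\<in>?S. ennreal (\<mu> z) * k z s)" "\<And>z. k z \<in> klS f (V z)"
      by (auto simp: Gen_def)
    then have "\<forall>z. \<exists>v g. k z = (\<lambda>s. \<Sum>\<^sub>\<infinity>t. v t * g t s) \<and> v \<in> V z \<and> (\<forall>t. g t \<in> f t)"
      unfolding klS_def by blast
    then obtain v g where vg: "\<And>z. k z = (\<lambda>s. \<Sum>\<^sub>\<infinity>t. v z t * g z t s)" "\<And>z. v z \<in> V z" "\<And>z t. g z t \<in> f t"
      by metis
    have "\<exists>h\<in>f t. \<forall>s. (\<Sum>z\<in>?S. ennreal (\<mu> z) * v z t * g z t s) = (\<Sum>z\<in>?S. ennreal (\<mu> z) * v z t) * h s" for t
    proof -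
      \<comment> \<open>The weight with which outcome \<open>z\<close> reaches the state
        \<open>t\<close>, as a real number.\<close>
      define u where "u z = \<mu> z * enn2real (v z t)" for z
      have u: "ennreal (u z) = ennreal (\<mu> z) * v z t" "0 \<le> u z" if "z \<in> ?S" for z
      proof -
        have "v z t \<noteq> top" using V[of z "v z"] vg(2) that by (auto simp: simple_fn_def)
        then show "ennreal (u z) = ennreal (\<mu> z) * v z t" using pos[of z]
          by (simp add: u_def ennreal_mult less_top)
        show "0 \<le> u z" using pos[of z] by (simp add: u_def)
      qed
      have "\<exists>h\<in>f t. \<forall>s. (\<Sum>z\<in>?S. ennreal (u z) * g z t s) = ennreal (\<Sum>z\<in>?S. u z) * h s"
        by (rule convex_sum[OF f(1)[of t] f(2)[of t] fin]) (use u(2) vg(3) in auto)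
      then obtain h where h: "h \<in> f t" "\<forall>s. (\<Sum>z\<in>?S. ennreal (u z) * g z t s) = ennreal (\<Sum>z\<in>?S. u z) * h s"
        by (elim bexE)
      have "ennreal (\<Sum>z\<in>?S. u z) = (\<Sum>z\<in>?S. ennreal (\<mu> z) * v z t)"
        using u by (subst sum_ennreal[symmetric]) (auto intro!: sum.cong)
      then show ?thesis using h u(1) by (intro bexI[of _ h]) auto
    qed
    then obtain h where h: "\<And>t. h t \<in> f t"
      "\<And>t s. (\<Sum>z\<in>?S. ennreal (\<mu> z) * v z t * g z t s) = (\<Sum>z\<in>?S. ennreal (\<mu> z) * v z t) * h t s" by metis
    have "x = (\<lambda>s. \<Sum>\<^sub>\<infinity>t. \<Sum>z\<in>?S. ennreal (\<mu> z) * v z t * g z t s)"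
      unfolding k(1) vg(1) by (simp add: infsum_sum_ennreal[OF fin] ennreal_infsum_cmult mult.assoc)
    also have "\<dots> = (\<lambda>s. \<Sum>\<^sub>\<infinity>t. (\<Sum>z\<in>?S. ennreal (\<mu> z) * v z t) * h t s)" by (simp only: h(2))
    finally have x: "x = \<dots>" .
    have "(\<lambda>t. \<Sum>z\<in>?S. ennreal (\<mu> z) * v z t) \<in> Gen \<mu> V" using vg(2) by (rule GenI)
    then show "x \<in> klS f (Gen \<mu> V)" unfolding x klS_def using h(1)
      by (intro CollectI exI[of _ "\<lambda>t. \<Sum>z\<in>?S. ennreal (\<mu> z) * v z t"] exI[of _ h]) simp
  qed
qed

definition delta :: "'s \<Rightarrow> 's \<Rightarrow> ennreal" where "delta s = (\<lambda>t. if t = s then 1 else 0)"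

lemma klS_delta: "(\<And>t. f t \<noteq> {}) \<Longrightarrow> klS f {delta s} = f s"
proof -
  assume ne: "\<And>t. f t \<noteq> {}"
  have "klS f {delta s} = {\<lambda>i. \<Sum>t\<in>{s}. delta s t * g t i | g. \<forall>t. g t \<in> f t}"
    by (rule klS_finite_support) (auto simp: delta_def)
  also have "\<dots> = {g s | g. \<forall>t. g t \<in> f t}" by (simp add: delta_def)
  also have "\<dots> = f s"
  proof
    have "\<forall>t. \<exists>a. a \<in> f t" using ne by (simp add: ex_in_conv)
    then obtain g where g: "\<And>t. g t \<in> f t" by metis
    show "f s \<subseteq> {g s | g. \<forall>t. g t \<in> f t}"
    proof
      fix a assume "a \<in> f s"
      then have "\<forall>t. (g(s := a)) t \<in> f t" "a = (g(s := a)) s" using g by auto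
      then show "a \<in> {g s | g. \<forall>t. g t \<in> f t}" by blast
    qed
  qed auto
  finally show ?thesis .
qed

text \<open>Injectivity keeps the points of the support apart; points merged by \<open>h\<close>
  would have to share one selection.\<close>

lemma Gen_push:
  assumes fin: "finite {z. \<mu> z \<noteq> 0}" and inj: "inj h" and ne: "\<And>z. V z \<noteq> {}"
  shows "Gen (push h \<mu>) V = Gen \<mu> (\<lambda>z. V (h z))"
proof -
  have p: "push h \<mu> (h z) = \<mu> z" for z
  proof -
    have "{w. \<mu> w \<noteq> 0 \<and> h w = h z} = (if \<mu> z = 0 then {} else {z})" using inj by (auto simp: inj_def)
    then show ?thesis by (simp add: push_def)
  qed
  have p0: "push h \<mu> y = 0" if "y \<notin> range h" for y
  proof -
    have "{w. \<mu> w \<noteq> 0 \<and> h w = y} = {}" using that by auto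
    then show ?thesis unfolding push_def by (simp only: sum.empty)
  qed
  have supp: "{y. push h \<mu> y \<noteq> 0} = h ` {z. \<mu> z \<noteq> 0}" using p p0 by force
  have eq: "(\<Sum>y\<in>{y. push h \<mu> y \<noteq> 0}. ennreal (push h \<mu> y) * k y i) = (\<Sum>z\<in>{z. \<mu> z \<noteq> 0}. ennreal (\<mu> z) * k (h z) i)" for k i
    unfolding supp using inj by (subst sum.reindex) (auto simp: p inj_on_def inj_def)
  show ?thesis
  proof
    show "Gen (push h \<mu>) V \<subseteq> Gen \<mu> (\<lambda>z. V (h z))" by (auto simp: Gen_def eq)
    show "Gen \<mu> (\<lambda>z. V (h z)) \<subseteq> Gen (push h \<mu>) V"
    proof
      fix x assume "x \<in> Gen \<mu> (\<lambda>z. V (h z))"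
      then obtain k where k: "x = (\<lambda>i. \<Sum>z\<in>{z. \<mu> z \<noteq> 0}. ennreal (\<mu> z) * k z i)" "\<And>z. k z \<in> V (h z)"
        by (auto simp: Gen_def)
      define k' where "k' y = (if y \<in> range h then k (inv h y) else SOME a. a \<in> V y)" for y
      have "k' y \<in> V y" for y using k(2) ne[of y] some_in_eq[of "V y"] inj by (auto simp: k'_def)
      moreover have "k' (h z) = k z" for z using inj by (simp add: k'_def)
      ultimately show "x \<in> Gen (push h \<mu>) V" unfolding Gen_def eq k(1)
        by (intro CollectI exI[of _ k']) simp
    qed
  qed
qed

subsection \<open>Approximants of programs\<close>

lemma val_sum: "val (\<lambda>i. \<Sum>z\<in>S. c z * k z i) = (\<lambda>U. \<Sum>z\<in>S. c z * val (k z) U)"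
proof (induction S rule: infinite_finite_induct)
  case (insert z S)
  then show ?case by (simp add: val_def infsum_add ennreal_infsum_cmult fun_eq_iff)
qed (simp_all add: val_def)

lemma val_delta: "val (delta t) = (\<lambda>U. if t \<in> U then 1 else 0)"
  using val_finite_support[of "{t}" "delta t"] by (auto simp: delta_def fun_eq_iff)

lemma simple_fn_delta: "simple_fn (delta t)"
  by (simp add: simple_fn_def delta_def)

lemma cvx_simple_fn: "cvx {v. simple_fn v}"
  unfolding cvx_def
proof (intro ballI allI impI)
  fix a b :: "'a \<Rightarrow> ennreal" and p :: real assume *: "a \<in> {v. simple_fn v}" "b \<in> {v. simple_fn v}"
  have "{i. mixv p a b i \<noteq> 0} \<subseteq> {i. a i \<noteq> 0} \<union> {i. b i \<noteq> 0}" by (auto simp: mixv_def)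
  then have "finite {i. mixv p a b i \<noteq> 0}" using * finite_subset by (auto simp: simple_fn_def)
  moreover have "mixv p a b i \<noteq> top" for i using * by (auto simp: mixv_def simple_fn_def ennreal_mult_eq_top_iff)
  ultimately show "mixv p a b \<in> {v. simple_fn v}" by (simp add: simple_fn_def)
qed

lemma simple_fn_hullE: "(\<And>v. v \<in> X \<Longrightarrow> simple_fn v) \<Longrightarrow> v \<in> hullE X \<Longrightarrow> simple_fn v"
  using hullE_min[of X "{v. simple_fn v}"] cvx_simple_fn by auto

lemma finite_Gen:
  assumes "finite {z. \<mu> z \<noteq> 0}" "\<And>z. \<mu> z \<noteq> 0 \<Longrightarrow> finite (V z)"
  shows "finite (Gen \<mu> V)"
proof (rule finite_subset)
  let ?S = "{z. \<mu> z \<noteq> 0}"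
  show "Gen \<mu> V \<subseteq> (\<lambda>k i. \<Sum>z\<in>?S. ennreal (\<mu> z) * k z i) ` (\<Pi>\<^sub>E z\<in>?S. V z)"
  proof
    fix x assume "x \<in> Gen \<mu> V"
    then obtain k where k: "x = (\<lambda>i. \<Sum>z\<in>?S. ennreal (\<mu> z) * k z i)" "\<And>z. k z \<in> V z" by (auto simp: Gen_def)
    have "x = (\<lambda>i. \<Sum>z\<in>?S. ennreal (\<mu> z) * restrict k ?S z i)" unfolding k(1) by (intro ext sum.cong) auto
    moreover have "restrict k ?S \<in> (\<Pi>\<^sub>E z\<in>?S. V z)" using k(2) by auto
    ultimately show "x \<in> (\<lambda>k i. \<Sum>z\<in>?S. ennreal (\<mu> z) * k z i) ` (\<Pi>\<^sub>E z\<in>?S. V z)" by blast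
  qed
  show "finite ((\<lambda>k i. \<Sum>z\<in>?S. ennreal (\<mu> z) * k z i) ` (\<Pi>\<^sub>E z\<in>?S. V z))"
    using assms by (intro finite_imageI finite_PiE) auto
qed

lemma simple_fn_Gen:
  assumes "finite {z. \<mu> z \<noteq> 0}" "\<And>z v. \<mu> z \<noteq> 0 \<Longrightarrow> v \<in> V z \<Longrightarrow> simple_fn v" "x \<in> Gen \<mu> V"
  shows "simple_fn x"
proof -
  let ?S = "{z. \<mu> z \<noteq> 0}"
  obtain k where k: "x = (\<lambda>i. \<Sum>z\<in>?S. ennreal (\<mu> z) * k z i)" "\<And>z. k z \<in> V z" using assms(3) by (auto simp: Gen_def)
  have f: "simple_fn (k z)" if "z \<in> ?S" for z using assms(2)[of z "k z"] k(2) that by simp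
  have "{i. x i \<noteq> 0} \<subseteq> (\<Union>z\<in>?S. {i. k z i \<noteq> 0})"
  proof
    fix i assume "i \<in> {i. x i \<noteq> 0}"
    then have "\<exists>z\<in>?S. ennreal (\<mu> z) * k z i \<noteq> 0" unfolding k(1) by (metis (mono_tags, lifting) mem_Collect_eq sum.neutral)
    then show "i \<in> (\<Union>z\<in>?S. {i. k z i \<noteq> 0})" by auto
  qed
  moreover have "finite (\<Union>z\<in>?S. {i. k z i \<noteq> 0})" using assms(1) f by (auto simp: simple_fn_def)
  ultimately have "finite {i. x i \<noteq> 0}" by (rule finite_subset)
  moreover have "x i \<noteq> top" for i
    unfolding k(1) using assms(1) f by (auto simp: simple_fn_def ennreal_mult_eq_top_iff)
  ultimately show ?thesis by (simp add: simple_fn_def)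
qed

lemma Gen_point: "(\<And>z. V z \<noteq> {}) \<Longrightarrow> Gen (point y) V = V y"
proof -
  assume ne: "\<And>z. V z \<noteq> {}"
  have s: "{z. point y z \<noteq> 0} = {y}" by (auto simp: point_def)
  have "Gen (point y) V = {k y | k. \<forall>z. k z \<in> V z}" unfolding Gen_def s by (simp add: point_def)
  also have "\<dots> = V y"
  proof
    have "\<forall>t. \<exists>a. a \<in> V t" using ne by (simp add: ex_in_conv)
    then obtain g where g: "\<And>t. g t \<in> V t" by metis
    show "V y \<subseteq> {k y | k. \<forall>z. k z \<in> V z}"
    proof
      fix a assume "a \<in> V y"
      then have "\<forall>t. (g(y := a)) t \<in> V t" "a = (g(y := a)) y" using g by auto
      then show "a \<in> {k y | k. \<forall>z. k z \<in> V z}" by blast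
    qed
  qed auto
  finally show ?thesis .
qed

text \<open>On the left both branches use the same selection at a shared configuration; by convexity two
  different selections can be merged into one.\<close>

lemma Gen_choice:
  assumes fin: "finite {z. \<mu> z \<noteq> 0}" "finite {z. \<nu> z \<noteq> 0}" and pos: "\<And>z. 0 \<le> \<mu> z" "\<And>z. 0 \<le> \<nu> z"
    and p: "0 \<le> p" "p \<le> 1" and V: "\<And>z. cvx (V z)" "\<And>z. V z \<noteq> {}"
  shows "Gen (\<lambda>z. p * \<mu> z + (1 - p) * \<nu> z) V = addS (scaleS p (Gen \<mu> V)) (scaleS (1 - p) (Gen \<nu> V))"
proof -
  let ?S = "{z. \<mu> z \<noteq> 0} \<union> {z. \<nu> z \<noteq> 0}" and ?r = "\<lambda>z. p * \<mu> z + (1 - p) * \<nu> z"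
  have finS: "finite ?S" using fin by simp
  have ext: "(\<Sum>z\<in>{z. \<rho> z \<noteq> 0}. ennreal (\<rho> z) * k z i) = (\<Sum>z\<in>?S. ennreal (\<rho> z) * k z i)"
    if "{z. \<rho> z \<noteq> 0} \<subseteq> ?S" for \<rho> :: "_ \<Rightarrow> real" and k :: "_ \<Rightarrow> _ \<Rightarrow> ennreal" and i
    using that by (intro sum.mono_neutral_left finS) auto
  have r: "ennreal (?r z) = ennreal p * ennreal (\<mu> z) + ennreal (1 - p) * ennreal (\<nu> z)" for z
    using pos[of z] p by (simp add: ennreal_mult)
  have e: "{z. ?r z \<noteq> 0} \<subseteq> ?S" "{z. \<mu> z \<noteq> 0} \<subseteq> ?S" "{z. \<nu> z \<noteq> 0} \<subseteq> ?S" by auto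
  show ?thesis
  proof
    show "Gen ?r V \<subseteq> addS (scaleS p (Gen \<mu> V)) (scaleS (1 - p) (Gen \<nu> V))"
    proof
      fix x assume "x \<in> Gen ?r V"
      then obtain k where k: "x = (\<lambda>i. \<Sum>z\<in>?S. ennreal (?r z) * k z i)" "\<And>z. k z \<in> V z"
        by (auto simp: Gen_def ext[OF e(1)])
      let ?a = "\<lambda>\<rho> i. \<Sum>z\<in>{z. \<rho> z \<noteq> 0}. ennreal (\<rho> z) * k z i"
      have x: "x = (\<lambda>i. ennreal p * ?a \<mu> i + ennreal (1 - p) * ?a \<nu> i)"
        unfolding k(1) ext[OF e(2)] ext[OF e(3)] r
        by (simp add: sum_distrib_left sum.distrib distrib_right mult.assoc)
      have G: "?a \<rho> \<in> Gen \<rho> V" for \<rho> using k(2) by (rule GenI)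
      have "(\<lambda>i. ennreal p * ?a \<mu> i) \<in> scaleS p (Gen \<mu> V)"
        and "(\<lambda>i. ennreal (1 - p) * ?a \<nu> i) \<in> scaleS (1 - p) (Gen \<nu> V)"
        unfolding scaleS_def using G[of \<mu>] G[of \<nu>] by auto
      then show "x \<in> addS (scaleS p (Gen \<mu> V)) (scaleS (1 - p) (Gen \<nu> V))"
        unfolding addS_def x by (intro CollectI exI[of _ "\<lambda>i. ennreal p * ?a \<mu> i"]
            exI[of _ "\<lambda>i. ennreal (1 - p) * ?a \<nu> i"]) simp
    qed
    show "addS (scaleS p (Gen \<mu> V)) (scaleS (1 - p) (Gen \<nu> V)) \<subseteq> Gen ?r V"
    proof
      fix x assume "x \<in> addS (scaleS p (Gen \<mu> V)) (scaleS (1 - p) (Gen \<nu> V))"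
      then obtain k l where kl: "\<And>z. k z \<in> V z" "\<And>z. l z \<in> V z"
        "x = (\<lambda>i. ennreal p * (\<Sum>z\<in>?S. ennreal (\<mu> z) * k z i) + ennreal (1 - p) * (\<Sum>z\<in>?S. ennreal (\<nu> z) * l z i))"
        unfolding addS_def scaleS_def Gen_def ext[OF e(2)] ext[OF e(3)] by blast
      have "\<exists>m\<in>V z. \<forall>i. ennreal (p * \<mu> z) * k z i + ennreal ((1 - p) * \<nu> z) * l z i = ennreal (?r z) * m i" for z
        using pos p kl by (intro mixv_scaled[OF _ _ refl kl(1) V(1)]) auto
      then obtain m where m: "\<And>z. m z \<in> V z"
        "\<And>z i. ennreal (p * \<mu> z) * k z i + ennreal ((1 - p) * \<nu> z) * l z i = ennreal (?r z) * m z i" by metis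
      have "x = (\<lambda>i. \<Sum>z\<in>?S. ennreal (p * \<mu> z) * k z i + ennreal ((1 - p) * \<nu> z) * l z i)"
        unfolding kl(3) using pos p by (simp add: sum_distrib_left sum.distrib ennreal_mult mult.assoc)
      also have "\<dots> = (\<lambda>i. \<Sum>z\<in>{z. ?r z \<noteq> 0}. ennreal (?r z) * m z i)"
        unfolding m(2) ext[OF e(1)] ..
      finally show "x \<in> Gen ?r V" using m(1) by (auto simp: Gen_def)
    qed
  qed
qed

lemma hullE_UN: "hullE (\<Union>i\<in>I. hullE (X i)) = hullE (\<Union>i\<in>I. X i)"
proof
  show "hullE (\<Union>i\<in>I. hullE (X i)) \<subseteq> hullE (\<Union>i\<in>I. X i)"
    by (intro hullE_min cvx_hullE UN_least hullE_mono) auto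
  show "hullE (\<Union>i\<in>I. X i) \<subseteq> hullE (\<Union>i\<in>I. hullE (X i))"
    using hullE_inc by (intro hullE_mono UN_mono) auto
qed

inductive_simps step_simps:
  "step sa sb (Skip, s) \<mu>" "step sa sb (Atom a, s) \<mu>" "step sa sb (Seq P Q, s) \<mu>" "step sa sb (Par P Q, s) \<mu>"
  "step sa sb (PCh p P Q, s) \<mu>" "step sa sb (NCh P Q, s) \<mu>" "step sa sb (If b P Q, s) \<mu>" "step sa sb (While b P, s) \<mu>"

lemma step_ex: "\<exists>\<mu>. step sa sb (P, s) \<mu>"
proof (induction P arbitrary: s)
  case (If b P Q) then show ?case by (cases "sb b s") (auto simp: step_simps)
next
  case (While b P) then show ?case by (cases "sb b s") (auto simp: step_simps)
next
  case (PCh p P Q)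
  then obtain \<mu> \<nu> where "step sa sb (P, s) \<mu>" "step sa sb (Q, s) \<nu>" by blast
  then show ?case by (intro exI) (rule st_pch)
next
  case Skip then show ?case by (intro exI) (rule st_skip)
next
  case (Atom a) then show ?case by (intro exI) (rule st_atom)
next
  case (Seq P Q)
  then obtain \<mu> where "step sa sb (P, s) \<mu>" by blast
  then show ?case by (intro exI) (rule st_seq)
next
  case (Par P Q)
  then obtain \<mu> where "step sa sb (P, s) \<mu>" by blast
  then show ?case by (intro exI) (rule st_parL)
next
  case (NCh P Q)
  then obtain \<mu> where "step sa sb (P, s) \<mu>" by blast
  then show ?case by (intro exI) (rule st_nchL)
qed

text \<open>Finite branching keeps the approximating sets finite, so that their hulls have closed
  saturations.\<close>

lemma step_finite: "finite {\<mu>. step sa sb (P, s) \<mu>}"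
proof (induction P arbitrary: s)
  case (Seq P Q)
  have "{\<mu>. step sa sb (Seq P Q, s) \<mu>} = push (seqmap Q) ` {\<mu>. step sa sb (P, s) \<mu>}"
    by (auto simp: step_simps)
  then show ?case using Seq by simp
next
  case (Par P Q)
  have "{\<mu>. step sa sb (Par P Q, s) \<mu>} = push (parmapL Q) ` {\<mu>. step sa sb (P, s) \<mu>} \<union> push (parmapR P) ` {\<mu>. step sa sb (Q, s) \<mu>}"
    by (auto simp: step_simps)
  then show ?case using Par by simp
next
  case (PCh p P Q)
  have "{\<mu>. step sa sb (PCh p P Q, s) \<mu>} = (\<lambda>(\<mu>, \<nu>) z. p * \<mu> z + (1 - p) * \<nu> z) ` ({\<mu>. step sa sb (P, s) \<mu>} \<times> {\<mu>. step sa sb (Q, s) \<mu>})"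
    by (auto simp: step_simps image_iff)
  then show ?case using PCh by simp
next
  case (NCh P Q)
  have "{\<mu>. step sa sb (NCh P Q, s) \<mu>} = {\<mu>. step sa sb (P, s) \<mu>} \<union> {\<mu>. step sa sb (Q, s) \<mu>}"
    by (auto simp: step_simps)
  then show ?case using NCh by simp
next
  case (If b P Q)
  have "{\<mu>. step sa sb (If b P Q, s) \<mu>} = {if sb b s then point (Inr (P, s)) else point (Inr (Q, s))}"
    by (auto simp: step_simps)
  then show ?case by simp
next
  case (While b P)
  have "{\<mu>. step sa sb (While b P, s) \<mu>} = {if sb b s then point (Inr (Seq P (While b P), s)) else point (Inl s)}"
    by (auto simp: step_simps)
  then show ?case by simp
next
  case Skip
  have "{\<mu>. step sa sb (Skip, s) \<mu>} = {point (Inl s)}" by (auto simp: step_simps)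
  then show ?case by simp
next
  case (Atom a)
  have "{\<mu>. step sa sb (Atom a, s) \<mu>} = {\<lambda>z. case z of Inl t \<Rightarrow> sa a s t | Inr _ \<Rightarrow> 0}"
    by (auto simp: step_simps)
  then show ?case by simp
qed

definition fin_nn :: "('z \<Rightarrow> real) \<Rightarrow> bool" where
  "fin_nn \<mu> \<longleftrightarrow> finite {z. \<mu> z \<noteq> 0} \<and> (\<forall>z. 0 \<le> \<mu> z)"

lemma fin_nn_point: "fin_nn (point y)"
  by (simp add: fin_nn_def point_def)

lemma push_supp: "push h \<mu> y \<noteq> 0 \<Longrightarrow> \<exists>z. \<mu> z \<noteq> 0 \<and> h z = y"
  unfolding push_def by (metis (mono_tags, lifting) mem_Collect_eq sum.neutral)

lemma fin_nn_push: "fin_nn \<mu> \<Longrightarrow> fin_nn (push h \<mu>)"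
proof -
  assume \<mu>: "fin_nn \<mu>"
  have "{y. push h \<mu> y \<noteq> 0} \<subseteq> h ` {z. \<mu> z \<noteq> 0}" using push_supp by fast
  then show ?thesis using \<mu> finite_subset by (auto simp: fin_nn_def push_def intro!: sum_nonneg)
qed

text \<open>A collision between a terminated and a running outcome would require
  \<open>Seq P' Q = Q\<close>, which is impossible by size.\<close>

lemma inj_seqmap: "inj (seqmap (Q :: ('at, 'bc) prog))"
proof -
  have "Seq P Q \<noteq> Q" for P :: "('at, 'bc) prog"
  proof
    assume "Seq P Q = Q"
    then have "size (Seq P Q) = size Q" by (rule arg_cong)
    then show False by simp
  qed
  then show ?thesis unfolding inj_def seqmap_def by (auto split: sum.splits)
qed

primrec FE :: "('at \<Rightarrow> 's \<Rightarrow> 's \<Rightarrow> real) \<Rightarrow> ('bc \<Rightarrow> 's \<Rightarrow> bool) \<Rightarrow> nat \<Rightarrow>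
    ('at, 'bc) prog \<Rightarrow> 's \<Rightarrow> ('s \<Rightarrow> ennreal) set" where
  "FE sa sb 0 P s = {\<lambda>_. 0}"
| "FE sa sb (Suc n) P s = (\<Union>\<mu>\<in>{\<mu>. step sa sb (P, s) \<mu>}.
     Gen \<mu> (case_sum (\<lambda>t. {delta t}) (\<lambda>c. FE sa sb n (fst c) (snd c))))"

lemma FE_ne: "FE sa sb n P s \<noteq> {}"
proof (induction n arbitrary: P s)
  case (Suc n)
  obtain \<mu> where \<mu>: "step sa sb (P, s) \<mu>" using step_ex[of sa sb P s] by (elim exE)
  have "Gen \<mu> (case_sum (\<lambda>t. {delta t}) (\<lambda>c. FE sa sb n (fst c) (snd c))) \<noteq> {}"
    by (rule Gen_ne) (use Suc in \<open>auto split: sum.split\<close>)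
  then show ?case using \<mu> by auto
qed simp

lemma Fn_em: "Fn sa sb n P s = em (FE sa sb n P s)"
proof (induction n arbitrary: P s)
  case 0 then show ?case by (auto simp: em_def vzero_def val_def)
next
  case (Suc n)
  let ?V = "case_sum (\<lambda>t. {delta t}) (\<lambda>c. FE sa sb n (fst c) (snd c))"
  have "{(\<lambda>U. \<Sum>z\<in>{z. \<mu> z \<noteq> 0}. ennreal (\<mu> z) * (case z of Inl t \<Rightarrow> (if t \<in> U then 1 else 0) | Inr c \<Rightarrow> g c U)) | g.
          \<forall>c. \<mu> (Inr c) \<noteq> 0 \<longrightarrow> g c \<in> Fn sa sb n (fst c) (snd c)} = em (Gen \<mu> ?V)" (is "?L = ?R") for \<mu>
  proof
    show "?L \<subseteq> ?R"
    proof
      fix v assume "v \<in> ?L"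
      then obtain g where g: "v = (\<lambda>U. \<Sum>z\<in>{z. \<mu> z \<noteq> 0}. ennreal (\<mu> z) * (case z of Inl t \<Rightarrow> (if t \<in> U then 1 else 0) | Inr c \<Rightarrow> g c U))"
        "\<And>c. \<mu> (Inr c) \<noteq> 0 \<Longrightarrow> g c \<in> em (FE sa sb n (fst c) (snd c))" using Suc by auto
      \<comment> \<open>\<open>Fn\<close> selects only where \<open>\<mu>\<close> is nonzero,
        whereas \<open>Gen\<close> expects a total selection; the gaps are filled with arbitrary
        members, which exist by \<open>FE_ne\<close>.\<close>
      define k where "k z = (case z of Inl t \<Rightarrow> delta t | Inr c \<Rightarrow>
        if \<mu> (Inr c) \<noteq> 0 then unval (g c) else SOME a. a \<in> FE sa sb n (fst c) (snd c))" for z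
      have kg: "val (k (Inr c)) = g c \<and> k (Inr c) \<in> FE sa sb n (fst c) (snd c)" if "\<mu> (Inr c) \<noteq> 0" for c
        using g(2)[OF that] that by (auto simp: k_def em_def)
      have "k z \<in> ?V z" for z
      proof (cases z)
        case (Inr c)
        show ?thesis
        proof (cases "\<mu> (Inr c) = 0")
          case True
          then have "k z = (SOME a. a \<in> FE sa sb n (fst c) (snd c))" using Inr by (simp add: k_def)
          then show ?thesis using Inr FE_ne[of sa sb n "fst c" "snd c"] some_in_eq[of "FE sa sb n (fst c) (snd c)"] by simp
        next
          case False then show ?thesis using kg[of c] Inr by simp
        qed
      qed (simp add: k_def)
      then have "(\<lambda>i. \<Sum>z\<in>{z. \<mu> z \<noteq> 0}. ennreal (\<mu> z) * k z i) \<in> Gen \<mu> ?V" by (rule GenI)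
      moreover have "v = val (\<lambda>i. \<Sum>z\<in>{z. \<mu> z \<noteq> 0}. ennreal (\<mu> z) * k z i)"
        unfolding g(1) val_sum using kg
        by (intro ext sum.cong refl) (auto simp: k_def val_delta split: sum.split)
      ultimately show "v \<in> ?R" by simp
    qed
    show "?R \<subseteq> ?L"
    proof
      fix v assume "v \<in> ?R"
      then obtain k where k: "v = val (\<lambda>i. \<Sum>z\<in>{z. \<mu> z \<noteq> 0}. ennreal (\<mu> z) * k z i)" "\<And>z. k z \<in> ?V z"
        by (auto simp: em_def Gen_def)
      have kl: "k (Inl t) = delta t" "k (Inr c) \<in> FE sa sb n (fst c) (snd c)" for t c
        using k(2)[of "Inl t"] k(2)[of "Inr c"] by auto
      show "v \<in> ?L"
      proof (intro CollectI exI conjI allI impI)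
        show "v = (\<lambda>U. \<Sum>z\<in>{z. \<mu> z \<noteq> 0}. ennreal (\<mu> z) *
            (case z of Inl t \<Rightarrow> (if t \<in> U then 1 else 0) | Inr c \<Rightarrow> val (k (Inr c)) U))"
          unfolding k(1) val_sum by (intro ext sum.cong refl) (auto simp: kl val_delta split: sum.split)
        show "val (k (Inr c)) \<in> Fn sa sb n (fst c) (snd c)" for c using kl(2) by (simp add: Suc)
      qed
    qed
  qed
  then show ?case by (auto simp: em_def)
qed

locale atomic_semantics =
  fixes sa :: "'at \<Rightarrow> 's \<Rightarrow> 's \<Rightarrow> real" and sb :: "'bc \<Rightarrow> 's \<Rightarrow> bool"
  assumes fdist_sa: "fdist (sa a s)"
begin

text \<open>The absence of parallel composition is preserved by steps. The probability bounds
  contained in \<open>nopar\<close> keep both weights of a probabilistic choice nonnegative.\<close>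

lemma step_props:
  "step sa sb (P, s) \<mu> \<Longrightarrow> nopar P \<Longrightarrow> fin_nn \<mu> \<and> (\<forall>c. \<mu> (Inr c) \<noteq> 0 \<longrightarrow> nopar (fst c))"
proof (induction P arbitrary: s \<mu>)
  case Skip then show ?case by (auto simp: step_simps fin_nn_point) (simp add: point_def)
next
  case (Atom a)
  then have \<mu>: "\<mu> = (\<lambda>z. case z of Inl t \<Rightarrow> sa a s t | Inr _ \<Rightarrow> 0)" by (simp add: step_simps)
  have "{z. \<mu> z \<noteq> 0} = Inl ` {t. sa a s t \<noteq> 0}"
  proof (intro set_eqI)
    fix z show "z \<in> {z. \<mu> z \<noteq> 0} \<longleftrightarrow> z \<in> Inl ` {t. sa a s t \<noteq> 0}" by (cases z) (auto simp: \<mu>)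
  qed
  then show ?case using fdist_sa[of a s] by (auto simp: fin_nn_def fdist_def \<mu> split: sum.split)
next
  case (Seq P Q)
  then obtain \<nu> where \<nu>: "step sa sb (P, s) \<nu>" "\<mu> = push (seqmap Q) \<nu>" by (auto simp: step_simps)
  have "nopar P" using Seq.prems(2) by simp
  note i = Seq.IH(1)[OF \<nu>(1) this]
  have IH: "fin_nn \<nu>" "\<And>c. \<nu> (Inr c) \<noteq> 0 \<Longrightarrow> nopar (fst c)" using i by blast+
  have "nopar (fst c)" if c: "\<mu> (Inr c) \<noteq> 0" for c
  proof -
    obtain z where "\<nu> z \<noteq> 0" "seqmap Q z = Inr c" using push_supp[of "seqmap Q" \<nu> "Inr c"] c \<nu>(2) by auto
    then show ?thesis using IH(2)[of "(fst (projr z), snd (projr z))"] Seq.prems(2)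
      by (cases z) (auto simp: seqmap_def)
  qed
  then show ?case using fin_nn_push[OF IH(1)] \<nu>(2) by simp
next
  case (PCh p P Q)
  then obtain \<mu>1 \<mu>2 where m: "step sa sb (P, s) \<mu>1" "step sa sb (Q, s) \<mu>2" "\<mu> = (\<lambda>z. p * \<mu>1 z + (1 - p) * \<mu>2 z)"
    by (auto simp: step_simps)
  have IH: "fin_nn \<mu>1" "\<And>c. \<mu>1 (Inr c) \<noteq> 0 \<Longrightarrow> nopar (fst c)" "fin_nn \<mu>2" "\<And>c. \<mu>2 (Inr c) \<noteq> 0 \<Longrightarrow> nopar (fst c)"
  proof -
    have "nopar P" "nopar Q" using PCh.prems(2) by auto
    note i = PCh.IH(1)[OF m(1) this(1)] PCh.IH(2)[OF m(2) this(2)]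
    then show "fin_nn \<mu>1" "\<And>c. \<mu>1 (Inr c) \<noteq> 0 \<Longrightarrow> nopar (fst c)" "fin_nn \<mu>2" "\<And>c. \<mu>2 (Inr c) \<noteq> 0 \<Longrightarrow> nopar (fst c)"
      by blast+
  qed
  have "{z. \<mu> z \<noteq> 0} \<subseteq> {z. \<mu>1 z \<noteq> 0} \<union> {z. \<mu>2 z \<noteq> 0}" by (auto simp: m(3))
  then have "finite {z. \<mu> z \<noteq> 0}" by (rule finite_subset) (use IH(1,3) in \<open>simp add: fin_nn_def\<close>)
  moreover have "0 \<le> \<mu> z" for z using IH(1,3) PCh.prems(2) by (auto simp: m(3) fin_nn_def)
  moreover have "nopar (fst c)" if "\<mu> (Inr c) \<noteq> 0" for c
  proof (cases "\<mu>1 (Inr c) = 0")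
    case True
    then have "\<mu>2 (Inr c) \<noteq> 0" using that by (auto simp: m(3))
    then show ?thesis by (rule IH(4))
  qed (rule IH(2))
  ultimately show ?case by (simp add: fin_nn_def)
next
  case (NCh P Q)
  have n: "nopar P" "nopar Q" using NCh.prems(2) by auto
  have "step sa sb (P, s) \<mu> \<or> step sa sb (Q, s) \<mu>" using NCh.prems(1) by (simp add: step_simps)
  then show ?case using NCh.IH(1)[OF _ n(1)] NCh.IH(2)[OF _ n(2)] by blast
next
  case (If b P Q) then show ?case by (auto simp: step_simps fin_nn_point) (auto simp: point_def split: if_splits)
next
  case (While b P) then show ?case by (auto simp: step_simps fin_nn_point) (auto simp: point_def split: if_splits)
qed (auto simp: step_simps)

lemma step_fin: "step sa sb (P, s) \<mu> \<Longrightarrow> nopar P \<Longrightarrow> finite {z. \<mu> z \<noteq> 0}"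
  and step_pos: "step sa sb (P, s) \<mu> \<Longrightarrow> nopar P \<Longrightarrow> 0 \<le> \<mu> z"
  and step_nopar: "step sa sb (P, s) \<mu> \<Longrightarrow> nopar P \<Longrightarrow> \<mu> (Inr (P', t)) \<noteq> 0 \<Longrightarrow> nopar P'"
  using step_props[of P s \<mu>] by (auto simp: fin_nn_def)

lemma FE_props: "nopar P \<Longrightarrow> finite (FE sa sb n P s) \<and> (\<forall>v\<in>FE sa sb n P s. simple_fn v)"
proof (induction n arbitrary: P s)
  case 0 then show ?case by (simp add: simple_fn_def)
next
  case (Suc n)
  let ?V = "case_sum (\<lambda>t. {delta t}) (\<lambda>c. FE sa sb n (fst c) (snd c))"
  have V: "finite (?V z) \<and> (\<forall>v\<in>?V z. simple_fn v)" if "step sa sb (P, s) \<mu>" "\<mu> z \<noteq> 0" for \<mu> z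
  proof (cases z)
    case (Inr c)
    then have "nopar (fst c)" using step_nopar[OF that(1) Suc.prems, of "fst c" "snd c"] that(2) by simp
    then show ?thesis using Suc.IH Inr by simp
  qed (simp add: simple_fn_delta)
  have "finite (Gen \<mu> ?V) \<and> (\<forall>v\<in>Gen \<mu> ?V. simple_fn v)" if "step sa sb (P, s) \<mu>" for \<mu>
  proof (intro conjI ballI)
    show "finite (Gen \<mu> ?V)"
      by (rule finite_Gen[OF step_fin[OF that Suc.prems]]) (use V[OF that] in blast)
    show "simple_fn v" if v: "v \<in> Gen \<mu> ?V" for v
      by (rule simple_fn_Gen[OF step_fin[OF \<open>step sa sb (P, s) \<mu>\<close> Suc.prems] _ v])
        (use V[OF \<open>step sa sb (P, s) \<mu>\<close>] in blast)
  qed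
  then show ?case using step_finite[of sa sb P s] by auto
qed

text \<open>Hulls of the sets \<open>F\<^sub>n\<close>, read as sets of functions.\<close>

definition HE :: "nat \<Rightarrow> ('at, 'bc) prog \<Rightarrow> 's \<Rightarrow> ('s \<Rightarrow> ennreal) set" where
  "HE n P s = hullE (FE sa sb n P s)"

definition HV :: "nat \<Rightarrow> 's + ('at, 'bc) prog \<times> 's \<Rightarrow> ('s \<Rightarrow> ennreal) set" where
  "HV n = case_sum (\<lambda>t. {delta t}) (\<lambda>c. HE n (fst c) (snd c))"

lemma HE_ne: "HE n P s \<noteq> {}" by (simp add: HE_def FE_ne)
lemma HV_ne: "HV n z \<noteq> {}" by (cases z) (auto simp: HV_def HE_ne)
lemma cvx_HE: "cvx (HE n P s)" by (simp add: HE_def cvx_hullE)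
lemma cvx_HV: "cvx (HV n z)" by (cases z) (auto simp: HV_def cvx_HE cvx_singleton)
lemma cvx_generator_HE: "nopar P \<Longrightarrow> cvx_generator (HE n P s)"
  unfolding HE_def using FE_props[of P n s] FE_ne[of sa sb n P s] by (intro cvx_generator_hullE) auto
lemma simple_fn_HE: "nopar P \<Longrightarrow> v \<in> HE n P s \<Longrightarrow> simple_fn v"
  unfolding HE_def using FE_props[of P n s] simple_fn_hullE[of "FE sa sb n P s" v] by blast
lemma HE_0: "HE 0 P s = {\<lambda>_. 0}" by (simp add: HE_def hullE_ident cvx_singleton)

text \<open>Taking hulls at the outcomes or after the mixture gives the same set, by
  \<open>Gen_hullE\<close>. The recursion can thus be run on convex sets alone.\<close>

lemma HE_Suc: "nopar P \<Longrightarrow> HE (Suc n) P s = hullE (\<Union>\<mu>\<in>{\<mu>. step sa sb (P, s) \<mu>}. Gen \<mu> (HV n))"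
proof -
  assume P: "nopar P"
  let ?V = "case_sum (\<lambda>t. {delta t}) (\<lambda>c. FE sa sb n (fst c) (snd c))"
  have "HV n = (\<lambda>z. hullE (?V z))"
    by (auto simp: HV_def HE_def fun_eq_iff hullE_ident cvx_singleton split: sum.split)
  moreover have "?V z \<noteq> {}" for z by (cases z) (auto simp: FE_ne)
  ultimately have "Gen \<mu> (HV n) = hullE (Gen \<mu> ?V)" if "step sa sb (P, s) \<mu>" for \<mu>
    using Gen_hullE[OF step_fin[OF that P], of ?V] by simp
  then have "(\<Union>\<mu>\<in>{\<mu>. step sa sb (P, s) \<mu>}. Gen \<mu> (HV n)) = (\<Union>\<mu>\<in>{\<mu>. step sa sb (P, s) \<mu>}. hullE (Gen \<mu> ?V))"
    by auto
  then show ?thesis by (simp only: hullE_UN) (simp add: HE_def)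
qed

text \<open>One more unfolding replaces the zero function at the cut-off by something larger, and
  mixtures, unions and hulls respect domination.\<close>

lemma HE_Suc_EM: "nopar P \<Longrightarrow> EM (HE n P s) (HE (Suc n) P s)"
proof (induction n arbitrary: P s)
  case 0 then show ?case unfolding HE_0 by (intro EM_zero HE_ne)
next
  case (Suc n)
  have "EM (HV n z) (HV (Suc n) z)" if "step sa sb (P, s) \<mu>" "\<mu> z \<noteq> 0" for \<mu> z
  proof (cases z)
    case (Inr c)
    then show ?thesis using Suc.IH step_nopar[OF that(1) Suc.prems, of "fst c" "snd c"] that(2)
      by (simp add: HV_def)
  qed (simp add: HV_def)
  then show ?case unfolding HE_Suc[OF Suc.prems]
    by (intro EM_hullE EM_UN Gen_EM HV_ne) auto
qed

lemma HE_EM: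
  assumes P: "nopar P" and "n \<le> m" shows "EM (HE n P s) (HE m P s)"
  using assms(2)
proof (induction m rule: nat_induct_at_least)
  case (Suc m) then show ?case using HE_Suc_EM[OF P, of m s] EM_trans by blast
qed simp

lemma Gen_push_seqmap:
  assumes "step sa sb (P, s) \<mu>" "nopar P"
  shows "Gen (push (seqmap Q) \<mu>) (HV n) = Gen \<mu> (\<lambda>z. HV n (seqmap Q z))"
  by (rule Gen_push[OF step_fin[OF assms] inj_seqmap HV_ne])

lemma HE_Suc_Seq:
  assumes "nopar P" "nopar Q"
  shows "HE (Suc n) (Seq P Q) s = hullE (\<Union>\<mu>\<in>{\<mu>. step sa sb (P, s) \<mu>}. Gen \<mu> (\<lambda>z. HV n (seqmap Q z)))"
proof -
  have "{\<mu>. step sa sb (Seq P Q, s) \<mu>} = push (seqmap Q) ` {\<mu>. step sa sb (P, s) \<mu>}"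
    by (auto simp: step_simps)
  then have "(\<Union>\<mu>\<in>{\<mu>. step sa sb (Seq P Q, s) \<mu>}. Gen \<mu> (HV n)) =
    (\<Union>\<mu>\<in>{\<mu>. step sa sb (P, s) \<mu>}. Gen (push (seqmap Q) \<mu>) (HV n))" by simp
  also have "\<dots> = (\<Union>\<mu>\<in>{\<mu>. step sa sb (P, s) \<mu>}. Gen \<mu> (\<lambda>z. HV n (seqmap Q z)))"
    by (rule SUP_cong[OF refl]) (simp add: Gen_push_seqmap assms)
  finally show ?thesis using assms by (simp add: HE_Suc)
qed

text \<open>Moves the Kleisli extension past the first step of \<open>P\<close> to its outcomes, the
  common ground of both comparisons for sequential composition.\<close>

lemma klS_HE_Suc:
  fixes n :: nat and s :: 's
  assumes P: "nopar P" and f: "\<And>t. cvx (f t)" "\<And>t. f t \<noteq> {}"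
  defines "R \<equiv> hullE (\<Union>\<mu>\<in>{\<mu>. step sa sb (P, s) \<mu>}. Gen \<mu> (\<lambda>z. klS f (HV n z)))"
  shows "EM (klS f (HE (Suc n) P s)) R" "EM R (klS f (HE (Suc n) P s))"
proof -
  have fsV: "simple_fn v" if "step sa sb (P, s) \<mu>" "\<mu> z \<noteq> 0" "v \<in> HV n z" for \<mu> z v
  proof (cases z)
    case (Inl t) then show ?thesis using that(3) simple_fn_delta by (simp add: HV_def)
  next
    case (Inr c)
    then show ?thesis using step_nopar[OF that(1) P, of "fst c" "snd c"] that(2,3) simple_fn_HE
      by (auto simp: HV_def)
  qed
  have "klS f (\<Union>\<mu>\<in>{\<mu>. step sa sb (P, s) \<mu>}. Gen \<mu> (HV n)) =
    (\<Union>\<mu>\<in>{\<mu>. step sa sb (P, s) \<mu>}. klS f (Gen \<mu> (HV n)))" by (auto simp: klS_def)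
  also have "\<dots> = (\<Union>\<mu>\<in>{\<mu>. step sa sb (P, s) \<mu>}. Gen \<mu> (\<lambda>z. klS f (HV n z)))"
    using step_fin[OF _ P] step_pos[OF _ P] f fsV HV_ne by (intro SUP_cong refl klS_Gen) auto
  finally have R: "R = hullE (klS f (\<Union>\<mu>\<in>{\<mu>. step sa sb (P, s) \<mu>}. Gen \<mu> (HV n)))" by (simp add: R_def)
  show "EM (klS f (HE (Suc n) P s)) R" "EM R (klS f (HE (Suc n) P s))"
    unfolding R HE_Suc[OF P] by (rule EM_klS_hullE[OF f(1)])+
qed

lemma klS_zero: "(\<And>t. f t \<noteq> {}) \<Longrightarrow> klS f {\<lambda>_. 0} = {\<lambda>_. 0}"
proof -
  assume "\<And>t. f t \<noteq> {}"
  then have "\<forall>t. \<exists>a. a \<in> f t" by (simp add: ex_in_conv)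
  then have "\<exists>g. \<forall>t. g t \<in> f t" by (rule choice)
  then show ?thesis by (auto simp: klS_def)
qed

lemma klS_HV_ne: "klS (HE m Q) (HV k z) \<noteq> {}"
  by (simp add: klS_eq_empty HV_ne HE_ne)

text \<open>Budgets \<open>k\<close> for \<open>P\<close> and \<open>m\<close> for \<open>Q\<close>
  fit into \<open>k + m\<close>. Each step of \<open>P\<close> is a step of the composition, and
  when \<open>P\<close> terminates at least \<open>m\<close> steps remain for
  \<open>Q\<close>.\<close>

lemma klS_HE_EM_Seq:
  "nopar P \<Longrightarrow> nopar Q \<Longrightarrow> EM (klS (HE m Q) (HE k P s)) (HE (k + m) (Seq P Q) s)"
proof (induction k arbitrary: P s)
  case 0 then show ?case by (simp add: HE_0 klS_zero EM_zero HE_ne klS_eq_empty)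
next
  case (Suc k)
  have "EM (klS (HE m Q) (HV k z)) (HV (k + m) (seqmap Q z))" if "step sa sb (P, s) \<mu>" "\<mu> z \<noteq> 0" for \<mu> z
  proof (cases z)
    case (Inl t)
    then show ?thesis using Suc.prems HE_ne by (simp add: HV_def seqmap_def klS_delta HE_EM)
  next
    case (Inr c)
    then show ?thesis using Suc.IH Suc.prems step_nopar[OF that(1) Suc.prems(1), of "fst c" "snd c"] that(2)
      by (cases c) (simp add: HV_def seqmap_def)
  qed
  then have "EM (hullE (\<Union>\<mu>\<in>{\<mu>. step sa sb (P, s) \<mu>}. Gen \<mu> (\<lambda>z. klS (HE m Q) (HV k z))))
    (HE (Suc (k + m)) (Seq P Q) s)"
    unfolding HE_Suc_Seq[OF Suc.prems] by (intro EM_hullE EM_UN Gen_EM HV_ne klS_HV_ne) auto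
  then show ?case using EM_trans[OF klS_HE_Suc(1)[OF Suc.prems(1) cvx_HE HE_ne]] by simp
qed

text \<open>The total budget \<open>n\<close> is granted in full to both parts, which can only
  enlarge the result: \<open>Q\<close> actually starts with what \<open>P\<close> has left
  over.\<close>

lemma HE_EM_klS_Seq:
  "nopar P \<Longrightarrow> nopar Q \<Longrightarrow> EM (HE n (Seq P Q) s) (klS (HE n Q) (HE n P s))"
proof (induction n arbitrary: P s)
  case 0 then show ?case by (simp add: HE_0 klS_zero EM_zero HE_ne klS_eq_empty)
next
  case (Suc n)
  \<comment> \<open>The continuation keeps the index \<open>Suc n\<close> while the budget of
    \<open>P\<close> drops to \<open>n\<close>; the induction hypothesis supplies index
    \<open>n\<close>, and monotonicity raises it.\<close>
  let ?f = "HE (Suc n) Q"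
  have "EM (HV n (seqmap Q z)) (klS ?f (HV n z))" if "step sa sb (P, s) \<mu>" "\<mu> z \<noteq> 0" for \<mu> z
  proof (cases z)
    case (Inl t)
    then show ?thesis using Suc.prems HE_ne by (simp add: HV_def seqmap_def klS_delta HE_Suc_EM)
  next
    case (Inr c)
    have "nopar (fst c)" using Inr step_nopar[OF that(1) Suc.prems(1), of "fst c" "snd c"] that(2) by simp
    then have "EM (HE n (Seq (fst c) Q) (snd c)) (klS (HE n Q) (HE n (fst c) (snd c)))"
      using Suc.IH Suc.prems by simp
    moreover have "EM (klS (HE n Q) (HE n (fst c) (snd c))) (klS ?f (HE n (fst c) (snd c)))"
      using Suc.prems by (intro EM_klS HE_Suc_EM EM_refl)
    ultimately have "EM (HE n (Seq (fst c) Q) (snd c)) (klS ?f (HE n (fst c) (snd c)))" by (rule EM_trans)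
    then show ?thesis using Inr by (cases c) (simp add: HV_def seqmap_def)
  qed
  then have "EM (HE (Suc n) (Seq P Q) s)
    (hullE (\<Union>\<mu>\<in>{\<mu>. step sa sb (P, s) \<mu>}. Gen \<mu> (\<lambda>z. klS ?f (HV n z))))"
    unfolding HE_Suc_Seq[OF Suc.prems] by (intro EM_hullE EM_UN Gen_EM HV_ne klS_HV_ne) auto
  then show ?case using klS_HE_Suc(2)[OF Suc.prems(1) cvx_HE HE_ne] by (rule EM_trans)
qed

end

subsection \<open>Limits of chains\<close>

definition chain_lim :: "pk \<Rightarrow> (nat \<Rightarrow> ('s \<Rightarrow> ennreal) set) \<Rightarrow> ('s \<Rightarrow> ennreal) set \<Rightarrow> bool" where
  "chain_lim x X Y \<longleftrightarrow> (\<forall>n. cvx_generator (X n)) \<and> (\<forall>n. ple x (X n) (X (Suc n))) \<and> islim x UNIV X Y \<and> cvx_generator Y"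

lemma ple_chain:
  assumes "\<And>n. ple x (X n) (X (Suc n))" "n \<le> m"
  shows "ple x (X n) (X m)"
  using assms(2)
proof (induction m rule: nat_induct_at_least)
  case (Suc m) then show ?case using assms(1) ple_trans by blast
qed simp

lemma directed_fam_chain: "(\<And>n. ple x (X n) (X (Suc n))) \<Longrightarrow> directed_fam x UNIV X"
  unfolding directed_fam_def using ple_chain[of x X] by (metis UNIV_I UNIV_not_empty max.cobounded1 max.cobounded2)

lemma chain_lim_shift:
  assumes c: "chain_lim x W Y" shows "chain_lim x (\<lambda>n. W (Suc n)) Y"
  using c unfolding chain_lim_def
proof (intro conjI; elim conjE)
    assume W: "\<forall>n. ple x (W n) (W (Suc n))" "islim x UNIV W Y"
    have s1: "scl (\<Union>n. W (Suc n)) = scl (\<Union>n. W n)" if "x \<noteq> PU"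
    proof
      show "scl (\<Union>n. W (Suc n)) \<subseteq> scl (\<Union>n. W n)" by (intro scl_mono) auto
      have "W n \<subseteq> scl (\<Union>n. W (Suc n))" for n
      proof -
        have "W n \<subseteq> scl (W (Suc n))" using W(1) that by (simp add: ple_def scl_subset_iff)
        also have "\<dots> \<subseteq> scl (\<Union>n. W (Suc n))" by (intro scl_mono) auto
        finally show ?thesis .
      qed
      then show "scl (\<Union>n. W n) \<subseteq> scl (\<Union>n. W (Suc n))" unfolding scl_subset_iff by (rule UN_least)
    qed
    have s2: "(\<Inter>n. upE (W (Suc n))) = (\<Inter>n. upE (W n))" if "x \<noteq> PL"
      using W(1) that unfolding ple_def by blast
    show "islim x UNIV (\<lambda>n. W (Suc n)) Y" using W(2) s1 s2 by (simp add: islim_def)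
qed auto

lemma Op_chain:
  assumes \<theta>: "jcont \<theta>" and G: "compact G" and c: "\<And>j. chain_lim x (\<lambda>n. \<A> n j) (B j)"
  shows "islim x UNIV (\<lambda>n. Op G \<theta> (\<A> n)) (Op G \<theta> B)" "ple x (Op G \<theta> (\<A> n)) (Op G \<theta> (\<A> (Suc n)))"
proof -
  have nc: "cvx_generator (\<A> n j)" "ple x (\<A> n j) (\<A> (Suc n) j)" "islim x UNIV (\<lambda>n. \<A> n j) (B j)" "cvx_generator (B j)" for n j
    using c[of j] by (auto simp: chain_lim_def)
  then have ne: "\<A> n j \<noteq> {}" "B j \<noteq> {}" for n j by (auto simp: cvx_generator_def)
  show "islim x UNIV (\<lambda>n. Op G \<theta> (\<A> n)) (Op G \<theta> B)"
  proof (rule Op_islim[OF \<theta> G UNIV_not_empty])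
    show "\<exists>k\<in>UNIV. \<forall>j. ple x (\<A> i j) (\<A> k j) \<and> ple x (\<A> i' j) (\<A> k j)" for i i'
      using ple_chain[of x "\<lambda>n. \<A> n _", OF nc(2)] by (intro bexI[of _ "max i i'"]) auto
  qed (use nc ne in \<open>auto intro: cvx_generator_generator\<close>)
  show "ple x (Op G \<theta> (\<A> n)) (Op G \<theta> (\<A> (Suc n)))" by (intro Op_ple_mono \<theta> ne nc)
qed

lemma chain_lim_addS:
  assumes X: "chain_lim x X Y" and X': "chain_lim x X' Y'" shows "chain_lim x (\<lambda>n. addS (X n) (X' n)) (addS Y Y')"
proof -
  have c: "chain_lim x (\<lambda>n. if j then X n else X' n) (if j then Y else Y')" for j using assms by simp
  note oc = Op_chain[where \<A> = "\<lambda>n j. if j then X n else X' n" and B = "\<lambda>j. if j then Y else Y'",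
      OF jcont_add_op compact_sing[of 0] c, folded addS_Op]
  show ?thesis unfolding chain_lim_def
  proof (intro conjI allI)
    show "cvx_generator (addS (X n) (X' n))" "cvx_generator (addS Y Y')" for n
      using assms by (auto simp: chain_lim_def intro: cvx_generator_addS)
  qed (rule oc)+
qed

lemma chain_lim_joinS:
  assumes X: "chain_lim x X Y" and X': "chain_lim x X' Y'" shows "chain_lim x (\<lambda>n. joinS (X n) (X' n)) (joinS Y Y')"
proof -
  have c: "chain_lim x (\<lambda>n. if j then X n else X' n) (if j then Y else Y')" for j using assms by simp
  note oc = Op_chain[where \<A> = "\<lambda>n j. if j then X n else X' n" and B = "\<lambda>j. if j then Y else Y'",
      OF jcont_mix_op compact_Icc[of 0 1] c, folded joinS_Op]
  show ?thesis unfolding chain_lim_def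
  proof (intro conjI allI)
    show "cvx_generator (joinS (X n) (X' n))" "cvx_generator (joinS Y Y')" for n
      using assms by (auto simp: chain_lim_def intro: cvx_generator_joinS)
  qed (rule oc)+
qed

lemma chain_lim_scaleS:
  assumes X: "chain_lim x X Y" shows "chain_lim x (\<lambda>n. scaleS r (X n)) (scaleS r Y)"
proof -
  note oc = Op_chain[where \<A> = "\<lambda>n _. X n" and B = "\<lambda>_. Y", OF jcont_scale_op compact_sing[of 0] assms,
      folded scaleS_Op]
  show ?thesis unfolding chain_lim_def
  proof (intro conjI allI)
    show "cvx_generator (scaleS r (X n))" "cvx_generator (scaleS r Y)" for n
      using assms by (auto simp: chain_lim_def intro: cvx_generator_scaleS)
  qed (rule oc)+
qed

text \<open>The map and the set to which it is applied grow together; the option-indexed family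
  treats them as arguments of one operation.\<close>

lemma islim_klS:
  assumes "chain_lim x X Y" "\<And>t. chain_lim x (\<lambda>n. f n t) (F t)"
  shows "islim x UNIV (\<lambda>n. klS (f n) (X n)) (klS F Y)"
proof -
  have c: "chain_lim x (\<lambda>n. case_option (X n) (f n) j) (case_option Y F j)" for j using assms by (cases j) auto
  show ?thesis using Op_chain(1)[where \<A> = "\<lambda>n. case_option (X n) (f n)" and B = "case_option Y F" and x = x,
        OF jcont_kl_op compact_sing[of 0] c] by (simp add: klS_Op)
qed

context atomic_semantics
begin

subsection \<open>The denotational equations\<close>

definition SE :: "pk \<Rightarrow> ('at, 'bc) prog \<Rightarrow> 's \<Rightarrow> ('s \<Rightarrow> ennreal) set" where
  "SE x P s = limset x UNIV (\<lambda>n. HE n P s)"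

lemma HE_chain: "nopar P \<Longrightarrow> ple x (HE n P s) (HE (Suc n) P s)"
  by (intro EM_ple HE_Suc_EM)

lemma SE_PCE: "nopar P \<Longrightarrow> SE x P s \<in> PCE x"
  unfolding SE_def by (intro limset_PCE directed_fam_chain HE_chain cvx_generator_generator cvx_generator_HE)

lemma islim_SE: "nopar P \<Longrightarrow> islim x UNIV (\<lambda>n. HE n P s) (SE x P s)"
  unfolding SE_def by (intro islim_limset directed_fam_chain HE_chain cvx_generator_generator cvx_generator_HE)

lemma chain_lim_SE: "nopar P \<Longrightarrow> chain_lim x (\<lambda>n. HE n P s) (SE x P s)"
  unfolding chain_lim_def using cvx_generator_HE HE_chain islim_SE PCE_cvx_generator[OF SE_PCE] by blast

lemma HE_ple_SE: "nopar P \<Longrightarrow> ple x (HE n P s) (SE x P s)"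
  using islim_upper[OF islim_SE] by simp

text \<open>\<open>pc_lub\<close> is a definite description, so the limit has to be identified as
  the unique least upper bound in the cone.\<close>

lemma sem_em: "nopar P \<Longrightarrow> sem x sa sb P s = em (SE x P s)"
proof -
  assume P: "nopar P"
  have g: "generator x (HE n P s)" for n by (intro cvx_generator_generator cvx_generator_HE P)
  have r: "range (\<lambda>n. basic x (Fn sa sb n P s)) = em ` range (\<lambda>n. elt x (HE n P s))"
    by (simp add: Fn_em basic_em HE_def image_image)
  have "islim x UNIV (\<lambda>n. elt x (HE n P s)) (SE x P s)"
    by (rule islim_cong[OF islim_SE[OF P]]) (auto intro: ple_elt elt_ple g)
  then have "is_lub_in (PCE x) (ple x) (range (\<lambda>n. elt x (HE n P s))) (SE x P s)"
    by (rule islim_is_lub[OF _ SE_PCE[OF P]])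
  moreover have "range (\<lambda>n. elt x (HE n P s)) \<subseteq> PCE x" using g elt_PCE by auto
  ultimately have "is_lub_in (PC x) (pc_le x) (em ` range (\<lambda>n. elt x (HE n P s))) (em (SE x P s))"
    using is_lub_PC[OF _ SE_PCE[OF P]] by simp
  then show ?thesis unfolding sem_def pc_lub_def r by (intro the_equality) (assumption, rule is_lub_PC_unique)
qed

text \<open>Describing the approximants from index 1 on is enough, because the chain increases and
  its first member does not affect the supremum.\<close>

lemma SE_shift:
  assumes P: "nopar P" and W: "\<And>n. HE (Suc n) P s = W n" and l: "islim x UNIV W Y" and Y: "Y \<in> PCE x"
  shows "SE x P s = Y"
proof (rule ple_antisym[OF SE_PCE[OF P] Y])
  show "ple x (SE x P s) Y"
  proof (rule islim_least[OF islim_SE[OF P]])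
    fix n
    have "ple x (HE n P s) (W n)" using HE_chain[OF P] by (simp add: W[symmetric])
    then show "ple x (HE n P s) Y" using islim_upper[OF l] ple_trans by blast
  qed
  show "ple x Y (SE x P s)"
    by (rule islim_least[OF l]) (simp add: W[symmetric] HE_ple_SE[OF P])
qed

lemma SE_shift_elt:
  assumes "nopar P" "\<And>n. HE (Suc n) P s = W n" "chain_lim x W Y"
  shows "SE x P s = elt x Y"
proof (rule SE_shift[OF assms(1,2)])
  have g: "generator x Y" using assms(3) cvx_generator_generator by (auto simp: chain_lim_def)
  show "islim x UNIV W (elt x Y)"
    by (rule islim_cong[of x UNIV W Y]) (use assms(3) g in \<open>auto simp: chain_lim_def ple_elt elt_ple\<close>)
  show "elt x Y \<in> PCE x" by (rule elt_PCE[OF g])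
qed

lemma chain_lim_const: "cvx_generator Y \<Longrightarrow> chain_lim x (\<lambda>_. Y) Y"
  by (simp add: chain_lim_def islim_const)

lemma basic_singleton: "basic x {val w} = em (elt x {w})"
  using basic_em[of x "{w}"] by (simp add: em_def hullE_ident[OF cvx_singleton])

lemma vdelta_val: "vdelta s = val (delta s)"
  by (simp add: vdelta_def val_delta)

lemma sem_Skip: "sem x sa sb Skip s = basic x {vdelta s}"
proof -
  have "{\<mu>. step sa sb (Skip, s) \<mu>} = {point (Inl s)}" by (auto simp: step_simps)
  then have "HE (Suc n) Skip s = {delta s}" for n
    by (simp add: HE_Suc Gen_point HV_ne) (simp add: HV_def hullE_ident cvx_singleton)
  then have "SE x Skip s = elt x {delta s}"
    by (intro SE_shift_elt[where W = "\<lambda>_. {delta s}"]) (simp_all add: chain_lim_const cvx_generator_singleton)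
  then show ?thesis by (simp add: sem_em vdelta_val basic_singleton)
qed

lemma sem_Atom: "sem x sa sb (Atom a) s = basic x {dist_val (sa a s)}"
proof -
  let ?\<mu> = "\<lambda>z :: 's + ('at, 'bc) prog \<times> 's. case z of Inl t \<Rightarrow> sa a s t | Inr _ \<Rightarrow> 0"
  define w where "w t = ennreal (sa a s t)" for t
  have fin: "finite {t. sa a s t \<noteq> 0}" and pos: "\<And>t. 0 \<le> sa a s t" using fdist_sa[of a s] by (auto simp: fdist_def)
  have supp: "{z. ?\<mu> z \<noteq> 0} = Inl ` {t. sa a s t \<noteq> 0}"
  proof (intro set_eqI)
    fix z show "z \<in> {z. ?\<mu> z \<noteq> 0} \<longleftrightarrow> z \<in> Inl ` {t. sa a s t \<noteq> 0}" by (cases z) auto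
  qed
  have sum: "(\<Sum>z\<in>{z. ?\<mu> z \<noteq> 0}. ennreal (?\<mu> z) * k z i) = w i" if k: "\<And>t. k (Inl t) = delta t"
    for k :: "_ \<Rightarrow> 's \<Rightarrow> ennreal" and i
  proof -
    have "(\<Sum>z\<in>{z. ?\<mu> z \<noteq> 0}. ennreal (?\<mu> z) * k z i) = (\<Sum>t\<in>{t. sa a s t \<noteq> 0}. ennreal (sa a s t) * delta t i)"
      unfolding supp by (subst sum.reindex) (auto simp: k)
    also have "\<dots> = (\<Sum>t\<in>{t. sa a s t \<noteq> 0}. if i = t then ennreal (sa a s t) else 0)"
      by (intro sum.cong) (auto simp: delta_def)
    also have "\<dots> = w i" using fin by (simp add: w_def)
    finally show ?thesis .
  qed
  have G: "Gen ?\<mu> (HV n) = {w}" for n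
  proof -
    have "Gen ?\<mu> (HV n) \<subseteq> {w}"
    proof
      fix x assume "x \<in> Gen ?\<mu> (HV n)"
      then obtain k where k: "x = (\<lambda>i. \<Sum>z\<in>{z. ?\<mu> z \<noteq> 0}. ennreal (?\<mu> z) * k z i)" "\<And>z. k z \<in> HV n z"
        unfolding Gen_def by blast
      have kd: "k (Inl t) = delta t" for t using k(2)[of "Inl t"] by (simp add: HV_def)
      have "x = w" unfolding k(1) by (rule ext) (rule sum[OF kd])
      then show "x \<in> {w}" by simp
    qed
    then show ?thesis using Gen_ne[of "HV n" ?\<mu>, OF HV_ne] by blast
  qed
  have "{\<mu>. step sa sb (Atom a, s) \<mu>} = {?\<mu>}" by (auto simp: step_simps)
  then have "HE (Suc n) (Atom a) s = {w}" for n by (simp add: HE_Suc G hullE_ident cvx_singleton)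
  then have "SE x (Atom a) s = elt x {w}"
    by (intro SE_shift_elt[where W = "\<lambda>_. {w}"]) (simp_all add: chain_lim_const cvx_generator_singleton)
  moreover have "dist_val (sa a s) = val w"
  proof -
    have "val w = (\<lambda>U. \<Sum>t\<in>{t. sa a s t \<noteq> 0}. if t \<in> U then w t else 0)"
      by (rule val_finite_support[OF fin]) (simp add: w_def)
    then show ?thesis unfolding dist_val_def w_def by simp
  qed
  ultimately show ?thesis by (simp add: sem_em basic_singleton)
qed

text \<open>The two domination lemmas are used along the diagonal, with the same index for both
  parts. Joint continuity makes the diagonal chain converge to the Kleisli image of the
  limits.\<close>

lemma SE_Seq:
  assumes P: "nopar P" and Q: "nopar Q"
  shows "SE x (Seq P Q) s = elt x (klS (SE x Q) (SE x P s))"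
proof -
  have PQ: "nopar (Seq P Q)" using P Q by simp
  have "ple x (SE x (Seq P Q) s) (klS (SE x Q) (SE x P s))"
  proof (rule islim_least[OF islim_SE[OF PQ]])
    fix n
    have "ple x (HE n (Seq P Q) s) (klS (HE n Q) (HE n P s))"
      by (intro EM_ple HE_EM_klS_Seq P Q)
    moreover have "ple x (klS (HE n Q) (HE n P s)) (klS (SE x Q) (SE x P s))"
      using PCE_generator[OF SE_PCE[OF P]] PCE_generator[OF SE_PCE[OF Q]]
      by (intro klS_ple HE_ple_SE P Q HE_ne) (auto simp: generator_def)
    ultimately show "ple x (HE n (Seq P Q) s) (klS (SE x Q) (SE x P s))" by (rule ple_trans)
  qed
  moreover have "ple x (klS (SE x Q) (SE x P s)) (SE x (Seq P Q) s)"
  proof (rule islim_least[OF islim_klS[OF chain_lim_SE[OF P] chain_lim_SE[OF Q]]])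
    fix n
    have "ple x (klS (HE n Q) (HE n P s)) (HE (n + n) (Seq P Q) s)" by (intro EM_ple klS_HE_EM_Seq P Q)
    then show "ple x (klS (HE n Q) (HE n P s)) (SE x (Seq P Q) s)"
      using HE_ple_SE[OF PQ] by (rule ple_trans)
  qed
  ultimately have "elt x (SE x (Seq P Q) s) = elt x (klS (SE x Q) (SE x P s))" by (rule elt_eqI)
  then show ?thesis using elt_PCE_ident[OF SE_PCE[OF PQ]] by simp
qed

lemma sem_fun_em: "nopar Q \<Longrightarrow> sem x sa sb Q = (\<lambda>t. em (SE x Q t))"
  by (rule ext) (rule sem_em)

lemma sem_Seq:
  assumes P: "nopar P" and Q: "nopar Q"
  shows "sem x sa sb (Seq P Q) s = kleisli x (sem x sa sb Q) (sem x sa sb P s)"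
  using kleisli_em[OF SE_PCE[OF Q, of x] SE_PCE[OF P, of x s]] P Q
  by (simp add: sem_fun_em SE_Seq)

lemma sem_PCh:
  assumes P: "nopar P" and Q: "nopar Q" and p: "0 \<le> p" "p \<le> 1"
  shows "sem x sa sb (PCh p P Q) s = padd x (pscale x p (sem x sa sb P s)) (pscale x (1 - p) (sem x sa sb Q s))"
proof -
  have PQ: "nopar (PCh p P Q)" using P Q p by simp
  define W where "W n = addS (scaleS p (HE n P s)) (scaleS (1 - p) (HE n Q s))" for n
  define Y where "Y = addS (scaleS p (SE x P s)) (scaleS (1 - p) (SE x Q s))"
  \<comment> \<open>A probabilistic choice steps together with both branches and spends no step of
    its own, so the index is \<open>Suc n\<close> on both sides.\<close>
  have H: "HE (Suc n) (PCh p P Q) s = W (Suc n)" for n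
  proof -
    let ?X = "\<lambda>P. \<Union>\<mu>\<in>{\<mu>. step sa sb (P, s) \<mu>}. Gen \<mu> (HV n)"
    have G: "Gen (\<lambda>z. p * \<mu> z + (1 - p) * \<nu> z) (HV n) = addS (scaleS p (Gen \<mu> (HV n))) (scaleS (1 - p) (Gen \<nu> (HV n)))"
      if "step sa sb (P, s) \<mu>" "step sa sb (Q, s) \<nu>" for \<mu> \<nu>
      using that step_fin[OF _ P] step_fin[OF _ Q] step_pos[OF _ P] step_pos[OF _ Q] p
      by (intro Gen_choice cvx_HV HV_ne) auto
    have "?X (PCh p P Q) = (\<Union>\<mu>\<in>{\<mu>. step sa sb (P, s) \<mu>}. \<Union>\<nu>\<in>{\<nu>. step sa sb (Q, s) \<nu>}.
        Gen (\<lambda>z. p * \<mu> z + (1 - p) * \<nu> z) (HV n))" by (auto simp: step_simps)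
    also have "\<dots> = (\<Union>\<mu>\<in>{\<mu>. step sa sb (P, s) \<mu>}. \<Union>\<nu>\<in>{\<nu>. step sa sb (Q, s) \<nu>}.
        addS (scaleS p (Gen \<mu> (HV n))) (scaleS (1 - p) (Gen \<nu> (HV n))))" by (simp add: G)
    also have "\<dots> = addS (scaleS p (?X P)) (scaleS (1 - p) (?X Q))"
    proof (intro set_eqI iffI)
      fix z assume "z \<in> addS (scaleS p (?X P)) (scaleS (1 - p) (?X Q))"
      then obtain a b where "z = (\<lambda>s. a s + b s)" "a \<in> scaleS p (?X P)" "b \<in> scaleS (1 - p) (?X Q)"
        by (auto simp: addS_def)
      then obtain \<mu> \<nu> where *: "step sa sb (P, s) \<mu>" "step sa sb (Q, s) \<nu>"
        "a \<in> scaleS p (Gen \<mu> (HV n))" "b \<in> scaleS (1 - p) (Gen \<nu> (HV n))" by (auto simp: scaleS_def)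
      then have "z \<in> addS (scaleS p (Gen \<mu> (HV n))) (scaleS (1 - p) (Gen \<nu> (HV n)))"
        using \<open>z = _\<close> by (auto simp: addS_def)
      then show "z \<in> (\<Union>\<mu>\<in>{\<mu>. step sa sb (P, s) \<mu>}. \<Union>\<nu>\<in>{\<nu>. step sa sb (Q, s) \<nu>}.
          addS (scaleS p (Gen \<mu> (HV n))) (scaleS (1 - p) (Gen \<nu> (HV n))))" using * by blast
    next
      fix z assume "z \<in> (\<Union>\<mu>\<in>{\<mu>. step sa sb (P, s) \<mu>}. \<Union>\<nu>\<in>{\<nu>. step sa sb (Q, s) \<nu>}.
          addS (scaleS p (Gen \<mu> (HV n))) (scaleS (1 - p) (Gen \<nu> (HV n))))"
      then obtain \<mu> \<nu> where *: "step sa sb (P, s) \<mu>" "step sa sb (Q, s) \<nu>"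
        "z \<in> addS (scaleS p (Gen \<mu> (HV n))) (scaleS (1 - p) (Gen \<nu> (HV n)))" by auto
      have "scaleS p (Gen \<mu> (HV n)) \<subseteq> scaleS p (?X P)" "scaleS (1 - p) (Gen \<nu> (HV n)) \<subseteq> scaleS (1 - p) (?X Q)"
        using *(1,2) by (auto simp: scaleS_def)
      then show "z \<in> addS (scaleS p (?X P)) (scaleS (1 - p) (?X Q))" using *(3) unfolding addS_def by blast
    qed
    finally show ?thesis using P Q PQ by (simp add: HE_Suc W_def hullE_addS hullE_scaleS)
  qed
  have c: "chain_lim x W Y" unfolding W_def Y_def by (intro chain_lim_addS chain_lim_scaleS chain_lim_SE P Q)
  then have SE: "SE x (PCh p P Q) s = elt x Y" by (intro SE_shift_elt[OF PQ H] chain_lim_shift)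
  have gs: "generator x (scaleS r (SE x P s))" if "nopar P" for r P
    by (rule cvx_generator_generator[OF cvx_generator_scaleS[OF PCE_cvx_generator[OF SE_PCE[OF that]]]])
  have "padd x (pscale x p (sem x sa sb P s)) (pscale x (1 - p) (sem x sa sb Q s)) =
    em (elt x (addS (elt x (scaleS p (SE x P s))) (elt x (scaleS (1 - p) (SE x Q s)))))"
    using P Q by (simp add: sem_em pscale_em SE_PCE padd_em elt_PCE gs)
  also have "elt x (addS (elt x (scaleS p (SE x P s))) (elt x (scaleS (1 - p) (SE x Q s)))) = elt x Y"
    unfolding Y_def by (intro elt_cong addS_elt gs P Q)
  finally show ?thesis using PQ by (simp add: sem_em SE)
qed

lemma sem_NCh:
  assumes P: "nopar P" and Q: "nopar Q"
  shows "sem x sa sb (NCh P Q) s = punion x (sem x sa sb P s) (sem x sa sb Q s)"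
proof -
  have PQ: "nopar (NCh P Q)" using P Q by simp
  \<comment> \<open>Resolving the choice is part of the first step of the chosen branch, so the
    index is not lowered.\<close>
  have H: "HE (Suc n) (NCh P Q) s = joinS (HE (Suc n) P s) (HE (Suc n) Q s)" for n
  proof -
    let ?X = "\<lambda>P. \<Union>\<mu>\<in>{\<mu>. step sa sb (P, s) \<mu>}. Gen \<mu> (HV n)"
    have "?X (NCh P Q) = ?X P \<union> ?X Q" by (auto simp: step_simps)
    moreover have "?X P \<noteq> {}" for P
      using step_ex[of sa sb P s] Gen_ne[of "HV n", OF HV_ne] by auto
    ultimately show ?thesis using P Q PQ by (simp add: HE_Suc hullE_Un joinS_def)
  qed
  have "chain_lim x (\<lambda>n. joinS (HE n P s) (HE n Q s)) (joinS (SE x P s) (SE x Q s))"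
    by (intro chain_lim_joinS chain_lim_SE P Q)
  then have "SE x (NCh P Q) s = elt x (joinS (SE x P s) (SE x Q s))"
    by (intro SE_shift_elt[OF PQ H] chain_lim_shift)
  then show ?thesis using P Q PQ by (simp add: sem_em punion_em SE_PCE)
qed

text \<open>Unlike the two choices, the test is a step of its own, so the branches enter with index
  \<open>n\<close>.\<close>

lemma HE_If: "nopar P \<Longrightarrow> nopar Q \<Longrightarrow> HE (Suc n) (If b P Q) s = (if sb b s then HE n P s else HE n Q s)"
proof -
  assume *: "nopar P" "nopar Q"
  have "{\<mu>. step sa sb (If b P Q, s) \<mu>} = {if sb b s then point (Inr (P, s)) else point (Inr (Q, s))}"
    by (auto simp: step_simps)
  then show ?thesis using * by (simp add: HE_Suc Gen_point HV_ne) (simp add: HV_def hullE_ident cvx_HE)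
qed

lemma sem_If:
  assumes P: "nopar P" and Q: "nopar Q"
  shows "sem x sa sb (If b P Q) s = (if sb b s then sem x sa sb P s else sem x sa sb Q s)"
proof -
  have I: "nopar (If b P Q)" using P Q by simp
  have "SE x (If b P Q) s = (if sb b s then SE x P s else SE x Q s)"
    by (rule SE_shift[OF I HE_If[OF P Q]]) (use P Q in \<open>auto simp: islim_SE SE_PCE\<close>)
  then show ?thesis using P Q I by (simp add: sem_em)
qed

lemma HE_While:
  "nopar P \<Longrightarrow> HE (Suc n) (While b P) s = (if sb b s then HE n (Seq P (While b P)) s else {delta s})"
proof -
  assume *: "nopar P"
  have "{\<mu>. step sa sb (While b P, s) \<mu>} = {if sb b s then point (Inr (Seq P (While b P), s)) else point (Inl s)}"
    by (auto simp: step_simps)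
  then show ?thesis using *
    by (simp add: HE_Suc Gen_point HV_ne) (simp add: HV_def hullE_ident cvx_HE cvx_singleton)
qed

lemma sem_While:
  assumes P: "nopar P"
  shows "sem x sa sb (While b P) s =
    (if sb b s then kleisli x (sem x sa sb (While b P)) (sem x sa sb P s) else peta x s)"
proof (cases "sb b s")
  case True
  have W: "nopar (While b P)" "nopar (Seq P (While b P))" using P by simp_all
  have "SE x (While b P) s = SE x (Seq P (While b P)) s"
    by (rule SE_shift[OF W(1) HE_While[OF P]]) (use True W(2) in \<open>auto simp: islim_SE SE_PCE\<close>)
  then have "sem x sa sb (While b P) s = sem x sa sb (Seq P (While b P)) s" using W by (simp only: sem_em)
  also have "\<dots> = kleisli x (sem x sa sb (While b P)) (sem x sa sb P s)" by (rule sem_Seq[OF P W(1)])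
  finally show ?thesis using True by simp
next
  case False
  have W: "nopar (While b P)" using P by simp
  have "SE x (While b P) s = elt x {delta s}"
    by (rule SE_shift_elt[OF W]) (use False P in \<open>auto simp: HE_While intro: chain_lim_const cvx_generator_singleton\<close>)
  then show ?thesis using False W by (simp add: sem_em peta_def vdelta_val basic_singleton)
qed

text \<open>Every approximant of the loop lies below the given fixpoint, by induction on its index.
  Representing the fixpoint by sets of functions makes its Kleisli extension available as
  \<open>klS h\<close>.\<close>

lemma sem_While_least:
  assumes P: "nopar P" and gP: "\<And>s. g s \<in> PC x"
    and fix_g: "\<And>s. g s = (if sb b s then kleisli x g (sem x sa sb P s) else peta x s)"
  shows "pc_le x (sem x sa sb (While b P) s) (g s)"
proof -
  have W: "nopar (While b P)" using P by simp
  define h where "h s = unval ` g s" for s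
  have g: "g s = em (h s) \<and> h s \<in> PCE x" for s
  proof -
    obtain A where "A \<in> PCE x" "g s = em A" using gP[of s] by (rule PC_E)
    then show ?thesis by (simp add: h_def)
  qed
  then have geq: "g = (\<lambda>t. em (h t))" and hP: "\<And>s. h s \<in> PCE x" by auto
  have hne: "h s \<noteq> {}" for s using PCE_generator[OF hP] by (simp add: generator_def)
  have SPne: "SE x P s \<noteq> {}" for s using PCE_generator[OF SE_PCE[OF P]] by (simp add: generator_def)
  have "ple x (HE n (While b P) s) (h s)" for n
  proof (induction n arbitrary: s)
    case 0 show ?case unfolding HE_0 by (intro EM_ple EM_zero hne)
  next
    case (Suc n)
    show ?case
    proof (cases "sb b s")
      case True
      have "em (h s) = em (elt x (klS h (SE x P s)))"
        using fix_g[of s] True kleisli_em[OF hP SE_PCE[OF P, of x s]] P by (simp add: geq sem_em)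
      then have hs: "h s = elt x (klS h (SE x P s))" by simp
      have gk: "generator x (klS h (SE x P s))" by (rule generator_klS[OF PCE_cvx_generator[OF SE_PCE[OF P]] PCE_cvx_generator[OF hP]])
      \<comment> \<open>The unfolding has used one step, so the loop reappears as continuation with
        index \<open>n\<close>, where the induction hypothesis applies at every state.\<close>
      have "ple x (HE n (Seq P (While b P)) s) (klS (HE n (While b P)) (HE n P s))"
        by (intro EM_ple HE_EM_klS_Seq P W)
      moreover have "ple x (klS (HE n (While b P)) (HE n P s)) (klS h (SE x P s))"
        by (intro klS_ple HE_ple_SE Suc P HE_ne hne SPne)
      ultimately have "ple x (HE n (Seq P (While b P)) s) (klS h (SE x P s))" by (rule ple_trans)
      then have "ple x (HE n (Seq P (While b P)) s) (h s)" unfolding hs using ple_elt[OF gk] by (rule ple_trans)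
      then show ?thesis using True P by (simp add: HE_While)
    next
      case False
      have "em (h s) = em (elt x {delta s})"
        using fix_g[of s] False by (simp add: geq peta_def vdelta_val basic_singleton)
      then have "h s = elt x {delta s}" by simp
      then show ?thesis using False P ple_elt[OF cvx_generator_generator[OF cvx_generator_singleton[of "delta s"]], of x] by (simp add: HE_While)
    qed
  qed
  then have "ple x (SE x (While b P) s) (h s)" by (intro islim_least[OF islim_SE[OF W]])
  then show ?thesis using g[of s] W by (simp add: sem_em pc_le_em SE_PCE)
qed

end

theorem mainTheorem9:
  fixes x :: pk
    and sa :: "'at \<Rightarrow> 's \<Rightarrow> 's \<Rightarrow> real" and sb :: "'bc \<Rightarrow> 's \<Rightarrow> bool"
    and P Q :: "('at, 'bc) prog" and s :: 's and a :: 'at and b :: 'bc and p :: real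
  assumes "\<forall>a s. fdist (sa a s)"
    and "nopar P" and "nopar Q" and "0 \<le> p" and "p \<le> 1"
  shows "sem x sa sb Skip s = basic x {vdelta s}
    \<and> sem x sa sb (Atom a) s = basic x {dist_val (sa a s)}
    \<and> sem x sa sb (Seq P Q) = kleisli x (sem x sa sb Q) \<circ> sem x sa sb P
    \<and> sem x sa sb (PCh p P Q) s = padd x (pscale x p (sem x sa sb P s)) (pscale x (1 - p) (sem x sa sb Q s))
    \<and> sem x sa sb (NCh P Q) s = punion x (sem x sa sb P s) (sem x sa sb Q s)
    \<and> sem x sa sb (If b P Q) s = (if sb b s then sem x sa sb P s else sem x sa sb Q s)
    \<and> is_lfp x (\<lambda>f s. if sb b s then kleisli x f (sem x sa sb P s) else peta x s)
               (sem x sa sb (While b P))"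
proof -
  interpret atomic_semantics sa sb by standard (use assms(1) in blast)
  have "sem x sa sb (Seq P Q) = kleisli x (sem x sa sb Q) \<circ> sem x sa sb P"
    by (rule ext) (simp add: sem_Seq assms(2,3))
  moreover have "is_lfp x (\<lambda>f s. if sb b s then kleisli x f (sem x sa sb P s) else peta x s) (sem x sa sb (While b P))"
    unfolding is_lfp_def
  proof (intro conjI allI impI)
    show "sem x sa sb (While b P) s \<in> PC x" for s using assms(2) by (simp add: sem_em SE_PCE)
    show "(\<lambda>s. if sb b s then kleisli x (sem x sa sb (While b P)) (sem x sa sb P s) else peta x s) = sem x sa sb (While b P)"
      by (rule ext) (rule sem_While[OF assms(2), symmetric])
    fix g s assume g: "\<forall>s. g s \<in> PC x" "(\<lambda>s. if sb b s then kleisli x g (sem x sa sb P s) else peta x s) = g"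
    show "pc_le x (sem x sa sb (While b P) s) (g s)"
      by (rule sem_While_least[OF assms(2)]) (use g fun_cong[OF g(2)] in auto)
  qed
  ultimately show ?thesis
    using sem_Skip sem_Atom sem_PCh[OF assms(2-5)] sem_NCh[OF assms(2,3)] sem_If[OF assms(2,3)] by blast
qed

end
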